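(* Let $n\ge 1$, let $\varphi$ be a CNF over variables $x_1,\dots,x_n$, let $p(n)$ be a size bound, and let $\mu,\epsilon,\gamma,\delta,\beta\in(0,1)$. Put $m_1=\frac{1}{2\gamma^2}\ln\frac{2}{\delta}$ and $w=\frac{1}{\mu\beta}\ln\frac{2m_1\cdot p(n)}{\delta}$. Let $D$ be a distribution over $\{0,1\}^n$ that has a width-$w$ $\left(\beta,1-\frac{\gamma}{4n(2n+1)^w}\right)$ correlation gap, and suppose Algorithm Learn+RES (described in the context) is given $\varphi,p(n),\epsilon,\delta,\gamma,\beta$ and independent partial assignments drawn from $M_\mu(D)$. Suppose that one of the following two cases holds: (1) $\Pr_{x\sim D}[\varphi(x)=1]\ge \epsilon+2\gamma$; or (2) there exist CNFs $\psi_0$ and $\psi_1$ such that every clause of $\psi_0$ is $\left(1-\frac{\gamma}{4n(2n+1)^w}\right)$-valid under $D$, $\psi_1$ is witnessed to evaluate to true with probability $1-\epsilon+2\gamma$ on $\rho\sim M_\mu(D)$, and there is a resolution refutation of size $p(n)$ of $\psi_0\wedge\psi_1\wedge\varphi$. Then with probability at least $1-\delta$, Algorithm Learn+RES decides which case holds (it rejects in case (1) and accepts in case (2)), and it runs in time $n^{O(\frac{1}{\mu\beta}\log\frac{p(n)}{\gamma\delta})}$.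
   Context: A literal is a variable $x_i$ or its negation $\neg x_i$; a clause is a disjunction of literals, its width is its number of literals; a CNF is a conjunction of clauses. For a distribution $D$ over $\{0,1\}^n$, a formula $\varphi$ is $(1-\epsilon)$-valid if $\Pr_{x\sim D}[\varphi(x)=1]\ge 1-\epsilon$. Correlation gap: $D$ has a width-$w$ $(\beta,1-\gamma')$ correlation gap if for every conjunction of $k\le w$ literals $\ell_1\wedge\cdots\wedge\ell_k$ with nonzero probability under $D$ and every variable $x$, either $\Pr[x=1\mid \ell_1\wedge\cdots\wedge\ell_k]\ge\beta$ and $\Pr[x=0\mid\ell_1\wedge\cdots\wedge\ell_k]\ge\beta$ (``$x$ is $\beta$-balanced for the conjunction''), or for some $b\in\{0,1\}$, $\Pr[x=b\mid\ell_1\wedge\cdots\wedge\ell_k]\ge 1-\gamma'$ (``$x$ (if $b=1$), resp. $\neg x$ (if $b=0$), is $(1-\gamma')$-implied by the conjunction''). Partial assignments and masking: a partial assignment is $\rho\in\{0,1,*\}^n$. The independent masking process $M_\mu$ maps $x\in\{0,1\}^n$ to $\rho$ with $\rho_i=x_i$ independently with probability $\mu$ and $\rho_i=*$ otherwise; $M_\mu(D)$ is the distribution of $M_\mu(x)$ for $x\sim D$. A literal $\ell$ on $x_i$ is unmasked in $\rho$ if $\rho_i\neq *$. A clause is witnessed to evaluate to true on $\rho$ if some literal $\ell(x_i)$ of it has $\rho_i\ne *$ and $\ell(\rho_i)=1$; it is witnessed to evaluate to false on $\rho$ if every literal $\ell(x_i)$ of it has $\rho_i\ne *$ and $\ell(\rho_i)=0$.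 A CNF is witnessed to evaluate to true on $\rho$ if all its clauses are. Restriction: for a clause $C$, $C|_\rho$ is the constant true $\top$ if $C$ is witnessed true on $\rho$, and otherwise the clause consisting of the literals of $C$ on variables $x_i$ with $\rho_i=*$. For a CNF $\varphi$, $\varphi|_\rho$ is the contradiction $\bot$ if some clause is witnessed false on $\rho$, otherwise the conjunction of $C|_\rho$ over clauses $C$ not witnessed true. Resolution: a resolution refutation of a CNF $\varphi$ is a sequence of clauses $C_1,\dots,C_k$ with $C_k$ the empty clause, each $C_i$ being either a clause of $\varphi$, a superclause of some earlier $C_j$ (weakening), or $D\vee E$ where $D\vee x$ and $E\vee\neg x$ are earlier clauses (cut). Its size is $k$; its width is the maximum clause width. Algorithm Learn+RES: input $\varphi,p(n),\epsilon,\delta,\gamma,\beta$, and partial assignments $\rho^{(1)},\dots,\rho^{(m_0+m_1)}$ from $M_\mu(D)$, where $m_0=\frac{2w(2n+1)^{2w}}{\mu^{2w}\gamma^2}\ln\frac{4(2n+1)}{\delta}$ and $m_1,w$ are as in the claim. (i) Let $\psi$ be the conjunction of all clauses $C$ of width at most $w$ that are witnessed to evaluate to false on at most $\frac{\gamma\mu^w}{2(2n+1)^w}m_0$ of $\rho^{(1)},\dots,\rho^{(m_0)}$. (ii) For each clause $C$ of $\varphi$: for each clause $C'$ of $\psi$ in turn, if $C'=C''\vee\ell$ where $C''\vee\neg\ell$ is a subclause of (the current) $C$, delete $\neg\ell$ from $C$; add the resulting $C$ to a CNF $\varphi'$. (iii) For $i=m_0+1,\dots,m_0+m_1$, decide (by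 exhaustive search over clauses of width at most $2w$) whether $(\varphi'\wedge\psi)|_{\rho^{(i)}}$ has a resolution refutation of width at most $2w$; count the $i$ for which it does not; as soon as this count exceeds $\lfloor\epsilon m_1\rfloor$, output Reject. If the loop finishes, output Accept.
   Formalization: w is capped at n (false otherwise, e.g. n=1); m0, m1, w are rounded up; in step (ii) C'' may not contain ℓ or ¬ℓ (x∨¬x would delete every literal); the time bound has a factor |φ|+1 and is stated for n≥2, p(n)≥2, as it fails for huge φ, n=1, or p(n)=1 with γδ near 1. *)

theory Defs
  imports "HOL-Probability.Probability" "HOL-Library.Monad_Syntax"
begin

section \<open>Clauses, CNFs and partial assignments\<close>

text \<open>
  The variables are \<open>0, \<dots>, n - 1\<close>; the literal \<open>(i, True)\<close> is the variable \<open>i\<close> and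
  \<open>(i, False)\<close> is its negation.  A clause is the set of its literals; complementary literals are
  allowed to occur together.
\<close>

type_synonym lit = "nat \<times> bool"
type_synonym clause = "lit set"
type_synonym cnf = "clause set"
type_synonym assignment = "nat \<Rightarrow> bool"
type_synonym passignment = "nat \<Rightarrow> bool option"

definition neg :: "lit \<Rightarrow> lit" where
  "neg l = (fst l, \<not> snd l)"

definition lits :: "nat \<Rightarrow> lit set" where
  "lits n = {..<n} \<times> UNIV"

definition cnf_over :: "nat \<Rightarrow> cnf \<Rightarrow> bool" where
  "cnf_over n \<phi> \<longleftrightarrow> (\<forall>C\<in>\<phi>. C \<subseteq> lits n)"

definition width :: "clause \<Rightarrow> nat" where
  "width C = card C"

definition lit_true :: "assignment \<Rightarrow> lit \<Rightarrow> bool" where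
  "lit_true x l \<longleftrightarrow> x (fst l) = snd l"

definition clause_true :: "assignment \<Rightarrow> clause \<Rightarrow> bool" where
  "clause_true x C \<longleftrightarrow> (\<exists>l\<in>C. lit_true x l)"

definition cnf_true :: "assignment \<Rightarrow> cnf \<Rightarrow> bool" where
  "cnf_true x \<phi> \<longleftrightarrow> (\<forall>C\<in>\<phi>. clause_true x C)"

definition conj_true :: "assignment \<Rightarrow> lit set \<Rightarrow> bool" where
  "conj_true x L \<longleftrightarrow> (\<forall>l\<in>L. lit_true x l)"

text \<open>In a partial assignment, \<open>None\<close> plays the role of the symbol \<open>*\<close>.\<close>

definition witnessed_true :: "passignment \<Rightarrow> clause \<Rightarrow> bool" where
  "witnessed_true \<rho> C \<longleftrightarrow> (\<exists>l\<in>C. \<rho> (fst l) = Some (snd l))"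

definition witnessed_false :: "passignment \<Rightarrow> clause \<Rightarrow> bool" where
  "witnessed_false \<rho> C \<longleftrightarrow> (\<forall>l\<in>C. \<rho> (fst l) = Some (\<not> snd l))"

definition cnf_witnessed_true :: "passignment \<Rightarrow> cnf \<Rightarrow> bool" where
  "cnf_witnessed_true \<rho> \<phi> \<longleftrightarrow> (\<forall>C\<in>\<phi>. witnessed_true \<rho> C)"

definition restrict_clause :: "passignment \<Rightarrow> clause \<Rightarrow> clause" where
  "restrict_clause \<rho> C = {l \<in> C. \<rho> (fst l) = None}"

text \<open>The contradiction is the CNF whose only clause is the empty one.\<close>

definition restrict_cnf :: "passignment \<Rightarrow> cnf \<Rightarrow> cnf" where
  "restrict_cnf \<rho> \<phi> =
     (if \<exists>C\<in>\<phi>. witnessed_false \<rho> C then {{}}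
      else restrict_clause \<rho> ` {C \<in> \<phi>. \<not> witnessed_true \<rho> C})"

section \<open>Distributions\<close>

definition distribution_over :: "nat \<Rightarrow> assignment pmf \<Rightarrow> bool" where
  "distribution_over n D \<longleftrightarrow> set_pmf D \<subseteq> PiE_dflt {..<n} False (\<lambda>_. UNIV)"

definition clause_valid :: "assignment pmf \<Rightarrow> real \<Rightarrow> clause \<Rightarrow> bool" where
  "clause_valid D a C \<longleftrightarrow> \<P>(x in D. clause_true x C) \<ge> a"

definition balanced :: "assignment pmf \<Rightarrow> real \<Rightarrow> lit set \<Rightarrow> nat \<Rightarrow> bool" where
  "balanced D \<beta> L i \<longleftrightarrow>
     \<P>(x in D. x i = True \<bar> conj_true x L) \<ge> \<beta> \<and> \<P>(x in D. x i = False \<bar> conj_true x L) \<ge> \<beta>"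

definition implied :: "assignment pmf \<Rightarrow> real \<Rightarrow> lit set \<Rightarrow> lit \<Rightarrow> bool" where
  "implied D a L l \<longleftrightarrow> \<P>(x in D. lit_true x l \<bar> conj_true x L) \<ge> a"

definition correlation_gap :: "nat \<Rightarrow> nat \<Rightarrow> real \<Rightarrow> real \<Rightarrow> assignment pmf \<Rightarrow> bool" where
  "correlation_gap n w \<beta> a D \<longleftrightarrow>
     (\<forall>L \<subseteq> lits n. card L \<le> w \<longrightarrow> \<P>(x in D. conj_true x L) \<noteq> 0 \<longrightarrow>
        (\<forall>i<n. balanced D \<beta> L i \<or> (\<exists>b. implied D a L (i, b))))"

definition mask :: "nat \<Rightarrow> real \<Rightarrow> assignment \<Rightarrow> passignment pmf" where
  "mask n \<mu> x = map_pmf (\<lambda>keep i. if keep i then Some (x i) else None)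
                   (Pi_pmf {..<n} False (\<lambda>_. bernoulli_pmf \<mu>))"

definition masked :: "nat \<Rightarrow> real \<Rightarrow> assignment pmf \<Rightarrow> passignment pmf" where
  "masked n \<mu> D = bind_pmf D (mask n \<mu>)"

section \<open>Resolution\<close>

definition inferred :: "cnf \<Rightarrow> clause set \<Rightarrow> clause \<Rightarrow> bool" where
  "inferred \<phi> S C \<longleftrightarrow>
     C \<in> \<phi> \<or>
     (\<exists>B\<in>S. B \<subseteq> C) \<or>
     (\<exists>D E i. D \<union> {(i, True)} \<in> S \<and> E \<union> {(i, False)} \<in> S \<and> C = D \<union> E)"

definition resolution_refutation :: "nat \<Rightarrow> cnf \<Rightarrow> clause list \<Rightarrow> bool" where
  "resolution_refutation n \<phi> Cs \<longleftrightarrow>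
     Cs \<noteq> [] \<and> last Cs = {} \<and>
     (\<forall>i<length Cs. Cs ! i \<subseteq> lits n \<and> inferred \<phi> (set (take i Cs)) (Cs ! i))"

definition has_refutation_of_width :: "nat \<Rightarrow> cnf \<Rightarrow> nat \<Rightarrow> bool" where
  "has_refutation_of_width n \<phi> k \<longleftrightarrow>
     (\<exists>Cs. resolution_refutation n \<phi> Cs \<and> (\<forall>C\<in>set Cs. width C \<le> k))"

section \<open>Step-counting programs\<close>

text \<open>
  A program returns a value together with the number of steps spent.  Every call of a (possibly
  recursive) list operation costs one step; operations on numbers, comparison of two literals, and
  looking up a variable in a partial assignment are free.  A list operation performs at most a
  constant number of them per call.
\<close>

datatype 'a tm = TM (val: 'a) (time: nat)

definition ret :: "'a \<Rightarrow> 'a tm" where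
  "ret x = TM x 0"

definition bind_tm :: "'a tm \<Rightarrow> ('a \<Rightarrow> 'b tm) \<Rightarrow> 'b tm" where
  "bind_tm m f = TM (val (f (val m))) (time m + time (f (val m)))"

adhoc_overloading Monad_Syntax.bind \<rightleftharpoons> bind_tm

definition tick :: "'a tm \<Rightarrow> 'a tm" where
  "tick m = TM (val m) (Suc (time m))"

lemma bind_tm_cong [fundef_cong]:
  "m = m' \<Longrightarrow> (\<And>x. x = val m' \<Longrightarrow> f x = f' x) \<Longrightarrow> bind_tm m f = bind_tm m' f'"
  by (simp add: bind_tm_def)

lemma val_simps [simp]:
  "val (ret x) = x" "val (bind_tm m f) = val (f (val m))" "val (tick m) = val m"
  by (simp_all add: ret_def bind_tm_def tick_def)

lemma time_simps [simp]:
  "time (ret x) = 0" "time (bind_tm m f) = time m + time (f (val m))" "time (tick m) = Suc (time m)"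
  by (simp_all add: ret_def bind_tm_def tick_def)

fun map_tm :: "('a \<Rightarrow> 'b tm) \<Rightarrow> 'a list \<Rightarrow> 'b list tm" where
  "map_tm f [] = tick (ret [])"
| "map_tm f (x # xs) = tick (do {y \<leftarrow> f x; ys \<leftarrow> map_tm f xs; ret (y # ys)})"

fun filter_tm :: "('a \<Rightarrow> bool tm) \<Rightarrow> 'a list \<Rightarrow> 'a list tm" where
  "filter_tm P [] = tick (ret [])"
| "filter_tm P (x # xs) =
     tick (do {b \<leftarrow> P x; ys \<leftarrow> filter_tm P xs; ret (if b then x # ys else ys)})"

fun ex_tm :: "('a \<Rightarrow> bool tm) \<Rightarrow> 'a list \<Rightarrow> bool tm" where
  "ex_tm P [] = tick (ret False)"
| "ex_tm P (x # xs) = tick (do {b \<leftarrow> P x; if b then ret True else ex_tm P xs})"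

fun all_tm :: "('a \<Rightarrow> bool tm) \<Rightarrow> 'a list \<Rightarrow> bool tm" where
  "all_tm P [] = tick (ret True)"
| "all_tm P (x # xs) = tick (do {b \<leftarrow> P x; if b then all_tm P xs else ret False})"

fun fold_tm :: "('a \<Rightarrow> 'b \<Rightarrow> 'b tm) \<Rightarrow> 'a list \<Rightarrow> 'b \<Rightarrow> 'b tm" where
  "fold_tm f [] s = tick (ret s)"
| "fold_tm f (x # xs) s = tick (do {s' \<leftarrow> f x s; fold_tm f xs s'})"

fun length_tm :: "'a list \<Rightarrow> nat tm" where
  "length_tm [] = tick (ret 0)"
| "length_tm (x # xs) = tick (do {k \<leftarrow> length_tm xs; ret (Suc k)})"

fun append_tm :: "'a list \<Rightarrow> 'a list \<Rightarrow> 'a list tm" where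
  "append_tm [] ys = tick (ret ys)"
| "append_tm (x # xs) ys = tick (do {zs \<leftarrow> append_tm xs ys; ret (x # zs)})"

fun split_tm :: "nat \<Rightarrow> 'a list \<Rightarrow> ('a list \<times> 'a list) tm" where
  "split_tm 0 xs = tick (ret ([], xs))"
| "split_tm (Suc k) [] = tick (ret ([], []))"
| "split_tm (Suc k) (x # xs) = tick (do {p \<leftarrow> split_tm k xs; ret (x # fst p, snd p)})"

definition mem_tm :: "'a \<Rightarrow> 'a list \<Rightarrow> bool tm" where
  "mem_tm l C = tick (ex_tm (\<lambda>k. ret (k = l)) C)"

definition subset_tm :: "'a list \<Rightarrow> 'a list \<Rightarrow> bool tm" where
  "subset_tm C D = tick (all_tm (\<lambda>l. mem_tm l D) C)"

definition delete_tm :: "'a \<Rightarrow> 'a list \<Rightarrow> 'a list tm" where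
  "delete_tm l C = tick (filter_tm (\<lambda>k. ret (k \<noteq> l)) C)"

section \<open>The algorithm\<close>

text \<open>Programs represent a clause by a list of its literals and a CNF by a list of such lists.\<close>

definition cnf_of :: "lit list list \<Rightarrow> cnf" where
  "cnf_of \<phi> = set ` set \<phi>"

definition cnf_size :: "lit list list \<Rightarrow> nat" where
  "cnf_size \<phi> = (\<Sum>C\<leftarrow>\<phi>. Suc (length C))"

fun lits_tm :: "nat \<Rightarrow> lit list tm" where
  "lits_tm 0 = tick (ret [])"
| "lits_tm (Suc n) = tick (do {ls \<leftarrow> lits_tm n; ret ((n, True) # (n, False) # ls)})"

fun sublists_tm :: "nat \<Rightarrow> 'a list \<Rightarrow> 'a list list tm" where
  "sublists_tm k [] = tick (ret [[]])"
| "sublists_tm 0 (l # ls) = tick (ret [[]])"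
| "sublists_tm (Suc k) (l # ls) =
     tick (do {
       As \<leftarrow> sublists_tm k ls;
       Bs \<leftarrow> sublists_tm (Suc k) ls;
       As' \<leftarrow> map_tm (\<lambda>C. ret (l # C)) As;
       append_tm As' Bs})"

definition clauses_tm :: "nat \<Rightarrow> nat \<Rightarrow> lit list list tm" where
  "clauses_tm n k = tick (do {ls \<leftarrow> lits_tm n; sublists_tm k ls})"

definition witnessed_true_tm :: "passignment \<Rightarrow> lit list \<Rightarrow> bool tm" where
  "witnessed_true_tm \<rho> C = tick (ex_tm (\<lambda>l. ret (\<rho> (fst l) = Some (snd l))) C)"

definition witnessed_false_tm :: "passignment \<Rightarrow> lit list \<Rightarrow> bool tm" where
  "witnessed_false_tm \<rho> C = tick (all_tm (\<lambda>l. ret (\<rho> (fst l) = Some (\<not> snd l))) C)"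

text \<open>Step (i): the clauses of width at most \<open>w\<close> witnessed false on at most \<open>t\<close> samples.\<close>

definition learn_tm :: "nat \<Rightarrow> nat \<Rightarrow> real \<Rightarrow> passignment list \<Rightarrow> lit list list tm" where
  "learn_tm n w t \<rho>s =
     tick (do {
       Cs \<leftarrow> clauses_tm n w;
       filter_tm (\<lambda>C. do {
         \<sigma>s \<leftarrow> filter_tm (\<lambda>\<rho>. witnessed_false_tm \<rho> C) \<rho>s;
         k \<leftarrow> length_tm \<sigma>s;
         ret (real k \<le> t)}) Cs})"

text \<open>
  Step (ii).  In \<open>C' = C'' \<or> l\<close> the literals \<open>l\<close> and \<open>neg l\<close> do not occur in \<open>C''\<close>: otherwise a
  tautological \<open>C'\<close> such as \<open>x \<or> \<not> x\<close> would allow the deletion of any literal, although deleting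
  \<open>neg l\<close> from \<open>C\<close> is meant to be the cut of \<open>C\<close> with \<open>C'\<close>.
\<close>

definition cut_lit_tm :: "lit list \<Rightarrow> lit \<Rightarrow> lit list \<Rightarrow> lit list tm" where
  "cut_lit_tm C' l C =
     tick (do {
       C'' \<leftarrow> delete_tm l C';
       a \<leftarrow> mem_tm (neg l) C'';
       b \<leftarrow> mem_tm (neg l) C;
       c \<leftarrow> subset_tm C'' C;
       if \<not> a \<and> b \<and> c then delete_tm (neg l) C else ret C})"

definition cut_clause_tm :: "lit list \<Rightarrow> lit list \<Rightarrow> lit list tm" where
  "cut_clause_tm C' C = tick (fold_tm (cut_lit_tm C') C' C)"

definition simplify_tm :: "lit list list \<Rightarrow> lit list list \<Rightarrow> lit list list tm" where
  "simplify_tm \<psi> \<phi> = tick (map_tm (\<lambda>C. fold_tm cut_clause_tm \<psi> C) \<phi>)"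

definition restrict_tm :: "passignment \<Rightarrow> lit list list \<Rightarrow> lit list list tm" where
  "restrict_tm \<rho> \<phi> =
     tick (do {
       b \<leftarrow> ex_tm (witnessed_false_tm \<rho>) \<phi>;
       if b then ret [[]]
       else do {
         \<phi>' \<leftarrow> filter_tm (\<lambda>C. do {t \<leftarrow> witnessed_true_tm \<rho> C; ret (\<not> t)}) \<phi>;
         map_tm (\<lambda>C. filter_tm (\<lambda>l. ret (\<rho> (fst l) = None)) C) \<phi>'}})"

text \<open>
  Exhaustive search for a refutation in step (iii): among the candidate clauses \<open>K\<close>, those that follow from the
  axioms \<open>A\<close> and the clauses \<open>S\<close> found so far by one rule (a cut being combined with weakening) are
  collected repeatedly, once for every candidate, so that the search ends with a fixed point.
\<close>

definition derivable_tm :: "lit list list \<Rightarrow> lit list list \<Rightarrow> lit list \<Rightarrow> bool tm" where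
  "derivable_tm A S C =
     tick (do {
       a \<leftarrow> ex_tm (\<lambda>D. subset_tm D C) A;
       b \<leftarrow> ex_tm (\<lambda>D. subset_tm D C) S;
       c \<leftarrow> ex_tm (\<lambda>P. ex_tm (\<lambda>Q. ex_tm (\<lambda>l. do {
              m \<leftarrow> mem_tm (neg l) Q;
              P' \<leftarrow> delete_tm l P;
              Q' \<leftarrow> delete_tm (neg l) Q;
              s \<leftarrow> subset_tm P' C;
              t \<leftarrow> subset_tm Q' C;
              ret (m \<and> s \<and> t)}) P) S) S;
       ret (a \<or> b \<or> c)})"

fun saturate_tm :: "lit list list \<Rightarrow> lit list list \<Rightarrow> nat \<Rightarrow> lit list list \<Rightarrow> lit list list tm" where
  "saturate_tm A K 0 S = tick (ret S)"
| "saturate_tm A K (Suc k) S =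
     tick (do {S' \<leftarrow> filter_tm (derivable_tm A S) K; saturate_tm A K k S'})"

definition refutable_tm :: "nat \<Rightarrow> nat \<Rightarrow> lit list list \<Rightarrow> bool tm" where
  "refutable_tm n k A =
     tick (do {
       K \<leftarrow> clauses_tm n k;
       r \<leftarrow> length_tm K;
       S \<leftarrow> saturate_tm A K r [];
       ex_tm (\<lambda>C. ret (C = [])) S})"

datatype verdict = Accept | Reject

fun test_tm :: "nat \<Rightarrow> nat \<Rightarrow> lit list list \<Rightarrow> int \<Rightarrow> int \<Rightarrow> passignment list \<Rightarrow> verdict tm" where
  "test_tm n w \<theta> bound c [] = tick (ret Accept)"
| "test_tm n w \<theta> bound c (\<rho> # \<rho>s) =
     tick (do {
       A \<leftarrow> restrict_tm \<rho> \<theta>;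
       r \<leftarrow> refutable_tm n (2 * w) A;
       let c' = (if r then c else c + 1) in
       if c' > bound then ret Reject else test_tm n w \<theta> bound c' \<rho>s})"

text \<open>
  The numbers of samples and the width are rounded up to integers, and the width is capped at \<open>n\<close>,
  the largest width of a non-tautological clause over \<open>n\<close> variables.  With \<open>w > n\<close> the threshold of
  step (i), which is proportional to \<open>\<mu> ^ w\<close>, would be too small for clauses over \<open>n\<close> variables:
  they are witnessed false with probability at least \<open>\<mu> ^ n\<close> times that of being false.
\<close>

definition test_samples :: "real \<Rightarrow> real \<Rightarrow> nat" where
  "test_samples \<gamma> \<delta> = nat \<lceil>1 / (2 * \<gamma>\<^sup>2) * ln (2 / \<delta>)\<rceil>"

definition res_width :: "nat \<Rightarrow> real \<Rightarrow> real \<Rightarrow> real \<Rightarrow> real \<Rightarrow> nat \<Rightarrow> nat" where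
  "res_width n \<mu> \<beta> \<gamma> \<delta> s =
     min n (nat \<lceil>1 / (\<mu> * \<beta>) * ln (2 * real (test_samples \<gamma> \<delta>) * real s / \<delta>)\<rceil>)"

definition learn_samples :: "nat \<Rightarrow> nat \<Rightarrow> real \<Rightarrow> real \<Rightarrow> real \<Rightarrow> nat" where
  "learn_samples n w \<mu> \<gamma> \<delta> =
     nat \<lceil>2 * real w * real (2 * n + 1) ^ (2 * w) / (\<mu> ^ (2 * w) * \<gamma>\<^sup>2)
           * ln (4 * real (2 * n + 1) / \<delta>)\<rceil>"

text \<open>The argument \<open>s\<close> is the size bound \<open>p(n)\<close>; the last argument is the list of samples.\<close>

definition learn_res ::
  "nat \<Rightarrow> real \<Rightarrow> lit list list \<Rightarrow> nat \<Rightarrow> real \<Rightarrow> real \<Rightarrow> real \<Rightarrow> real \<Rightarrow> passignment list \<Rightarrow> verdict tm"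
where
  "learn_res n \<mu> \<phi> s \<epsilon> \<delta> \<gamma> \<beta> \<rho>s =
     tick (let w = res_width n \<mu> \<beta> \<gamma> \<delta> s;
               m\<^sub>0 = learn_samples n w \<mu> \<gamma> \<delta>;
               m\<^sub>1 = test_samples \<gamma> \<delta>
      in do {
       parts \<leftarrow> split_tm m\<^sub>0 \<rho>s;
       \<psi> \<leftarrow> learn_tm n w (\<gamma> * \<mu> ^ w / (2 * real (2 * n + 1) ^ w) * real m\<^sub>0) (fst parts);
       \<phi>' \<leftarrow> simplify_tm \<psi> \<phi>;
       \<theta> \<leftarrow> append_tm \<phi>' \<psi>;
       test_tm n w \<theta> \<lfloor>\<epsilon> * real m\<^sub>1\<rfloor> 0 (snd parts)})"

definition sample :: "nat \<Rightarrow> real \<Rightarrow> assignment pmf \<Rightarrow> nat \<Rightarrow> passignment list pmf" where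
  "sample n \<mu> D m = replicate_pmf m (masked n \<mu> D)"

section \<open>The values computed by the programs\<close>

lemma val_map_tm [simp]: "val (map_tm f xs) = map (\<lambda>x. val (f x)) xs"
  by (induction xs) simp_all

lemma val_filter_tm [simp]: "val (filter_tm P xs) = filter (\<lambda>x. val (P x)) xs"
  by (induction xs) simp_all

lemma val_ex_tm [simp]: "val (ex_tm P xs) \<longleftrightarrow> (\<exists>x\<in>set xs. val (P x))"
  by (induction xs) simp_all

lemma val_all_tm [simp]: "val (all_tm P xs) \<longleftrightarrow> (\<forall>x\<in>set xs. val (P x))"
  by (induction xs) simp_all

lemma val_fold_tm [simp]: "val (fold_tm f xs s) = fold (\<lambda>x s. val (f x s)) xs s"
  by (induction xs arbitrary: s) simp_all

lemma val_length_tm [simp]: "val (length_tm xs) = length xs"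
  by (induction xs) simp_all

lemma val_append_tm [simp]: "val (append_tm xs ys) = xs @ ys"
  by (induction xs) simp_all

lemma val_split_tm [simp]: "val (split_tm k xs) = (take k xs, drop k xs)"
  by (induction k xs rule: split_tm.induct) simp_all

lemma val_list_set_simps [simp]:
  "val (mem_tm l C) \<longleftrightarrow> l \<in> set C"
  "val (subset_tm C D) \<longleftrightarrow> set C \<subseteq> set D"
  "val (delete_tm l C) = filter (\<lambda>k. k \<noteq> l) C"
  by (auto simp: mem_tm_def subset_tm_def delete_tm_def)

lemma val_witnessed_simps [simp]:
  "val (witnessed_true_tm \<rho> C) \<longleftrightarrow> witnessed_true \<rho> (set C)"
  "val (witnessed_false_tm \<rho> C) \<longleftrightarrow> witnessed_false \<rho> (set C)"
  by (simp_all add: witnessed_true_tm_def witnessed_false_tm_def witnessed_true_def witnessed_false_def)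

lemma set_val_lits_tm: "set (val (lits_tm n)) = lits n"
proof (induction n)
  case (Suc n)
  have "lits (Suc n) = insert (n, True) (insert (n, False) (lits n))"
    unfolding lits_def lessThan_Suc UNIV_bool by blast
  with Suc show ?case by simp
qed (simp add: lits_def)

lemma distinct_val_lits_tm: "distinct (val (lits_tm n))"
proof (induction n)
  case (Suc n)
  moreover have "(n, b) \<notin> set (val (lits_tm n))" for b
    by (simp add: set_val_lits_tm lits_def)
  ultimately show ?case by simp
qed simp

lemma set_val_sublists_tm:
  "distinct ls \<Longrightarrow> set ` set (val (sublists_tm k ls)) = {A. A \<subseteq> set ls \<and> card A \<le> k}"
proof (induction k ls rule: sublists_tm.induct)
  case (2 l ls)
  have "A = {}" if "A \<subseteq> insert l (set ls)" "card A = 0" for A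
    using that finite_subset[OF that(1)] by simp
  then show ?case by auto
next
  case (3 k l ls)
  let ?S = "\<lambda>j. {A. A \<subseteq> set ls \<and> card A \<le> j}"
  have l: "l \<notin> set ls" using 3 by simp
  have "set ` set (val (sublists_tm (Suc k) (l # ls))) = insert l ` ?S k \<union> ?S (Suc k)"
    using 3 by (simp add: image_Un image_image flip: 3(1))
  also have "\<dots> = {A. A \<subseteq> set (l # ls) \<and> card A \<le> Suc k}"
  proof (intro equalityI subsetI)
    fix A assume "A \<in> insert l ` ?S k \<union> ?S (Suc k)"
    then show "A \<in> {A. A \<subseteq> set (l # ls) \<and> card A \<le> Suc k}"
      by (auto intro: order_trans[OF card_insert_le_m1] simp: card_insert_if finite_subset)
  next
    fix A assume A: "A \<in> {A. A \<subseteq> set (l # ls) \<and> card A \<le> Suc k}"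
    then have fin: "finite A" by (auto intro: finite_subset)
    show "A \<in> insert l ` ?S k \<union> ?S (Suc k)"
    proof (cases "l \<in> A")
      case True
      then have "A = insert l (A - {l})" by auto
      moreover have "A - {l} \<in> ?S k" using A True fin by auto
      ultimately show ?thesis by blast
    qed (use A in auto)
  qed
  finally show ?case .
qed auto

lemma cnf_of_val_clauses_tm:
  "cnf_of (val (clauses_tm n k)) = {C. C \<subseteq> lits n \<and> width C \<le> k}"
  by (simp add: clauses_tm_def cnf_of_def set_val_sublists_tm distinct_val_lits_tm set_val_lits_tm width_def)

lemma cnf_of_val_learn_tm:
  "cnf_of (val (learn_tm n w t \<rho>s)) =
     {C. C \<subseteq> lits n \<and> width C \<le> w \<and> real (length (filter (\<lambda>\<rho>. witnessed_false \<rho> C) \<rho>s)) \<le> t}"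
  (is "?L = ?R")
proof -
  have "?L = {C \<in> cnf_of (val (clauses_tm n w)).
                real (length (filter (\<lambda>\<rho>. witnessed_false \<rho> C) \<rho>s)) \<le> t}"
    by (auto simp: learn_tm_def cnf_of_def)
  then show ?thesis by (auto simp: cnf_of_val_clauses_tm)
qed

lemma set_val_cut_lit_tm:
  "set (val (cut_lit_tm C' l C)) =
     (if neg l \<notin> set C' - {l} \<and> insert (neg l) (set C' - {l}) \<subseteq> set C
      then set C - {neg l} else set C)"
proof -
  have *: "{k \<in> P. k \<noteq> m} = P - {m}" for P :: clause and m by blast
  have "neg l \<noteq> l" by (cases l) (simp add: neg_def)
  then show ?thesis by (simp add: cut_lit_tm_def *)
qed

lemma cnf_of_val_restrict_tm: "cnf_of (val (restrict_tm \<rho> \<phi>)) = restrict_cnf \<rho> (cnf_of \<phi>)"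
proof (cases "\<exists>C\<in>set \<phi>. witnessed_false \<rho> (set C)")
  case True
  then show ?thesis by (auto simp: restrict_tm_def restrict_cnf_def cnf_of_def)
next
  case False
  then have "cnf_of (val (restrict_tm \<rho> \<phi>)) =
      (\<lambda>C. set (filter (\<lambda>l. \<rho> (fst l) = None) C)) ` {C \<in> set \<phi>. \<not> witnessed_true \<rho> (set C)}"
    by (simp add: restrict_tm_def cnf_of_def image_image)
  also have "\<dots> = restrict_cnf \<rho> (cnf_of \<phi>)"
    using False by (auto simp: restrict_cnf_def cnf_of_def restrict_clause_def image_iff)
  finally show ?thesis .
qed

definition derived :: "cnf \<Rightarrow> cnf \<Rightarrow> clause \<Rightarrow> bool" where
  "derived \<phi> S C \<longleftrightarrow> (\<exists>D\<in>\<phi> \<union> S. D \<subseteq> C) \<or>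
     (\<exists>P\<in>S. \<exists>Q\<in>S. \<exists>l\<in>P. neg l \<in> Q \<and> P - {l} \<subseteq> C \<and> Q - {neg l} \<subseteq> C)"

lemma val_derivable_tm: "val (derivable_tm A S C) \<longleftrightarrow> derived (cnf_of A) (cnf_of S) (set C)"
proof -
  have "{k \<in> P. k \<noteq> l} = P - {l}" for P :: clause and l by blast
  then show ?thesis by (simp add: derivable_tm_def derived_def cnf_of_def bex_Un disj_assoc)
qed

lemma derived_mono: "derived \<phi> S C \<Longrightarrow> S \<subseteq> T \<Longrightarrow> derived \<phi> T C"
  unfolding derived_def by (meson UnE UnI1 UnI2 subsetD)

lemma cnf_of_val_saturate_tm:
  "cnf_of (val (saturate_tm A K r S)) =
     ((\<lambda>S. {C \<in> cnf_of K. derived (cnf_of A) S C}) ^^ r) (cnf_of S)"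
proof (induction r arbitrary: S)
  case (Suc r)
  have "cnf_of (filter (\<lambda>C. derived (cnf_of A) (cnf_of S) (set C)) K) =
      {C \<in> cnf_of K. derived (cnf_of A) (cnf_of S) C}"
    by (auto simp: cnf_of_def)
  with Suc show ?case by (simp add: val_derivable_tm funpow_Suc_right del: funpow.simps)
qed simp

lemma saturation_fixpoint:
  fixes F :: "'a set \<Rightarrow> 'a set"
  assumes "mono F" "\<And>S. F S \<subseteq> K" "finite K" "card K \<le> r"
  shows "F ((F ^^ r) {}) = (F ^^ r) {}"
proof -
  let ?f = "\<lambda>i. (F ^^ i) {}"
  have sub: "?f i \<subseteq> K" for i using assms(2) by (cases i) auto
  have mono: "mono ?f"
    using mono_funpow[OF assms(1)] by simp
  have "range ?f \<subseteq> Pow K" using sub by auto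
  then have fin: "finite (range ?f)" using assms(3) by (meson finite_Pow_iff finite_subset)
  have "?f (card K) = (\<Union>i. ?f i)"
    by (intro finite_mono_strict_prefix_implies_finite_fixpoint
          finite_mono_remains_stable_implies_strict_prefix sub assms(3) fin mono) simp
  then have stable: "?f i \<subseteq> ?f (card K)" for i by blast
  moreover have "?f (card K) \<subseteq> ?f i" if "i \<ge> card K" for i
    by (rule monoD[OF mono that])
  ultimately have "?f (Suc r) = ?f r" using assms(4) by (meson le_SucI order_antisym order_trans)
  then show ?thesis by simp
qed

lemma inferred_mono: "inferred \<phi> S C \<Longrightarrow> S \<subseteq> T \<Longrightarrow> inferred \<phi> T C"
  unfolding inferred_def
proof (elim disjE exE conjE)
  fix D E i
  assume *: "S \<subseteq> T" "D \<union> {(i, True)} \<in> S" "E \<union> {(i, False)} \<in> S" "C = D \<union> E"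
  have "D \<union> {(i, True)} \<in> T" "E \<union> {(i, False)} \<in> T" using * by (auto simp only: subset_iff)
  with *(4) show "C \<in> \<phi> \<or> (\<exists>B\<in>T. B \<subseteq> C) \<or>
      (\<exists>D E i. D \<union> {(i, True)} \<in> T \<and> E \<union> {(i, False)} \<in> T \<and> C = D \<union> E)" by metis
qed auto

definition derivation :: "nat \<Rightarrow> cnf \<Rightarrow> nat \<Rightarrow> clause list \<Rightarrow> bool" where
  "derivation n \<phi> w Cs \<longleftrightarrow>
     (\<forall>i<length Cs. Cs ! i \<subseteq> lits n \<and> width (Cs ! i) \<le> w \<and> inferred \<phi> (set (take i Cs)) (Cs ! i))"

lemma has_refutation_iff_derivation:
  "has_refutation_of_width n \<phi> w \<longleftrightarrow> (\<exists>Cs. derivation n \<phi> w Cs \<and> Cs \<noteq> [] \<and> last Cs = {})"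
  unfolding has_refutation_of_width_def resolution_refutation_def derivation_def all_set_conv_all_nth
  by (intro ex_cong1) blast

lemma derivation_Nil: "derivation n \<phi> w []"
  by (simp add: derivation_def)

lemma derivation_append:
  assumes "derivation n \<phi> w Cs" "derivation n \<phi> w Ds"
  shows "derivation n \<phi> w (Cs @ Ds)"
  unfolding derivation_def
proof (intro allI impI)
  fix i assume i: "i < length (Cs @ Ds)"
  show "(Cs @ Ds) ! i \<subseteq> lits n \<and> width ((Cs @ Ds) ! i) \<le> w \<and>
      inferred \<phi> (set (take i (Cs @ Ds))) ((Cs @ Ds) ! i)"
  proof (cases "i < length Cs")
    case True
    with assms(1) show ?thesis by (simp add: derivation_def nth_append)
  next
    case False
    let ?j = "i - length Cs"
    have "Ds ! ?j \<subseteq> lits n \<and> width (Ds ! ?j) \<le> w \<and> inferred \<phi> (set (take ?j Ds)) (Ds ! ?j)"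
      using assms(2) i False by (simp add: derivation_def)
    then show ?thesis using False by (auto simp: nth_append intro: inferred_mono)
  qed
qed

lemma derivation_snoc:
  assumes "derivation n \<phi> w Cs" "C \<subseteq> lits n" "width C \<le> w" "inferred \<phi> (set Cs) C"
  shows "derivation n \<phi> w (Cs @ [C])"
proof (unfold derivation_def, intro allI impI)
  fix i assume "i < length (Cs @ [C])"
  then consider "i < length Cs" | "i = length Cs" by fastforce
  then show "(Cs @ [C]) ! i \<subseteq> lits n \<and> width ((Cs @ [C]) ! i) \<le> w \<and>
      inferred \<phi> (set (take i (Cs @ [C]))) ((Cs @ [C]) ! i)"
    using assms by cases (simp_all add: derivation_def nth_append)
qed

lemma finite_lits: "finite (lits n)"
  by (simp add: lits_def)

lemma width_mono: "C \<subseteq> D \<Longrightarrow> D \<subseteq> lits n \<Longrightarrow> width C \<le> width D"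
  unfolding width_def by (metis card_mono finite_lits finite_subset)

lemma derivation_of_derived:
  assumes S: "\<And>D. D \<in> S \<Longrightarrow> \<exists>Cs. derivation n \<phi> w Cs \<and> D \<in> set Cs"
    and C: "derived \<phi> S C" "C \<subseteq> lits n" "width C \<le> w"
  shows "\<exists>Cs. derivation n \<phi> w Cs \<and> C \<in> set Cs"
proof -
  have weaken: "\<exists>Cs. derivation n \<phi> w Cs \<and> C \<in> set Cs"
    if "derivation n \<phi> w Cs" "D \<in> set Cs" "D \<subseteq> C" for Cs D
  proof -
    have "inferred \<phi> (set Cs) C" unfolding inferred_def using that by blast
    from derivation_snoc[OF that(1) C(2,3) this] show ?thesis by (metis in_set_conv_decomp)
  qed
  consider (ax) D where "D \<in> \<phi>" "D \<subseteq> C" | (weak) D where "D \<in> S" "D \<subseteq> C"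
    | (cut) P Q l where "P \<in> S" "Q \<in> S" "l \<in> P" "neg l \<in> Q" "P - {l} \<subseteq> C" "Q - {neg l} \<subseteq> C"
    using C(1) unfolding derived_def by blast
  then show ?thesis
  proof cases
    case ax
    have "derivation n \<phi> w ([] @ [D])"
      using ax C width_mono[OF ax(2) C(2)]
      by (intro derivation_snoc derivation_Nil) (auto simp: inferred_def)
    from weaken[OF this _ ax(2)] show ?thesis by simp
  next
    case weak
    with S weaken show ?thesis by blast
  next
    case cut
    obtain Cs Ds where ders: "derivation n \<phi> w Cs" "P \<in> set Cs" "derivation n \<phi> w Ds" "Q \<in> set Ds"
      using S cut(1,2) by blast
    define R where "R = (P - {l}) \<union> (Q - {neg l})"
    have R: "R \<subseteq> C" using cut by (auto simp: R_def)
    obtain v b where l: "l = (v, b)" by force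
    have P: "P - {l} \<union> {l} \<in> set (Cs @ Ds)" using ders(2) cut(3) by (simp add: insert_absorb)
    have Q: "Q - {neg l} \<union> {neg l} \<in> set (Cs @ Ds)" using ders(4) cut(4) by (simp add: insert_absorb)
    have "inferred \<phi> (set (Cs @ Ds)) R"
    proof (cases b)
      case True
      with P Q l have "P - {l} \<union> {(v, True)} \<in> set (Cs @ Ds)" "Q - {neg l} \<union> {(v, False)} \<in> set (Cs @ Ds)"
        by (simp_all add: neg_def)
      then show ?thesis unfolding inferred_def R_def by (intro disjI2 exI conjI) (assumption, assumption, rule refl)
    next
      case False
      with P Q l have "Q - {neg l} \<union> {(v, True)} \<in> set (Cs @ Ds)" "P - {l} \<union> {(v, False)} \<in> set (Cs @ Ds)"
        by (simp_all add: neg_def)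
      then show ?thesis unfolding inferred_def R_def by (intro disjI2 exI conjI) (assumption, assumption, rule Un_commute)
    qed
    from derivation_snoc[OF derivation_append[OF ders(1,3)] _ _ this]
    have "derivation n \<phi> w ((Cs @ Ds) @ [R])" using R C width_mono[OF R C(2)] by simp
    from weaken[OF this _ R] show ?thesis by simp
  qed
qed

lemma val_refutable_tm:
  assumes "cnf_over n (cnf_of A)"
  shows "val (refutable_tm n k A) \<longleftrightarrow> has_refutation_of_width n (cnf_of A) k"
proof -
  define K where "K = val (clauses_tm n k)"
  define F where "F = (\<lambda>S. {C \<in> cnf_of K. derived (cnf_of A) S C})"
  define T where "T = (F ^^ length K) {}"
  have K: "cnf_of K = {C. C \<subseteq> lits n \<and> width C \<le> k}"
    by (simp add: K_def cnf_of_val_clauses_tm)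
  have val: "val (refutable_tm n k A) \<longleftrightarrow> {} \<in> T"
  proof -
    have "val (refutable_tm n k A) \<longleftrightarrow> {} \<in> cnf_of (val (saturate_tm A K (length K) []))"
      by (auto simp: refutable_tm_def K_def cnf_of_def)
    then show ?thesis unfolding cnf_of_val_saturate_tm T_def F_def by (simp add: cnf_of_def)
  qed
  have "mono F" unfolding F_def by (intro monoI) (auto intro: derived_mono)
  moreover have "card (cnf_of K) \<le> length K"
    unfolding cnf_of_def by (meson card_image_le card_length le_trans List.finite_set)
  ultimately have fix_T: "F T = T"
    unfolding T_def by (intro saturation_fixpoint[where K = "cnf_of K"]) (auto simp: F_def cnf_of_def)
  have sound: "\<exists>Cs. derivation n (cnf_of A) k Cs \<and> C \<in> set Cs" if "C \<in> (F ^^ r) {}" for r C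
    using that
  proof (induction r arbitrary: C)
    case (Suc r)
    then have "C \<in> cnf_of K" "derived (cnf_of A) ((F ^^ r) {}) C" by (simp_all add: F_def)
    then show ?case using derivation_of_derived[OF Suc.IH] by (simp add: K)
  qed simp
  have complete: "Cs ! i \<in> T" if der: "derivation n (cnf_of A) k Cs" and "i < length Cs" for Cs i
    using \<open>i < length Cs\<close>
  proof (induction i rule: less_induct)
    case (less i)
    note d = der[unfolded derivation_def, rule_format, OF less.prems]
    have "set (take i Cs) \<subseteq> T"
      using less by (auto simp: in_set_conv_nth)
    then have "inferred (cnf_of A) T (Cs ! i)" using d inferred_mono by blast
    then have "derived (cnf_of A) T (Cs ! i)"
      unfolding inferred_def
    proof (elim disjE exE conjE)
      fix D E v
      assume *: "D \<union> {(v, True)} \<in> T" "E \<union> {(v, False)} \<in> T" "Cs ! i = D \<union> E"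
      have "neg (v, True) = (v, False)" by (simp add: neg_def)
      then show ?thesis unfolding derived_def *(3)
        by (intro disjI2 bexI[OF _ *(1)] bexI[OF _ *(2)] bexI[of _ "(v, True)"]) auto
    qed (auto simp: derived_def)
    with d have "Cs ! i \<in> F T" by (auto simp: F_def K)
    then show ?case by (simp add: fix_T)
  qed
  show ?thesis unfolding val has_refutation_iff_derivation
  proof
    assume "{} \<in> T"
    then obtain Cs where Cs: "derivation n (cnf_of A) k Cs" "{} \<in> set Cs"
      using sound T_def by blast
    then have "derivation n (cnf_of A) k (Cs @ [{}])"
      by (intro derivation_snoc) (auto simp: width_def inferred_def)
    then show "\<exists>Cs. derivation n (cnf_of A) k Cs \<and> Cs \<noteq> [] \<and> last Cs = {}" by fastforce
  next
    assume "\<exists>Cs. derivation n (cnf_of A) k Cs \<and> Cs \<noteq> [] \<and> last Cs = {}"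
    then show "{} \<in> T" using complete by (metis diff_less last_conv_nth length_greater_0_conv less_one)
  qed
qed

lemma val_test_tm:
  assumes "cnf_over n (cnf_of \<theta>)" "c \<le> bound"
  shows "val (test_tm n w \<theta> bound c \<rho>s) = Accept \<longleftrightarrow>
    c + int (length (filter
      (\<lambda>\<rho>. \<not> has_refutation_of_width n (restrict_cnf \<rho> (cnf_of \<theta>)) (2 * w)) \<rho>s)) \<le> bound"
  using assms(2)
proof (induction \<rho>s arbitrary: c)
  case (Cons \<rho> \<rho>s)
  have "cnf_over n (restrict_cnf \<rho> (cnf_of \<theta>))"
    using assms(1) by (fastforce simp: cnf_over_def restrict_cnf_def restrict_clause_def)
  then have "val (refutable_tm n (2 * w) (val (restrict_tm \<rho> \<theta>))) \<longleftrightarrow>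
      has_refutation_of_width n (restrict_cnf \<rho> (cnf_of \<theta>)) (2 * w)"
    by (simp add: val_refutable_tm cnf_of_val_restrict_tm)
  with Cons show ?case by (auto simp: Let_def)
qed simp

lemma set_val_cut_clause_tm: "set (val (cut_clause_tm C' C)) \<subseteq> set C"
proof -
  have "set (fold (\<lambda>l C. val (cut_lit_tm C' l C)) ls C) \<subseteq> set C" for ls
  proof (induction ls arbitrary: C)
    case (Cons l ls)
    have "set (val (cut_lit_tm C' l C)) \<subseteq> set C" by (simp add: set_val_cut_lit_tm)
    with Cons[of "val (cut_lit_tm C' l C)"] show ?case by (simp add: order_trans)
  qed simp
  then show ?thesis by (simp add: cut_clause_tm_def)
qed

lemma cnf_over_val_simplify_tm:
  assumes "cnf_over n (cnf_of \<phi>)"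
  shows "cnf_over n (cnf_of (val (simplify_tm \<psi> \<phi>)))"
proof -
  have "set (fold (\<lambda>C' C. val (cut_clause_tm C' C)) \<psi> C) \<subseteq> set C" for C
  proof (induction \<psi> arbitrary: C)
    case (Cons C' \<psi>)
    show ?case
      using order_trans[OF Cons[of "val (cut_clause_tm C' C)"] set_val_cut_clause_tm] by simp
  qed simp
  with assms show ?thesis
    unfolding cnf_over_def cnf_of_def simplify_tm_def by simp (blast dest: subset_trans)
qed

lemma val_learn_res:
  fixes n s :: nat and \<mu> \<beta> \<gamma> \<delta> \<epsilon> :: real and \<phi> :: "lit list list" and \<rho>s :: "passignment list"
  assumes "cnf_over n (cnf_of \<phi>)" "\<epsilon> \<ge> 0"
  defines "w \<equiv> res_width n \<mu> \<beta> \<gamma> \<delta> s"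
  defines "m\<^sub>0 \<equiv> learn_samples n w \<mu> \<gamma> \<delta>"
  defines "m\<^sub>1 \<equiv> test_samples \<gamma> \<delta>"
  defines "\<psi> \<equiv> val (learn_tm n w (\<gamma> * \<mu> ^ w / (2 * real (2 * n + 1) ^ w) * real m\<^sub>0) (take m\<^sub>0 \<rho>s))"
  defines "\<phi>' \<equiv> val (simplify_tm \<psi> \<phi>)"
  shows "val (learn_res n \<mu> \<phi> s \<epsilon> \<delta> \<gamma> \<beta> \<rho>s) = Accept \<longleftrightarrow>
    int (length (filter
      (\<lambda>\<rho>. \<not> has_refutation_of_width n (restrict_cnf \<rho> (cnf_of \<phi>' \<union> cnf_of \<psi>)) (2 * w))
      (drop m\<^sub>0 \<rho>s))) \<le> \<lfloor>\<epsilon> * real m\<^sub>1\<rfloor>"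
proof -
  have "cnf_over n (cnf_of \<psi>)"
    by (simp add: \<psi>_def cnf_of_val_learn_tm cnf_over_def)
  moreover have "cnf_over n (cnf_of \<phi>')"
    unfolding \<phi>'_def by (rule cnf_over_val_simplify_tm[OF assms(1)])
  moreover have un: "cnf_of (\<phi>' @ \<psi>) = cnf_of \<phi>' \<union> cnf_of \<psi>"
    by (simp add: cnf_of_def image_Un)
  ultimately have over: "cnf_over n (cnf_of (\<phi>' @ \<psi>))"
    unfolding cnf_over_def by (simp only: ball_Un)
  have "0 \<le> \<lfloor>\<epsilon> * real m\<^sub>1\<rfloor>" using assms(2) by simp
  from val_test_tm[OF over this, of w "drop m\<^sub>0 \<rho>s"] show ?thesis
    unfolding un by (simp add: learn_res_def Let_def w_def m\<^sub>0_def m\<^sub>1_def \<psi>_def \<phi>'_def)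
qed


end

theory Submission
  imports Defs
begin

text \<open>
  Fix a clause \<open>C\<close> and examine its literals adaptively, always taking one whose value is not yet
  almost determined by the falsity of the visible literals examined before. By the correlation gap
  each examination makes \<open>C\<close> witnessed true with probability at least \<open>\<mu> * \<beta>\<close>, so with high
  probability either \<open>C\<close> is witnessed true, or the process stops within \<open>w\<close> steps; in the latter case
  each remaining literal, or its negation, follows from a clause of width at most \<open>w\<close> that is almost
  always true, over visible literals that are false. When this happens for every clause of the
  given refutation, the restricted refutation can be simulated keeping only at most \<open>w\<close> literals of
  each clause, whence width \<open>2 * w\<close> suffices.

  The threshold of the learning step is proportional to \<open>\<mu> ^ w\<close>, so almost valid clauses narrower
  than \<open>w\<close> need not be learned; but all their extensions to width exactly \<open>w\<close> are, and cutting over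
  these recovers them. As the threshold is only twice the expected count, this needs the
  multiplicative Chernoff bound, together with \<open>\<gamma> \<le> 1 / 2\<close>, which the hypothesis of the second case
  implies. Conversely, whatever is learned is true with probability at least \<open>1 - \<gamma>\<close>, so
  soundness of resolution limits the frequency of refutations in the first case.
\<close>

section \<open>Resolution\<close>

text \<open>The wide clauses of the query are the obstacle. They need not be almost valid, and after
  restriction they may be too wide to serve as axioms, so nearly false literals cannot be cut away
  afterwards. The deletions of step (ii) act beforehand: a wide clause with a remaining literal that
  is nearly always false given the visible ones would have been shortened further. The shortened
  clauses depend on the learning samples, so the tameness estimate is applied to them only once
  these samples are fixed, over the independent test samples.

  The constants fit as follows. In an almost valid clause up to \<open>n - 1\<close> nearly false
  literals are dropped at a cost of \<eta> each, so clauses of falsity probability up to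
  \<open>n * \<eta>\<close> have to be learned; the 4 in \<eta> makes their expected frequency
  \<open>\<mu> ^ w * n * \<eta>\<close> half the threshold. Conversely, with high probability each
  learned clause is false with probability at most \<open>\<gamma> / (2 * n + 1) ^ w\<close>, and
  there are at most \<open>(2 * n + 1) ^ w\<close> of them.\<close>

definition taut :: "clause \<Rightarrow> bool" where
  "taut C \<longleftrightarrow> (\<exists>l\<in>C. neg l \<in> C)"

lemma fst_neg [simp]: "fst (neg l) = fst l" and snd_neg [simp]: "snd (neg l) = (\<not> snd l)"
  by (simp_all add: neg_def)

lemma neg_neg [simp]: "neg (neg l) = l"
  by (simp add: neg_def)

lemma neg_neq [simp]: "neg l \<noteq> l" "l \<noteq> neg l"
  by (cases l; simp add: neg_def)+

lemma eq_or_eq_neg: "fst k = fst l \<Longrightarrow> k = l \<or> k = neg l"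
  by (cases k; cases l) (auto simp: neg_def)

lemma neg_in_lits_iff [simp]: "neg l \<in> lits n \<longleftrightarrow> l \<in> lits n"
  by (simp add: lits_def mem_Times_iff)

lemma lit_true_neg [simp]: "lit_true x (neg l) \<longleftrightarrow> \<not> lit_true x l"
  by (auto simp: lit_true_def)

lemma clause_true_mono: "clause_true x C \<Longrightarrow> C \<subseteq> D \<Longrightarrow> clause_true x D"
  by (auto simp: clause_true_def)

lemma taut_mono: "taut C \<Longrightarrow> C \<subseteq> D \<Longrightarrow> taut D"
  by (auto simp: taut_def)

lemma clause_true_taut: "taut C \<Longrightarrow> clause_true x C"
  unfolding taut_def clause_true_def using lit_true_neg by blast

lemma taut_insert_iff: "taut (insert l K) \<longleftrightarrow> taut K \<or> neg l \<in> K"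
  by (auto simp: taut_def)

lemma inj_on_fst_nontaut: "\<not> taut C \<Longrightarrow> inj_on fst C"
  unfolding inj_on_def taut_def using eq_or_eq_neg by metis

lemma card_nontaut_le:
  assumes "\<not> taut C" "C \<subseteq> lits n"
  shows "card C \<le> n"
proof -
  have "card C = card (fst ` C)" by (rule card_image[OF inj_on_fst_nontaut[OF assms(1)], symmetric])
  also have "\<dots> \<le> card {..<n}"
    by (rule card_mono) (use assms(2) in \<open>auto simp: lits_def\<close>)
  finally show ?thesis by simp
qed

lemma witnessed_true_mono: "witnessed_true \<rho> C \<Longrightarrow> C \<subseteq> D \<Longrightarrow> witnessed_true \<rho> D"
  by (auto simp: witnessed_true_def)

lemma restrict_clause_mono: "C \<subseteq> D \<Longrightarrow> restrict_clause \<rho> C \<subseteq> restrict_clause \<rho> D"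
  by (auto simp: restrict_clause_def)

lemma restrict_clause_subset: "restrict_clause \<rho> C \<subseteq> C"
  by (auto simp: restrict_clause_def)

lemma restrict_cnf_eq:
  "\<forall>C\<in>\<phi>. \<not> witnessed_false \<rho> C \<Longrightarrow>
    restrict_cnf \<rho> \<phi> = restrict_clause \<rho> ` {C \<in> \<phi>. \<not> witnessed_true \<rho> C}"
  by (simp add: restrict_cnf_def)

lemma finite_clause: "C \<subseteq> lits n \<Longrightarrow> finite C"
  using finite_lits finite_subset by blast

lemma resolution_sound:
  assumes "resolution_refutation n \<phi> Cs"
  shows "\<not> cnf_true x \<phi>"
proof
  assume x: "cnf_true x \<phi>"
  have "clause_true x (Cs ! i)" if "i < length Cs" for i
    using that
  proof (induction i rule: less_induct)
    case (less i)
    have S: "clause_true x B" if "B \<in> set (take i Cs)" for B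
      using that less by (auto simp: in_set_conv_nth)
    have "inferred \<phi> (set (take i Cs)) (Cs ! i)"
      using assms less.prems by (simp add: resolution_refutation_def)
    then consider "Cs ! i \<in> \<phi>" | B where "B \<in> set (take i Cs)" "B \<subseteq> Cs ! i"
      | D E v where "D \<union> {(v, True)} \<in> set (take i Cs)" "E \<union> {(v, False)} \<in> set (take i Cs)"
          "Cs ! i = D \<union> E"
      unfolding inferred_def by blast
    then show ?case
    proof cases
      case 1
      then show ?thesis using x by (simp add: cnf_true_def)
    next
      case 2
      then show ?thesis using S clause_true_mono by blast
    next
      case 3
      from S[OF 3(1)] S[OF 3(2)] show ?thesis
        unfolding 3(3) by (auto simp: clause_true_def lit_true_def)
    qed
  qed
  moreover have "Cs \<noteq> []" "last Cs = {}" using assms by (auto simp: resolution_refutation_def)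
  ultimately have "clause_true x {}" by (metis last_conv_nth length_greater_0_conv diff_less zero_less_one)
  then show False by (simp add: clause_true_def)
qed

section \<open>Restrictions that agree with a total assignment\<close>

definition extends :: "assignment \<Rightarrow> passignment \<Rightarrow> bool" where
  "extends x \<rho> \<longleftrightarrow> (\<forall>i. \<rho> i = None \<or> \<rho> i = Some (x i))"

text \<open>A true literal of a clause that is not witnessed true must be masked, so it survives in
  the restricted clause. Hence \<open>x\<close> satisfies the whole restriction, and soundness of
  resolution applies.\<close>

lemma no_refutation_of_restriction:
  assumes "extends x \<rho>" "cnf_true x \<theta>"
  shows "\<not> has_refutation_of_width n (restrict_cnf \<rho> \<theta>) k"
proof -
  have nf: "\<forall>C\<in>\<theta>. \<not> witnessed_false \<rho> C"
  proof
    fix C assume "C \<in> \<theta>"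
    then obtain l where l: "l \<in> C" "x (fst l) = snd l"
      using assms(2) by (auto simp: cnf_true_def clause_true_def lit_true_def)
    have "\<rho> (fst l) \<noteq> Some (\<not> snd l)"
      using assms(1) l(2) unfolding extends_def by (metis option.distinct(1) option.inject)
    then show "\<not> witnessed_false \<rho> C" using l(1) by (auto simp: witnessed_false_def)
  qed
  have "clause_true x (restrict_clause \<rho> C)" if C: "C \<in> \<theta>" "\<not> witnessed_true \<rho> C" for C
  proof -
    obtain l where l: "l \<in> C" "x (fst l) = snd l"
      using assms(2) C(1) by (auto simp: cnf_true_def clause_true_def lit_true_def)
    moreover have "\<rho> (fst l) \<noteq> Some (snd l)" using C(2) l(1) by (auto simp: witnessed_true_def)
    ultimately have "\<rho> (fst l) = None" using assms(1)[unfolded extends_def, rule_format, of "fst l"] by auto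
    with l have "l \<in> restrict_clause \<rho> C" "lit_true x l"
      by (simp_all add: restrict_clause_def lit_true_def)
    then show ?thesis unfolding clause_true_def by blast
  qed
  then have "cnf_true x (restrict_cnf \<rho> \<theta>)"
    using nf by (auto simp: restrict_cnf_eq cnf_true_def)
  then show ?thesis
    using resolution_sound by (auto simp: has_refutation_of_width_def)
qed

section \<open>Derivability in bounded width\<close>

definition derivable :: "nat \<Rightarrow> cnf \<Rightarrow> nat \<Rightarrow> clause \<Rightarrow> bool" where
  "derivable n \<phi> k C \<longleftrightarrow> (\<exists>Cs. derivation n \<phi> k Cs \<and> C \<in> set Cs)"

lemma derivable_in_lits: "derivable n \<phi> k C \<Longrightarrow> C \<subseteq> lits n"
  unfolding derivable_def derivation_def by (metis in_set_conv_nth)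

lemma derivable_axiom:
  assumes "C \<in> \<phi>" "C \<subseteq> lits n" "card C \<le> k"
  shows "derivable n \<phi> k C"
  using derivation_of_derived[of "{}" n \<phi> k C] assms
  by (auto simp: derivable_def derived_def width_def)

lemma derivable_cut:
  assumes "derivable n \<phi> k P" "derivable n \<phi> k Q" "l \<in> P" "neg l \<in> Q"
    and "card (P - {l} \<union> (Q - {neg l})) \<le> k"
  shows "derivable n \<phi> k (P - {l} \<union> (Q - {neg l}))"
  using derivation_of_derived[of "{P, Q}" n \<phi> k "P - {l} \<union> (Q - {neg l})"] assms
    derivable_in_lits[OF assms(1)] derivable_in_lits[OF assms(2)]
  unfolding derivable_def derived_def width_def by blast

lemma refutation_of_derivable_empty:
  assumes "derivable n \<phi> k {}"
  shows "has_refutation_of_width n \<phi> k"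
proof -
  obtain Cs where Cs: "derivation n \<phi> k Cs" "{} \<in> set Cs" using assms by (auto simp: derivable_def)
  then have "derivation n \<phi> k (Cs @ [{}])"
    by (intro derivation_snoc) (auto simp: width_def inferred_def)
  then show ?thesis unfolding has_refutation_iff_derivation by fastforce
qed

text \<open>
  Only clauses of width exactly \<open>w\<close> are assumed to be present: narrower ones are recovered by
  cutting over all their extensions to width \<open>w\<close>.
\<close>

lemma derivable_restrict_of_extensions:
  assumes "\<forall>C\<in>\<theta>. \<not> witnessed_false \<rho> C" "w \<le> n" "w \<le> k"
    and "\<And>K'. K \<subseteq> K' \<Longrightarrow> K' \<subseteq> lits n \<Longrightarrow> \<not> taut K' \<Longrightarrow> card K' = w \<Longrightarrow> K' \<in> \<theta>"
    and "K \<subseteq> lits n" "\<not> taut K" "card K \<le> w" "\<not> witnessed_true \<rho> K"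
  shows "derivable n (restrict_cnf \<rho> \<theta>) k (restrict_clause \<rho> K)"
  using assms(4-)
proof (induction "w - card K" arbitrary: K)
  case 0
  then have "card K = w" by simp
  with 0 have "restrict_clause \<rho> K \<in> restrict_cnf \<rho> \<theta>"
    by (auto simp: restrict_cnf_eq[OF assms(1)])
  moreover have "card (restrict_clause \<rho> K) \<le> k"
    using card_mono[OF finite_clause[OF 0(3)] restrict_clause_subset] \<open>card K = w\<close> assms(3)
    by (metis order_trans)
  ultimately show ?case
    using 0(3) restrict_clause_subset by (intro derivable_axiom) blast+
next
  case (Suc j)
  have fin: "finite K" by (rule finite_clause[OF Suc(4)])
  \<comment> \<open>As \<open>K\<close> has fewer than \<open>w\<close> literals and
    \<open>w\<close> is capped at \<open>n\<close>, some variable does not occur in it.\<close>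
  have "card (fst ` K) < n"
    using Suc(2) assms(2) card_image_le[OF fin, of fst] by linarith
  then obtain v where v: "v < n" "v \<notin> fst ` K"
    by (metis card_lessThan card_mono finite_imageI fin lessThan_iff not_less subsetI)
  have ext: "derivable n (restrict_cnf \<rho> \<theta>) k (restrict_clause \<rho> (insert (v, b) K))"
    if "\<rho> v \<noteq> Some b" for b
  proof (rule Suc(1))
    show "j = w - card (insert (v, b) K)" "card (insert (v, b) K) \<le> w"
      using Suc(2) fin v(2) by (auto simp: card_insert_if image_iff)
    show "insert (v, b) K \<subseteq> lits n" using Suc(4) v(1) by (auto simp: lits_def)
    show "\<not> taut (insert (v, b) K)"
      using Suc(5) v(2) by (auto simp: taut_insert_iff image_iff neg_def)
    show "\<not> witnessed_true \<rho> (insert (v, b) K)"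
      using Suc(7) that by (auto simp: witnessed_true_def)
  qed (use Suc(3) in auto)
  \<comment> \<open>If the new variable is masked, the two extensions are cut on it. If it is
    visible, the extension by its false literal restricts to the same clause as
    \<open>K\<close>.\<close>
  show ?case
  proof (cases "\<rho> v")
    case None
    have eq: "restrict_clause \<rho> (insert (v, b) K) = insert (v, b) (restrict_clause \<rho> K)" for b
      using None by (auto simp: restrict_clause_def)
    have nin: "(v, b) \<notin> restrict_clause \<rho> K" for b
      using v(2) by (auto simp: restrict_clause_def image_iff)
    have "neg (v, True) = (v, False)" by (simp add: neg_def)
    then have "derivable n (restrict_cnf \<rho> \<theta>) k
      (insert (v, True) (restrict_clause \<rho> K) - {(v, True)} \<union>
        (insert (v, False) (restrict_clause \<rho> K) - {neg (v, True)}))"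
      using ext[of True] ext[of False] None nin Suc(6) assms(3)
        card_mono[OF fin restrict_clause_subset, of \<rho>]
      by (intro derivable_cut) (auto simp: eq)
    then show ?thesis using nin \<open>neg (v, True) = (v, False)\<close> by simp
  next
    case (Some b)
    then have "restrict_clause \<rho> (insert (v, \<not> b) K) = restrict_clause \<rho> K"
      by (auto simp: restrict_clause_def)
    with ext[of "\<not> b"] Some show ?thesis by simp
  qed
qed

text \<open>Cuts with unit clauses only shrink the clause, so the width bound is never exceeded on
  the way.\<close>

lemma derivable_remove_units:
  assumes "derivable n \<phi> k R" "card R \<le> k" "finite A" "A \<subseteq> R"
    and "\<And>l. l \<in> A \<Longrightarrow> derivable n \<phi> k {neg l}"
  shows "derivable n \<phi> k (R - A)"
  using assms(3,4,5)
proof (induction A rule: finite_induct)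
  case empty
  then show ?case using assms(1) by simp
next
  case (insert l A)
  have "finite R" using derivable_in_lits[OF assms(1)] by (rule finite_clause)
  then have "card (R - A - {l} \<union> ({neg l} - {neg l})) \<le> k"
    using assms(2) by (metis (no_types, lifting) Diff_cancel Diff_subset card_mono order_trans sup_bot.right_neutral)
  then have "derivable n \<phi> k (R - A - {l} \<union> ({neg l} - {neg l}))"
    using insert by (intro derivable_cut) auto
  moreover have "R - A - {l} \<union> ({neg l} - {neg l}) = R - insert l A" by auto
  ultimately show ?case by simp
qed

section \<open>Simulating a refutation on a masked example\<close>

text \<open>Equally the probability of the conjunction of the negated literals. One quantity thus
  serves for validity of clauses and for the conjunctions of the correlation gap.\<close>

definition false_prob :: "assignment pmf \<Rightarrow> clause \<Rightarrow> real" where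
  "false_prob D K = measure_pmf.prob D {x. \<not> clause_true x K}"

lemma false_prob_antimono: "K \<subseteq> K' \<Longrightarrow> false_prob D K' \<le> false_prob D K"
  unfolding false_prob_def by (intro measure_pmf.finite_measure_mono) (auto dest: clause_true_mono)

lemma false_prob_nonneg: "false_prob D K \<ge> 0"
  by (simp add: false_prob_def)

lemma false_prob_empty: "false_prob D {} = 1"
  by (simp add: false_prob_def clause_true_def)

text \<open>If \<open>Q\<close> is false but \<open>C\<close> is true, then some literal
  \<open>l\<close> of \<open>C - Q\<close> is true, and the clause \<open>insert (neg l) L\<close>
  is false because \<open>L\<close> is part of \<open>Q\<close>. A union bound over \<open>l\<close>
  gives the sum.\<close>

lemma false_prob_remove_lits:
  assumes "Q \<subseteq> C" "finite C" "L \<subseteq> Q"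
  shows "false_prob D Q \<le> false_prob D C + (\<Sum>l\<in>C - Q. false_prob D (insert (neg l) L))"
proof -
  let ?A = "\<Union>l\<in>C - Q. {x. \<not> clause_true x (insert (neg l) L)}"
  have "{x. \<not> clause_true x Q} \<subseteq> {x. \<not> clause_true x C} \<union> ?A"
  proof
    fix x assume "x \<in> {x. \<not> clause_true x Q}"
    then have x: "\<And>l. l \<in> Q \<Longrightarrow> \<not> lit_true x l" by (auto simp: clause_true_def)
    show "x \<in> {x. \<not> clause_true x C} \<union> ?A"
    proof (cases "clause_true x C")
      case True
      then obtain l where l: "l \<in> C" "lit_true x l" unfolding clause_true_def by blast
      with x have "l \<in> C - Q" by blast
      moreover have "\<not> clause_true x (insert (neg l) L)"
        using x assms(3) l(2) unfolding clause_true_def by auto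
      ultimately show ?thesis by blast
    qed simp
  qed
  then have "false_prob D Q \<le> measure_pmf.prob D ({x. \<not> clause_true x C} \<union> ?A)"
    unfolding false_prob_def by (intro measure_pmf.finite_measure_mono) auto
  also have "\<dots> \<le> false_prob D C + measure_pmf.prob D ?A"
    unfolding false_prob_def by (intro measure_Un_le) auto
  also have "measure_pmf.prob D ?A \<le> (\<Sum>l\<in>C - Q. false_prob D (insert (neg l) L))"
    unfolding false_prob_def using assms(2)
    by (intro measure_UNION_le) auto
  finally show ?thesis by simp
qed

text \<open>The bound is on the joint probability and not on the conditional one, because it is the
  clause \<open>insert l L\<close> or \<open>insert (neg l) L\<close> that has to be almost valid
  for the learning step.\<close>

definition settled :: "assignment pmf \<Rightarrow> real \<Rightarrow> clause \<Rightarrow> lit \<Rightarrow> bool" where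
  "settled D \<eta> L l \<longleftrightarrow> false_prob D (insert l L) \<le> \<eta> \<or> false_prob D (insert (neg l) L) \<le> \<eta>"

definition visible :: "passignment \<Rightarrow> clause \<Rightarrow> clause" where
  "visible \<rho> Q = {l \<in> Q. \<rho> (fst l) \<noteq> None}"

text \<open>
  The set \<open>Q\<close> consists of the literals that an adaptive process has examined: it always examines a
  literal that is not yet settled by the falsity of the visible ones among those examined before.
\<close>

definition tame :: "assignment pmf \<Rightarrow> real \<Rightarrow> nat \<Rightarrow> passignment \<Rightarrow> clause \<Rightarrow> bool" where
  "tame D \<eta> w \<rho> C \<longleftrightarrow> taut C \<or> witnessed_true \<rho> C \<or> card C \<le> w \<or>
     (\<exists>Q\<subseteq>C. card Q < w \<and> (\<forall>l\<in>C - Q. settled D \<eta> (visible \<rho> Q) l))"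

text \<open>The negated condition is the guard under which \<open>cut_lit_tm\<close> deletes a
  literal, so no deletion of step (ii) applies any more.\<close>

definition irreducible_by :: "cnf \<Rightarrow> clause \<Rightarrow> bool" where
  "irreducible_by \<psi> C \<longleftrightarrow>
     (\<forall>C'\<in>\<psi>. \<forall>l\<in>C'. \<not> (neg l \<notin> C' - {l} \<and> insert (neg l) (C' - {l}) \<subseteq> C))"

section \<open>Width reduction under one fixed restriction\<close>

locale learned_restriction =
  fixes n w :: nat and D :: "assignment pmf" and \<eta> :: real and \<psi> \<phi>' :: cnf and \<rho> :: passignment
  assumes width: "1 \<le> w" "w \<le> n"
    and eta: "0 \<le> \<eta>" "(real n + 1) * \<eta> < 1"
    and learned: "\<And>K. K \<subseteq> lits n \<Longrightarrow> \<not> taut K \<Longrightarrow> card K = w \<Longrightarrow>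
      false_prob D K \<le> real n * \<eta> \<Longrightarrow> K \<in> \<psi>"
    and not_false: "\<forall>C\<in>\<phi>' \<union> \<psi>. \<not> witnessed_false \<rho> C"
begin

abbreviation der :: "clause \<Rightarrow> bool" where
  "der \<equiv> derivable n (restrict_cnf \<rho> (\<phi>' \<union> \<psi>)) (2 * w)"

text \<open>The invariant of the simulation. Asking only for some subclause of the restriction makes
  it monotone, so weakening steps of the given refutation need no derivation.\<close>

definition small :: "clause \<Rightarrow> bool" where
  "small C \<longleftrightarrow> (\<exists>B\<subseteq>restrict_clause \<rho> C. card B \<le> w \<and> der B)"

lemma small_mono: "small C \<Longrightarrow> C \<subseteq> C' \<Longrightarrow> small C'"
  unfolding small_def by (meson order_trans restrict_clause_mono)

lemma eta_le: "\<eta> \<le> real n * \<eta>"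
  using width eta(1) mult_right_mono[of 1 "real n" \<eta>] by simp

text \<open>Extending a clause can only lower its falsity probability, so all non-tautological
  extensions to width \<open>w\<close> have been learned. The bound is \<open>n * \<eta>\<close> and
  not \<eta> for the sake of \<open>small_of_valid\<close>.\<close>

lemma derivable_learned:
  assumes "K \<subseteq> lits n" "\<not> taut K" "card K \<le> w" "false_prob D K \<le> real n * \<eta>"
    "\<not> witnessed_true \<rho> K"
  shows "der (restrict_clause \<rho> K)"
proof (rule derivable_restrict_of_extensions[OF not_false width(2) _ _ assms(1,2,3,5)])
  fix K' assume "K \<subseteq> K'" "K' \<subseteq> lits n" "\<not> taut K'" "card K' = w"
  then show "K' \<in> \<phi>' \<union> \<psi>"
    using learned order_trans[OF false_prob_antimono assms(4)] by blast
qed simp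

lemma visible_false:
  assumes "\<not> witnessed_true \<rho> C" "Q \<subseteq> C" "l \<in> visible \<rho> Q"
  shows "\<rho> (fst l) = Some (\<not> snd l)"
proof -
  have "l \<in> C" "\<rho> (fst l) \<noteq> None" using assms(2,3) by (auto simp: visible_def)
  moreover from this have "\<rho> (fst l) \<noteq> Some (snd l)"
    using assms(1) unfolding witnessed_true_def by blast
  ultimately show ?thesis by (cases "\<rho> (fst l)") auto
qed

text \<open>If falsity of the visible part of \<open>Q\<close> nearly implies that a remaining
  literal \<open>l\<close> is true, then \<open>insert l (visible \<rho> Q)\<close> is available and
  restricts to at most \<open>{l}\<close>, so \<open>C\<close> is small at once. Otherwise all
  remaining literals are nearly implied to be false.\<close>

lemma tame_cases:
  assumes "tame D \<eta> w \<rho> C" "C \<subseteq> lits n" "\<not> taut C" "\<not> witnessed_true \<rho> C"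
  obtains (narrow) "card C \<le> w" | (small) "small C"
    | (settled) Q where "w < card C" "Q \<subseteq> C" "card Q < w"
        "\<And>l. l \<in> C - Q \<Longrightarrow> false_prob D (insert (neg l) (visible \<rho> Q)) \<le> \<eta>"
proof (cases "card C \<le> w")
  case False
  then obtain Q where Q: "Q \<subseteq> C" "card Q < w" "\<And>l. l \<in> C - Q \<Longrightarrow> settled D \<eta> (visible \<rho> Q) l"
    using assms unfolding tame_def by blast
  show ?thesis
  proof (cases "\<exists>l\<in>C - Q. false_prob D (insert l (visible \<rho> Q)) \<le> \<eta>")
    case True
    then obtain l where l: "l \<in> C" "l \<notin> Q" "false_prob D (insert l (visible \<rho> Q)) \<le> \<eta>" by blast
    let ?K = "insert l (visible \<rho> Q)"
    have vis: "visible \<rho> Q \<subseteq> Q" by (auto simp: visible_def)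
    have KC: "?K \<subseteq> C" using l(1) Q(1) vis by blast
    have finQ: "finite Q" using Q(1) assms(2) finite_clause by blast
    have "card ?K \<le> Suc (card (visible \<rho> Q))" by (rule card_insert_le_m1) auto
    also have "\<dots> \<le> w" using card_mono[OF finQ vis] Q(2) by simp
    finally have "card ?K \<le> w" .
    then have "der (restrict_clause \<rho> ?K)"
      using KC assms(2) l(3) eta_le taut_mono[OF _ KC] witnessed_true_mono[OF _ KC] assms(3,4)
      by (intro derivable_learned) auto
    moreover have "restrict_clause \<rho> ?K \<subseteq> {l}" by (auto simp: restrict_clause_def visible_def)
    from card_mono[OF _ this] have "card (restrict_clause \<rho> ?K) \<le> w"
      using width(1) by simp
    ultimately have "small C"
      unfolding small_def using restrict_clause_mono[OF KC] by blast
    then show ?thesis by (rule that(2))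
  next
    case False
    then show ?thesis
      using that(3)[of Q] Q \<open>\<not> card C \<le> w\<close> unfolding settled_def by (meson not_le)
  qed
qed (rule that(1))

text \<open>For a literal \<open>l\<close> of \<open>R\<close> outside \<open>Q\<close>, the clause
  \<open>insert (neg l) (visible \<rho> Q)\<close> is available and restricts to the unit
  \<open>{neg l}\<close>, its visible literals being false. Cutting with these units leaves part of
  \<open>Q\<close>, which has fewer than \<open>w\<close> literals.\<close>

lemma small_of_derivable:
  assumes "tame D \<eta> w \<rho> C" "C \<subseteq> lits n" "\<not> taut C" "\<not> witnessed_true \<rho> C"
    and "der R" "R \<subseteq> restrict_clause \<rho> C" "card R \<le> 2 * w"
  shows "small C"
  using assms(1-4)
proof (cases rule: tame_cases)
  case narrow
  have "R \<subseteq> C" using assms(6) restrict_clause_subset by blast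
  from card_mono[OF finite_clause[OF assms(2)] this] narrow have "card R \<le> w" by simp
  then show ?thesis using assms(5,6) unfolding small_def by blast
next
  case small
  then show ?thesis .
next
  case (settled Q)
  have vis: "visible \<rho> Q \<subseteq> Q" by (auto simp: visible_def)
  have finQ: "finite Q" using settled(2) assms(2) finite_clause by blast
  have RC: "R \<subseteq> C" using assms(6) restrict_clause_subset by blast
  have "der {neg l}" if l: "l \<in> R - Q" for l
  proof -
    let ?K = "insert (neg l) (visible \<rho> Q)"
    have lC: "l \<in> C" "\<rho> (fst l) = None" using l assms(6) by (auto simp: restrict_clause_def)
    have "l \<notin> visible \<rho> Q" using l vis by blast
    then have "\<not> taut ?K"
      using assms(3) taut_mono[of "visible \<rho> Q" C] vis settled(2) by (auto simp: taut_insert_iff)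
    moreover have "\<not> witnessed_true \<rho> ?K"
      using visible_false[OF assms(4) settled(2)] lC(2) by (fastforce simp: witnessed_true_def)
    moreover have "card ?K \<le> w"
      using card_mono[OF finQ vis] settled(3) finite_subset[OF vis finQ] by (simp add: card_insert_if)
    moreover have "?K \<subseteq> lits n" using lC(1) assms(2) settled(2) vis by auto
    moreover have "false_prob D ?K \<le> real n * \<eta>"
      using settled(4)[of l] l RC eta_le by fastforce
    ultimately have "der (restrict_clause \<rho> ?K)" by (intro derivable_learned)
    moreover have "restrict_clause \<rho> ?K = {neg l}"
      using lC(2) by (auto simp: restrict_clause_def visible_def)
    ultimately show ?thesis by simp
  qed
  moreover have "finite (R - Q)" using RC assms(2) finite_clause by blast
  ultimately have "der (R - (R - Q))"
    using assms(5,7) by (intro derivable_remove_units) auto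
  moreover have "card (R - (R - Q)) \<le> w"
  proof -
    have "card (R - (R - Q)) \<le> card Q" by (rule card_mono[OF finQ]) auto
    then show ?thesis using settled(3) by simp
  qed
  ultimately show ?thesis unfolding small_def using assms(6) by blast
qed

text \<open>Here \<open>C\<close> itself may be too wide to be derived and then trimmed. Instead the
  nearly false literals are dropped before the restriction, at a cost of \<eta> each, and
  \<open>Q\<close> turns out to be almost valid and narrow, hence available.\<close>

lemma small_of_valid:
  assumes "tame D \<eta> w \<rho> C" "C \<subseteq> lits n" "\<not> taut C" "\<not> witnessed_true \<rho> C"
    and "false_prob D C \<le> \<eta>"
  shows "small C"
  using assms(1-4)
proof (cases rule: tame_cases)
  case narrow
  have "card (restrict_clause \<rho> C) \<le> w"
    using card_mono[OF finite_clause[OF assms(2)] restrict_clause_subset] narrow by (rule order_trans)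
  then show ?thesis
    using derivable_learned[OF assms(2,3) narrow _ assms(4)] assms(5) eta_le unfolding small_def by force
next
  case (settled Q)
  have fin: "finite C" using assms(2) finite_clause by blast
  have "false_prob D Q \<le> false_prob D C + (\<Sum>l\<in>C - Q. false_prob D (insert (neg l) (visible \<rho> Q)))"
    using settled(2) fin by (intro false_prob_remove_lits) (auto simp: visible_def)
  also have "\<dots> \<le> \<eta> + (\<Sum>l\<in>C - Q. \<eta>)"
    using assms(5) settled(4) by (intro add_mono sum_mono) auto
  also have "\<dots> = (1 + real (card (C - Q))) * \<eta>" by (simp add: algebra_simps)
  finally have *: "false_prob D Q \<le> (1 + real (card (C - Q))) * \<eta>" .
  have card: "card (C - Q) + card Q \<le> n"
    using card_nontaut_le[OF assms(3,2)] card_Diff_subset[of Q C] settled(2) fin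
    by (metis card_mono finite_subset le_add_diff_inverse2)
  \<comment> \<open>The empty clause is false with probability 1. One literal in \<open>Q\<close>
    also lowers the factor from \<open>n + 1\<close> to \<open>n\<close>, as needed for the learning
    bound.\<close>
  have "Q \<noteq> {}"
  proof
    assume "Q = {}"
    have "(1 + real (card (C - Q))) * \<eta> \<le> (real n + 1) * \<eta>"
      using card eta(1) by (intro mult_right_mono) auto
    with * eta(2) \<open>Q = {}\<close> show False by (simp add: false_prob_empty)
  qed
  then have "card Q \<ge> 1" using finite_subset[OF settled(2) fin] by (simp add: Suc_le_eq card_gt_0_iff)
  with card have "1 + real (card (C - Q)) \<le> real n" by linarith
  then have "false_prob D Q \<le> real n * \<eta>"
    using * eta(1) by (meson mult_right_mono order_trans)
  then have "der (restrict_clause \<rho> Q)"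
    using settled(2,3) assms(2-4) taut_mono[OF _ settled(2)] witnessed_true_mono[OF _ settled(2)]
    by (intro derivable_learned) auto
  moreover have "card (restrict_clause \<rho> Q) \<le> w"
    using card_mono[OF finite_subset[OF settled(2) fin] restrict_clause_subset[of \<rho>]] settled(3) by simp
  ultimately show ?thesis
    unfolding small_def using restrict_clause_mono[OF settled(2)] by blast
qed

text \<open>The settled case is contradictory: some learned clause would allow a further deletion
  from \<open>C\<close>. In the narrow case the restricted clause is itself an axiom of admissible
  width.\<close>

lemma small_of_irreducible:
  assumes "tame D \<eta> w \<rho> C" "C \<subseteq> lits n" "\<not> taut C" "\<not> witnessed_true \<rho> C"
    and "C \<in> \<phi>'" "irreducible_by \<psi> C"
  shows "small C"
  using assms(1-4)
proof (cases rule: tame_cases)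
  case narrow
  have c: "card (restrict_clause \<rho> C) \<le> w"
    using card_mono[OF finite_clause[OF assms(2)] restrict_clause_subset] narrow by (rule order_trans)
  have "restrict_clause \<rho> C \<in> restrict_cnf \<rho> (\<phi>' \<union> \<psi>)"
    using assms(4,5) by (auto simp: restrict_cnf_eq[OF not_false])
  then have "der (restrict_clause \<rho> C)"
    using c assms(2) restrict_clause_subset by (intro derivable_axiom) fastforce+
  with c show ?thesis unfolding small_def by blast
next
  case (settled Q)
  have fin: "finite C" using assms(2) finite_clause by blast
  have finQ: "finite Q" using fin settled(2) finite_subset by blast
  obtain l where l: "l \<in> C" "l \<notin> Q"
    using settled(1,3) card_mono[OF finQ, of C] by (meson leD less_trans not_le subsetI)
  have vis: "visible \<rho> Q \<subseteq> Q" by (auto simp: visible_def)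
  \<comment> \<open>Only clauses of width exactly \<open>w\<close> are known to be learned, hence
    the padding of \<open>Q\<close> to \<open>w - 1\<close> literals. The padding is taken from
    \<open>C\<close>, so that the rest of the learned clause is a subclause of \<open>C\<close>, as
    the deletion guard demands.\<close>
  obtain Z where Z: "Q \<subseteq> Z" "Z \<subseteq> C - {l}" "card Z = w - 1"
  proof -
    have "card Q \<le> w - 1" "w - 1 \<le> card (C - {l})" "Q \<subseteq> C - {l}"
      using settled(1-3) l by auto
    from exists_subset_between[OF this] fin that show ?thesis by auto
  qed
  let ?K = "insert (neg l) Z"
  have nl: "neg l \<notin> C" "neg l \<notin> Z" using l(1) assms(3) Z(2) by (auto simp: taut_def)
  have finZ: "finite Z" using Z(2) fin finite_subset by blast
  have "?K \<in> \<psi>"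
  proof (rule learned)
    show "?K \<subseteq> lits n" using Z(2) assms(2) l(1) by auto
    show "\<not> taut ?K" using Z(2) assms(3) taut_mono[of Z C] by (auto simp: taut_insert_iff)
    show "card ?K = w" using Z(3) width(1) nl(2) finZ by simp
    have "false_prob D ?K \<le> false_prob D (insert (neg l) (visible \<rho> Q))"
      using vis Z(1) by (intro false_prob_antimono) auto
    then show "false_prob D ?K \<le> real n * \<eta>" using settled(4)[of l] l eta_le by simp
  qed
  then have "\<not> (neg (neg l) \<notin> ?K - {neg l} \<and> insert (neg (neg l)) (?K - {neg l}) \<subseteq> C)"
    by (rule assms(6)[unfolded irreducible_by_def, rule_format]) simp
  moreover have "?K - {neg l} = Z" using nl(2) by auto
  ultimately show ?thesis using Z(2) l(1) by auto
qed

text \<open>Induction along the refutation: each clause is a tautology, witnessed true, or small.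
  All three properties pass to superclauses, so a clause of the query inherits the invariant from
  its simplified subclause.\<close>

theorem simulate_refutation:
  assumes ref: "resolution_refutation n (\<psi>\<^sub>0 \<union> \<psi>\<^sub>1 \<union> \<phi>) Cs"
    and valid: "\<And>C. C \<in> \<psi>\<^sub>0 \<Longrightarrow> false_prob D C \<le> \<eta>"
    and wit: "cnf_witnessed_true \<rho> \<psi>\<^sub>1"
    and f: "\<And>C. C \<in> \<phi> \<Longrightarrow> f C \<in> \<phi>' \<and> f C \<subseteq> C \<and> irreducible_by \<psi> (f C)"
    and tame: "\<And>C. C \<in> set Cs \<Longrightarrow> tame D \<eta> w \<rho> (if C \<in> \<phi> then f C else C)"
  shows "has_refutation_of_width n (restrict_cnf \<rho> (\<phi>' \<union> \<psi>)) (2 * w)"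
proof -
  define good where "good C \<longleftrightarrow> taut C \<or> witnessed_true \<rho> C \<or> small C" for C
  have good_mono: "good C \<Longrightarrow> C \<subseteq> C' \<Longrightarrow> good C'" for C C'
    unfolding good_def using taut_mono witnessed_true_mono small_mono by blast
  have "good (Cs ! i)" if "i < length Cs" for i
    using that
  proof (induction i rule: less_induct)
    case (less i)
    let ?C = "Cs ! i"
    have S: "good B" if "B \<in> set (take i Cs)" for B
      using that less by (auto simp: in_set_conv_nth)
    have C: "?C \<subseteq> lits n" "inferred (\<psi>\<^sub>0 \<union> \<psi>\<^sub>1 \<union> \<phi>) (set (take i Cs)) ?C"
      using ref less.prems by (simp_all add: resolution_refutation_def)
    have tameC: "tame D \<eta> w \<rho> (if ?C \<in> \<phi> then f ?C else ?C)"
      using less.prems by (intro tame) simp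
    show ?case
    proof (cases "taut ?C \<or> witnessed_true \<rho> ?C")
      case True
      then show ?thesis by (auto simp: good_def)
    next
      case nt: False
      \<comment> \<open>A clause of \<phi> is handled as an axiom however it was inferred, since for
        it only \<open>f C\<close> is known to be tame.\<close>
      show ?thesis
      proof (cases "?C \<in> \<phi>")
        case True
        with f tameC have fC: "f ?C \<in> \<phi>'" "f ?C \<subseteq> ?C" "irreducible_by \<psi> (f ?C)"
          "tame D \<eta> w \<rho> (f ?C)" by auto
        have "small (f ?C)"
          using fC nt C(1) taut_mono[OF _ fC(2)] witnessed_true_mono[OF _ fC(2)]
          by (intro small_of_irreducible) auto
        then show ?thesis using good_mono[OF _ fC(2)] by (auto simp: good_def)
      next
        case False
        then have tm: "tame D \<eta> w \<rho> ?C" using tameC by simp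
        from C(2) False consider "?C \<in> \<psi>\<^sub>0" | "?C \<in> \<psi>\<^sub>1"
          | B where "B \<in> set (take i Cs)" "B \<subseteq> ?C"
          | P Q v where "P \<union> {(v, True)} \<in> set (take i Cs)" "Q \<union> {(v, False)} \<in> set (take i Cs)"
              "?C = P \<union> Q"
          unfolding inferred_def by blast
        then show ?thesis
        proof cases
          case 1
          then show ?thesis using small_of_valid[OF tm C(1)] nt valid by (auto simp: good_def)
        next
          case 2
          then show ?thesis using wit by (auto simp: good_def cnf_witnessed_true_def)
        next
          case 3
          then show ?thesis using S good_mono by blast
        next
          case 4
          let ?x = "(v, True)" and ?y = "(v, False)"
          have neg: "neg ?x = ?y" "neg ?y = ?x" by (simp_all add: neg_def)
          have P: "good (insert ?x P)" and Q: "good (insert ?y Q)" using S 4(1,2) by auto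
          have ntPQ: "\<not> taut P" "\<not> taut Q" "\<not> witnessed_true \<rho> P" "\<not> witnessed_true \<rho> Q"
            using nt taut_mono[of _ ?C] witnessed_true_mono[of \<rho> _ ?C] 4(3) by auto
          \<comment> \<open>If a premise keeps its pivot literal through the other premise, it is
            contained in the conclusion, and the cut is a weakening.\<close>
          show ?thesis
          proof (cases "?y \<in> P \<or> ?x \<in> Q")
            case True
            then have "insert ?y Q \<subseteq> ?C \<or> insert ?x P \<subseteq> ?C" using 4(3) by auto
            then show ?thesis using P Q good_mono by blast
          next
            case nin: False
            then have nt': "\<not> taut (insert ?x P)" "\<not> taut (insert ?y Q)"
              using ntPQ by (auto simp: taut_insert_iff neg)
            show ?thesis
            proof (cases "\<rho> v")
              case (Some b)
              show ?thesis
              proof (cases b)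
                case True
                then have "\<not> witnessed_true \<rho> (insert ?y Q)" "restrict_clause \<rho> (insert ?y Q) = restrict_clause \<rho> Q"
                  using ntPQ Some by (auto simp: witnessed_true_def restrict_clause_def)
                then have "small Q" using Q nt' by (auto simp: good_def small_def)
                then show ?thesis using small_mono 4(3) unfolding good_def by blast
              next
                case False
                then have "\<not> witnessed_true \<rho> (insert ?x P)" "restrict_clause \<rho> (insert ?x P) = restrict_clause \<rho> P"
                  using ntPQ Some by (auto simp: witnessed_true_def restrict_clause_def)
                then have "small P" using P nt' by (auto simp: good_def small_def)
                then show ?thesis using small_mono 4(3) unfolding good_def by blast
              qed
            next
              case None
              then have "\<not> witnessed_true \<rho> (insert ?x P)" "\<not> witnessed_true \<rho> (insert ?y Q)"
                using ntPQ by (auto simp: witnessed_true_def)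
              then obtain A B where A: "A \<subseteq> restrict_clause \<rho> (insert ?x P)" "card A \<le> w" "der A"
                and B: "B \<subseteq> restrict_clause \<rho> (insert ?y Q)" "card B \<le> w" "der B"
                using P Q nt' unfolding good_def small_def by blast
              let ?R = "A - {?x} \<union> (B - {?y})"
              have R: "?R \<subseteq> restrict_clause \<rho> ?C"
                using A(1) B(1) unfolding 4(3) by (auto simp: restrict_clause_def)
              have "card ?R \<le> card (A - {?x}) + card (B - {?y})" by (rule card_Un_le)
              also have "\<dots> \<le> 2 * w"
                using A(2) B(2) card_Diff1_le[of A ?x] card_Diff1_le[of B ?y] by linarith
              finally have cR: "card ?R \<le> 2 * w" .
              \<comment> \<open>The derived subclauses may have lost the pivot; then one of them
                already lies within the restricted conclusion.\<close>
              consider "?x \<notin> A" | "?y \<notin> B" | "?x \<in> A" "?y \<in> B" by blast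
              then have "small ?C"
              proof cases
                case 1
                then have "A \<subseteq> restrict_clause \<rho> ?C" using R by auto
                then show ?thesis using A unfolding small_def by blast
              next
                case 2
                then have "B \<subseteq> restrict_clause \<rho> ?C" using R by auto
                then show ?thesis using B unfolding small_def by blast
              next
                case 3
                then have "der ?R" using derivable_cut[OF A(3) B(3), of ?x] cR by (simp add: neg)
                then show ?thesis using small_of_derivable[OF tm C(1) _ _ _ R cR] nt by blast
              qed
              then show ?thesis by (simp add: good_def)
            qed
          qed
        qed
      qed
    qed
  qed
  moreover have "Cs \<noteq> []" "last Cs = {}" using ref by (auto simp: resolution_refutation_def)
  ultimately have "good {}" by (metis last_conv_nth length_greater_0_conv diff_less zero_less_one)
  \<comment> \<open>The empty clause is neither a tautology nor witnessed true, and the only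
    subclause of its restriction is itself.\<close>
  then have "der {}" by (auto simp: good_def taut_def witnessed_true_def small_def restrict_clause_def)
  then show ?thesis by (rule refutation_of_derivable_empty)
qed

end

section \<open>The simplified query\<close>

text \<open>Deletion is sound because it is a cut. If \<open>l\<close> is true, the deleted literal
  was false. If \<open>l\<close> is false, a true literal of \<open>C' - {l}\<close> lies in
  \<open>C\<close>, and the guard \<open>neg l \<notin> C' - {l}\<close> keeps it from being the
  deleted one.\<close>

lemma clause_true_cut_lit:
  assumes "clause_true x (set C')" "clause_true x (set C)"
  shows "clause_true x (set (val (cut_lit_tm C' l C)))"
proof (cases "neg l \<notin> set C' - {l} \<and> insert (neg l) (set C' - {l}) \<subseteq> set C")
  case True
  then have eq: "set (val (cut_lit_tm C' l C)) = set C - {neg l}" by (simp add: set_val_cut_lit_tm)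
  show ?thesis
  proof (cases "lit_true x l")
    case True
    then show ?thesis using assms(2) unfolding eq clause_true_def
      by (metis DiffI lit_true_neg singletonD)
  next
    case False
    then obtain k where "k \<in> set C' - {l}" "lit_true x k" using assms(1) by (auto simp: clause_true_def)
    then show ?thesis unfolding eq clause_true_def using True by blast
  qed
next
  case False
  then have "set (val (cut_lit_tm C' l C)) = set C" unfolding set_val_cut_lit_tm by (rule if_not_P)
  then show ?thesis using assms(2) by simp
qed

lemma clause_true_fold_cut_lit:
  assumes "clause_true x (set C')"
  shows "clause_true x (set C) \<Longrightarrow> clause_true x (set (fold (\<lambda>l C. val (cut_lit_tm C' l C)) ls C))"
  by (induction ls arbitrary: C) (simp_all add: clause_true_cut_lit[OF assms])

lemma clause_true_fold_cut_clause:
  assumes "\<And>C'. C' \<in> set \<psi> \<Longrightarrow> clause_true x (set C')"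
  shows "clause_true x (set C) \<Longrightarrow> clause_true x (set (fold (\<lambda>C' C. val (cut_clause_tm C' C)) \<psi> C))"
  using assms
  by (induction \<psi> arbitrary: C) (simp_all add: cut_clause_tm_def clause_true_fold_cut_lit)

lemma cnf_true_simplify:
  assumes "cnf_true x (cnf_of \<psi>)" "cnf_true x (cnf_of \<phi>)"
  shows "cnf_true x (cnf_of (val (simplify_tm \<psi> \<phi>)))"
  using assms clause_true_fold_cut_clause[of \<psi> x]
  by (auto simp: cnf_true_def cnf_of_def simplify_tm_def)

lemma set_fold_cut_lit_subset: "set (fold (\<lambda>l C. val (cut_lit_tm C' l C)) ls C) \<subseteq> set C"
proof (induction ls arbitrary: C)
  case (Cons l ls)
  have "set (val (cut_lit_tm C' l C)) \<subseteq> set C" by (auto simp: set_val_cut_lit_tm)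
  with Cons[of "val (cut_lit_tm C' l C)"] show ?case by simp
qed simp

lemma set_fold_cut_clause_subset: "set (fold (\<lambda>C' C. val (cut_clause_tm C' C)) \<psi> C) \<subseteq> set C"
proof (induction \<psi> arbitrary: C)
  case (Cons C' \<psi>)
  then show ?case using set_val_cut_clause_tm[of C' C] by fastforce
qed simp

text \<open>One pass suffices: after the turn of \<open>l\<close> the guard fails, and later
  deletions only shrink the clause, so it cannot hold again. The same reasoning serves for the pass
  over all learned clauses.\<close>

lemma irreducible_fold_cut_lit:
  assumes "l \<in> set ls" "neg l \<notin> set C' - {l}"
  shows "\<not> insert (neg l) (set C' - {l}) \<subseteq> set (fold (\<lambda>l C. val (cut_lit_tm C' l C)) ls C)"
  using assms(1)
proof (induction ls arbitrary: C)
  case (Cons k ls)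
  show ?case
  proof (cases "k = l")
    case True
    have "\<not> insert (neg l) (set C' - {l}) \<subseteq> set (val (cut_lit_tm C' l C))"
      using assms(2) by (auto simp: set_val_cut_lit_tm)
    then show ?thesis
      using set_fold_cut_lit_subset[of C' ls "val (cut_lit_tm C' l C)"] True by auto
  qed (use Cons in auto)
qed simp

lemma irreducible_fold_cut_clause:
  assumes "C' \<in> set \<psi>" "l \<in> set C'" "neg l \<notin> set C' - {l}"
  shows "\<not> insert (neg l) (set C' - {l}) \<subseteq> set (fold (\<lambda>C' C. val (cut_clause_tm C' C)) \<psi> C)"
  using assms(1)
proof (induction \<psi> arbitrary: C)
  case (Cons B \<psi>)
  show ?case
  proof (cases "B = C'")
    case True
    have "\<not> insert (neg l) (set C' - {l}) \<subseteq> set (val (cut_clause_tm C' C))"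
      using irreducible_fold_cut_lit[OF assms(2,3)] by (simp add: cut_clause_tm_def)
    then show ?thesis
      using set_fold_cut_clause_subset[of \<psi> "val (cut_clause_tm C' C)"] True by auto
  qed (use Cons in auto)
qed simp

lemma simplify_irreducible:
  assumes "C \<in> cnf_of \<phi>"
  shows "\<exists>B\<in>cnf_of (val (simplify_tm \<psi> \<phi>)). B \<subseteq> C \<and> irreducible_by (cnf_of \<psi>) B"
proof -
  obtain c where c: "c \<in> set \<phi>" "C = set c" using assms by (auto simp: cnf_of_def)
  let ?B = "fold (\<lambda>C' C. val (cut_clause_tm C' C)) \<psi> c"
  have "irreducible_by (cnf_of \<psi>) (set ?B)"
    unfolding irreducible_by_def cnf_of_def using irreducible_fold_cut_clause by auto
  moreover have "set ?B \<in> cnf_of (val (simplify_tm \<psi> \<phi>))"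
    using c by (auto simp: cnf_of_def simplify_tm_def)
  ultimately show ?thesis using set_fold_cut_clause_subset c(2) by blast
qed

section \<open>Independent samples\<close>

lemma map_replicate_pmf: "map_pmf (map f) (replicate_pmf m p) = replicate_pmf m (map_pmf f p)"
proof (induction m)
  case (Suc m)
  show ?case
    unfolding replicate_pmf.simps Suc.IH[symmetric]
    by (simp add: map_pmf_def bind_assoc_pmf bind_return_pmf)
qed simp

lemma map_pmf_pred_eq_bernoulli:
  "map_pmf P p = bernoulli_pmf (measure_pmf.prob p {x. P x})" (is "_ = bernoulli_pmf ?q")
proof (rule pmf_eqI)
  fix b
  have "pmf (map_pmf P p) True = ?q" by (simp add: pmf_map vimage_def)
  moreover have "pmf (map_pmf P p) False = 1 - ?q"
    by (simp add: pmf_map vimage_def measure_pmf.prob_neg[unfolded space_measure_pmf, simplified])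
  ultimately show "pmf (map_pmf P p) b = pmf (bernoulli_pmf ?q) b" by (cases b) simp_all
qed

lemma count_replicate_pmf:
  "map_pmf (\<lambda>xs. length (filter P xs)) (replicate_pmf m p) =
     binomial_pmf m (measure_pmf.prob p {x. P x})"
proof -
  have "length (filter P xs) = length (filter id (map P xs))" for xs
    by (induction xs) auto
  then have "map_pmf (\<lambda>xs. length (filter P xs)) (replicate_pmf m p) =
      map_pmf (length \<circ> filter id) (map_pmf (map P) (replicate_pmf m p))"
    by (simp add: pmf.map_comp o_def)
  then show ?thesis
    by (simp add: map_replicate_pmf map_pmf_pred_eq_bernoulli binomial_pmf_altdef)
qed

lemma prob_count:
  "measure_pmf.prob (replicate_pmf m p) {xs. R (length (filter P xs))} =
     measure_pmf.prob (binomial_pmf m (measure_pmf.prob p {x. P x})) {k. R k}"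
  by (subst count_replicate_pmf[symmetric]) (simp add: vimage_def)

text \<open>Hoeffding's inequality for the binomial count, with a margin \<open>t\<close> between
  the tested frequency and the true one.\<close>

lemma prob_count_le:
  assumes "m > 0" "t \<ge> 0" "a + t \<le> measure_pmf.prob p {x. P x}"
  shows "measure_pmf.prob (replicate_pmf m p) {xs. real (length (filter P xs)) \<le> a * real m}
    \<le> exp (- 2 * real m * t\<^sup>2)"
proof -
  let ?q = "measure_pmf.prob p {x. P x}"
  interpret binomial_distribution m ?q by unfold_locales auto
  have "measure_pmf.prob (binomial_pmf m ?q) {k. real k \<le> a * real m}
      \<le> measure_pmf.prob (binomial_pmf m ?q) {k. real k / real m \<le> ?q - t}"
  proof (intro measure_pmf.finite_measure_mono subsetI)
    fix k assume "k \<in> {k. real k \<le> a * real m}"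
    then have "real k / real m \<le> a" using assms(1) by (simp add: field_simps)
    with assms(3) show "k \<in> {k. real k / real m \<le> ?q - t}" by simp
  qed simp
  also have "\<dots> \<le> exp (- 2 * real m * t\<^sup>2)" using prob_le'[OF assms(1,2)] by simp
  finally show ?thesis by (subst prob_count[where R = "\<lambda>k. real k \<le> a * real m"])
qed

lemma prob_count_ge:
  assumes "m > 0" "t \<ge> 0" "measure_pmf.prob p {x. P x} + t \<le> a"
  shows "measure_pmf.prob (replicate_pmf m p) {xs. a * real m \<le> real (length (filter P xs))}
    \<le> exp (- 2 * real m * t\<^sup>2)"
proof -
  let ?q = "measure_pmf.prob p {x. P x}"
  interpret binomial_distribution m ?q by unfold_locales auto
  have "measure_pmf.prob (binomial_pmf m ?q) {k. a * real m \<le> real k}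
      \<le> measure_pmf.prob (binomial_pmf m ?q) {k. ?q + t \<le> real k / real m}"
  proof (intro measure_pmf.finite_measure_mono subsetI)
    fix k assume "k \<in> {k. a * real m \<le> real k}"
    then have "a \<le> real k / real m" using assms(1) by (simp add: field_simps)
    with assms(3) show "k \<in> {k. ?q + t \<le> real k / real m}" by simp
  qed simp
  also have "\<dots> \<le> exp (- 2 * real m * t\<^sup>2)" using prob_ge'[OF assms(1,2)] by simp
  finally show ?thesis by (subst prob_count[where R = "\<lambda>k. a * real m \<le> real k"])
qed

text \<open>The exponential moment of the count \<open>k\<close> is \<open>E[2 ^ k] = (1 + q) ^ m\<close>.\<close>

lemma prob_count_gt_twice:
  assumes "measure_pmf.prob p {x. P x} \<le> a / 2"
  shows "measure_pmf.prob (replicate_pmf m p) {xs. a * real m < real (length (filter P xs))}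
    \<le> exp (- (a * real m / 6))"
proof -
  define q where "q = measure_pmf.prob p {x. P x}"
  define s where "s = a * real m"
  have q: "0 \<le> q" "q \<le> 1" "q \<in> {0..1}" by (simp_all add: q_def)
  have s: "q * real m \<le> s / 2" "0 \<le> s"
  proof -
    have "q * real m \<le> a / 2 * real m" using assms by (intro mult_right_mono) (simp_all add: q_def)
    then show "q * real m \<le> s / 2" by (simp add: s_def)
    have "0 \<le> a" using assms q(1) unfolding q_def by linarith
    then show "0 \<le> s" by (simp add: s_def)
  qed
  have moment: "measure_pmf.expectation (binomial_pmf m q) (\<lambda>k. 2 ^ k) = (1 + q) ^ m"
  proof -
    have "measure_pmf.expectation (binomial_pmf m q) (\<lambda>k. 2 ^ k) =
        (\<Sum>k\<le>m. (real (m choose k) * q ^ k * (1 - q) ^ (m - k)) * 2 ^ k)"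
      using q(3) by (subst expectation_binomial_pmf') auto
    also have "\<dots> = (\<Sum>k\<le>m. real (m choose k) * (2 * q) ^ k * (1 - q) ^ (m - k))"
      by (intro sum.cong) (simp_all add: power_mult_distrib)
    also have "\<dots> = (2 * q + (1 - q)) ^ m" by (rule binomial_ring[symmetric])
    finally show ?thesis by (simp add: add.commute)
  qed
  have "measure_pmf.prob (binomial_pmf m q) {k. s < real k} =
      measure_pmf.expectation (binomial_pmf m q) (indicator {k. s < real k})" by simp
  \<comment> \<open>Markov's inequality for \<open>2 ^ k\<close>.\<close>
  also have "\<dots> \<le> measure_pmf.expectation (binomial_pmf m q) (\<lambda>k. 2 ^ k / 2 powr s)"
  proof (intro integral_mono integrable_binomial_pmf q(3))
    fix k
    have "1 \<le> 2 ^ k / 2 powr s" if "s < real k"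
      using that powr_mono[of s "real k" 2] by (simp add: powr_realpow)
    then show "indicator {k. s < real k} k \<le> 2 ^ k / 2 powr s" by (simp add: indicator_def)
  qed
  also have "\<dots> = (1 + q) ^ m / 2 powr s" by (simp add: moment)
  also have "\<dots> \<le> exp (q * real m) / 2 powr s"
    using exp_ge_add_one_self[of q] q(1)
    by (intro divide_right_mono) (simp_all add: exp_of_nat2_mult power_mono)
  also have "\<dots> = exp (q * real m - s * ln 2)" by (simp add: powr_def exp_diff)
  \<comment> \<open>The 6 arises from \<open>ln 2 \<ge> 2 / 3\<close>: the exponent is at most
    \<open>s / 2 - 2 * s / 3\<close>.\<close>
  also have "\<dots> \<le> exp (- (s / 6))"
  proof -
    have "s * (2 / 3) \<le> s * ln 2" using ln2_ge_two_thirds s(2) by (intro mult_left_mono) auto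
    with s(1) show ?thesis by simp
  qed
  finally show ?thesis
    unfolding s_def q_def by (subst prob_count[where R = "\<lambda>k. a * real m < real k"])
qed

text \<open>A union bound over the samples, obtained as Bernoulli's inequality for the probability
  that the count is nonzero.\<close>

lemma prob_exists_sample:
  "measure_pmf.prob (replicate_pmf m p) {xs. \<exists>x\<in>set xs. P x}
    \<le> real m * measure_pmf.prob p {x. P x}"
proof -
  define q where "q = measure_pmf.prob p {x. P x}"
  have q: "q \<in> {0..1}" by (simp add: q_def)
  have "{xs. \<exists>x\<in>set xs. P x} = {xs. length (filter P xs) \<noteq> 0}"
    by (auto simp: filter_empty_conv)
  then have "measure_pmf.prob (replicate_pmf m p) {xs. \<exists>x\<in>set xs. P x} =
      measure_pmf.prob (binomial_pmf m q) {k. k \<noteq> 0}"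
    using prob_count[of m p "\<lambda>k. k \<noteq> 0" P] by (simp only: q_def)
  also have "{k. k \<noteq> 0} = UNIV - {0::nat}" by auto
  also have "measure_pmf.prob (binomial_pmf m q) \<dots> = 1 - pmf (binomial_pmf m q) 0"
    by (simp add: measure_pmf.prob_compl[unfolded space_measure_pmf, simplified] measure_pmf_single)
  also have "\<dots> = 1 - (1 - q) ^ m" using q by simp
  also have "\<dots> \<le> real m * q" using Bernoulli_inequality[of "- q" m] q by simp
  finally show ?thesis by (simp add: q_def)
qed

text \<open>Given the first \<open>k\<close> samples, the other \<open>m\<close> are still
  independent, so the tested property may depend on what was learned. Prefixes outside
  \<open>G\<close> are charged their full probability, the others at most \<open>b\<close>.\<close>

lemma prob_split_samples:
  assumes "measure_pmf.prob (replicate_pmf k p) {xs. \<not> G xs} \<le> a" "a \<ge> 0" "b \<ge> 0"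
    and "\<And>xs. G xs \<Longrightarrow> measure_pmf.prob (replicate_pmf m p) {ys. R xs ys} \<le> b"
  shows "measure_pmf.prob (replicate_pmf (k + m) p) {zs. R (take k zs) (drop k zs)} \<le> a + b"
proof -
  let ?M = "measure_pmf (replicate_pmf k p)" and ?N = "measure_pmf (replicate_pmf m p)"
  let ?S = "{zs. R (take k zs) (drop k zs)}"
  have "emeasure (replicate_pmf (k + m) p) ?S =
      (\<integral>\<^sup>+xs. emeasure (bind_pmf (replicate_pmf m p) (\<lambda>ys. return_pmf (xs @ ys))) ?S \<partial>?M)"
    by (simp add: replicate_pmf_distrib del: emeasure_return_pmf)
  also have "\<dots> = (\<integral>\<^sup>+xs. emeasure ?N {ys. R xs ys} \<partial>?M)"
  proof (intro nn_integral_cong_AE AE_pmfI)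
    fix xs assume "xs \<in> set_pmf (replicate_pmf k p)"
    then have "length xs = k" by (simp add: set_replicate_pmf)
    then have "(\<lambda>ys. xs @ ys) -` ?S = {ys. R xs ys}" by auto
    moreover have "bind_pmf (replicate_pmf m p) (\<lambda>ys. return_pmf (xs @ ys)) = map_pmf (\<lambda>ys. xs @ ys) (replicate_pmf m p)"
      by (simp add: map_pmf_def)
    ultimately show "emeasure (bind_pmf (replicate_pmf m p) (\<lambda>ys. return_pmf (xs @ ys))) ?S = emeasure ?N {ys. R xs ys}"
      by (simp only: emeasure_map_pmf)
  qed
  also have "\<dots> \<le> (\<integral>\<^sup>+xs. indicator {xs. \<not> G xs} xs + ennreal b \<partial>?M)"
  proof (intro nn_integral_mono)
    fix xs
    show "emeasure ?N {ys. R xs ys} \<le> indicator {xs. \<not> G xs} xs + ennreal b"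
    proof (cases "G xs")
      case True
      then show ?thesis
        using assms(4)[OF True] by (simp add: measure_pmf.emeasure_eq_measure ennreal_leI)
    next
      case False
      have "emeasure ?N {ys. R xs ys} \<le> 1" by (rule measure_pmf.emeasure_le_1)
      with False show ?thesis by (simp add: add_increasing2)
    qed
  qed
  also have "\<dots> = emeasure ?M {xs. \<not> G xs} + ennreal b"
    by (simp add: nn_integral_add)
  also have "\<dots> \<le> ennreal a + ennreal b"
    using assms(1) by (intro add_right_mono) (simp add: measure_pmf.emeasure_eq_measure ennreal_leI)
  also have "\<dots> = ennreal (a + b)" using assms(2,3) by simp
  finally show ?thesis
    using assms(2,3) by (simp only: measure_pmf.emeasure_eq_measure ennreal_le_iff add_nonneg_nonneg)
qed

section \<open>Masked examples\<close>

definition hide :: "(nat \<Rightarrow> bool) \<Rightarrow> assignment \<Rightarrow> passignment" where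
  "hide keep x = (\<lambda>i. if keep i then Some (x i) else None)"

text \<open>The domain is a parameter so that examined variables can be taken out one at a time;
  outside it the default is \<open>False\<close>, that is, masked.\<close>

definition keep_pmf :: "nat set \<Rightarrow> real \<Rightarrow> (nat \<Rightarrow> bool) pmf" where
  "keep_pmf A \<mu> = Pi_pmf A False (\<lambda>_. bernoulli_pmf \<mu>)"

lemma finite_set_keep_pmf: "finite A \<Longrightarrow> finite (set_pmf (keep_pmf A \<mu>))"
  unfolding keep_pmf_def
  by (rule finite_subset[OF set_Pi_pmf_subset']) (auto intro!: finite_PiE_dflt)

text \<open>The mask is drawn independently of the example, so the two draws can be exchanged and
  estimates can be made for each fixed mask.\<close>

lemma prob_masked:
  "measure_pmf.prob (masked n \<mu> D) {\<rho>. P \<rho>} =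
     measure_pmf.expectation (keep_pmf {..<n} \<mu>) (\<lambda>keep. measure_pmf.prob D {x. P (hide keep x)})"
proof -
  let ?K = "keep_pmf {..<n} \<mu>"
  have "masked n \<mu> D = D \<bind> (\<lambda>x. ?K \<bind> (\<lambda>keep. return_pmf (hide keep x)))"
    by (simp add: masked_def mask_def[abs_def] keep_pmf_def map_pmf_def hide_def)
  also have "\<dots> = ?K \<bind> (\<lambda>keep. map_pmf (hide keep) D)"
    by (subst bind_commute_pmf) (simp add: map_pmf_def)
  finally have *: "masked n \<mu> D = ?K \<bind> (\<lambda>keep. map_pmf (hide keep) D)" .
  have "ennreal (measure_pmf.prob (masked n \<mu> D) {\<rho>. P \<rho>}) =
      (\<integral>\<^sup>+keep. ennreal (measure_pmf.prob D {x. P (hide keep x)}) \<partial>?K)"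
    unfolding * measure_pmf.emeasure_eq_measure[symmetric] by (simp add: vimage_def)
  also have "\<dots> = ennreal (measure_pmf.expectation ?K (\<lambda>keep. measure_pmf.prob D {x. P (hide keep x)}))"
    by (intro nn_integral_eq_integral integrable_measure_pmf_finite finite_set_keep_pmf) auto
  finally show ?thesis by (simp add: Bochner_Integration.integral_nonneg)
qed

lemma prob_le_prob_masked:
  assumes "\<And>x keep. Q x \<Longrightarrow> P (hide keep x)"
  shows "measure_pmf.prob D {x. Q x} \<le> measure_pmf.prob (masked n \<mu> D) {\<rho>. P \<rho>}"
proof -
  have "measure_pmf.expectation (keep_pmf {..<n} \<mu>) (\<lambda>_. measure_pmf.prob D {x. Q x})
      \<le> measure_pmf.prob (masked n \<mu> D) {\<rho>. P \<rho>}"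
    unfolding prob_masked using assms
    by (intro integral_mono integrable_measure_pmf_finite finite_set_keep_pmf
          measure_pmf.finite_measure_mono) auto
  then show ?thesis by simp
qed

lemma prob_keep_all:
  assumes "V \<subseteq> {..<n}" "0 \<le> \<mu>" "\<mu> \<le> 1"
  shows "measure_pmf.prob (keep_pmf {..<n} \<mu>) {keep. \<forall>i\<in>V. keep i} = \<mu> ^ card V"
proof -
  have "{keep. \<forall>i\<in>V. keep i} = Pi {..<n} (\<lambda>i. if i \<in> V then {True} else UNIV)"
    using assms(1) by (auto simp: Pi_def)
  then have "measure_pmf.prob (keep_pmf {..<n} \<mu>) {keep. \<forall>i\<in>V. keep i} =
      (\<Prod>i<n. measure_pmf.prob (bernoulli_pmf \<mu>) (if i \<in> V then {True} else UNIV))"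
    unfolding keep_pmf_def by (simp only: measure_Pi_pmf_Pi finite_lessThan)
  also have "\<dots> = (\<Prod>i<n. if i \<in> V then \<mu> else 1)"
    using assms(2,3) by (intro prod.cong) (auto simp: measure_pmf_single)
  also have "\<dots> = \<mu> ^ card V"
    using assms(1) by (simp add: prod.If_cases Int_absorb1)
  finally show ?thesis .
qed

text \<open>Without complementary literals the clause has \<open>card K\<close> distinct variables.
  All of them must be visible, and this event is independent of the falsity of
  \<open>K\<close>.\<close>

lemma prob_witnessed_false:
  assumes "K \<subseteq> lits n" "\<not> taut K" "0 \<le> \<mu>" "\<mu> \<le> 1"
  shows "measure_pmf.prob (masked n \<mu> D) {\<rho>. witnessed_false \<rho> K} = \<mu> ^ card K * false_prob D K"
proof -
  let ?A = "{keep. \<forall>i\<in>fst ` K. keep i}"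
  have "measure_pmf.prob D {x. witnessed_false (hide keep x) K} = indicator ?A keep * false_prob D K" for keep
  proof (cases "keep \<in> ?A")
    case True
    then have "witnessed_false (hide keep x) K \<longleftrightarrow> \<not> clause_true x K" for x
      by (auto simp: witnessed_false_def hide_def clause_true_def lit_true_def)
    with True show ?thesis by (simp add: false_prob_def)
  next
    case False
    then have "\<not> witnessed_false (hide keep x) K" for x
      by (auto simp: witnessed_false_def hide_def)
    with False show ?thesis by simp
  qed
  then have "measure_pmf.prob (masked n \<mu> D) {\<rho>. witnessed_false \<rho> K} =
      measure_pmf.prob (keep_pmf {..<n} \<mu>) ?A * false_prob D K"
    by (simp add: prob_masked)
  also have "measure_pmf.prob (keep_pmf {..<n} \<mu>) ?A = \<mu> ^ card (fst ` K)"
    using assms by (intro prob_keep_all) (auto simp: lits_def)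
  also have "card (fst ` K) = card K" by (rule card_image[OF inj_on_fst_nontaut[OF assms(2)]])
  finally show ?thesis .
qed

section \<open>Adaptive examination of a clause\<close>

lemma false_prob_split: "false_prob D (insert l L) + false_prob D (insert (neg l) L) = false_prob D L"
proof -
  have "{x. \<not> clause_true x L} = {x. \<not> clause_true x (insert l L)} \<union> {x. \<not> clause_true x (insert (neg l) L)}"
    by (auto simp: clause_true_def)
  moreover have "{x. \<not> clause_true x (insert l L)} \<inter> {x. \<not> clause_true x (insert (neg l) L)} = {}"
    by (auto simp: clause_true_def)
  ultimately show ?thesis
    unfolding false_prob_def by (simp add: measure_pmf.finite_measure_Union)
qed

text \<open>The correlation gap is applied to the conjunction of the negated literals of
  \<open>L\<close>. In the balanced case at most a fraction \<open>1 - \<beta>\<close> of the mass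
  also makes \<open>l\<close> false. In the implied case the conditional error is at least the joint
  one, so \<open>l\<close> is settled.\<close>

lemma settled_or_decreasing:
  assumes gap: "correlation_gap n w \<beta> (1 - \<eta>) D" and "\<eta> \<ge> 0"
    and L: "L \<subseteq> lits n" "card L \<le> w" and l: "l \<in> lits n"
  shows "settled D \<eta> L l \<or> false_prob D (insert l L) \<le> (1 - \<beta>) * false_prob D L"
\<comment> \<open>The gap says nothing about conjunctions of probability 0, but there every literal
  is settled.\<close>
proof (cases "false_prob D L = 0")
  case True
  then have "false_prob D (insert l L) \<le> \<eta>"
    using false_prob_antimono[of L "insert l L" D, OF subset_insertI] assms(2) by simp
  then show ?thesis by (simp add: settled_def)
next
  case False
  then have pos: "false_prob D L > 0" using false_prob_nonneg[of D L] by linarith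
  have conj: "conj_true x (neg ` L) \<longleftrightarrow> \<not> clause_true x L" for x
    by (auto simp: conj_true_def clause_true_def)
  have cond: "\<P>(x in D. lit_true x k \<bar> conj_true x (neg ` L)) = false_prob D (insert (neg k) L) / false_prob D L" for k
  proof -
    have "{x. lit_true x k \<and> conj_true x (neg ` L)} = {x. \<not> clause_true x (insert (neg k) L)}"
      by (auto simp: conj clause_true_def)
    then show ?thesis by (simp add: cond_prob_def conj false_prob_def)
  qed
  have negL: "neg ` L \<subseteq> lits n" "card (neg ` L) \<le> w"
    using L by (auto intro: order_trans[OF card_image_le[OF finite_clause[OF L(1)]]])
  have "\<P>(x in D. conj_true x (neg ` L)) \<noteq> 0"
    using False by (simp add: conj false_prob_def)
  moreover have "fst l < n" using l by (auto simp: lits_def)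
  ultimately consider "balanced D \<beta> (neg ` L) (fst l)" | b where "implied D (1 - \<eta>) (neg ` L) (fst l, b)"
    using gap[unfolded correlation_gap_def, rule_format, OF negL] by blast
  then show ?thesis
  proof cases
    case 1
    have "\<P>(x in D. lit_true x l \<bar> conj_true x (neg ` L)) \<ge> \<beta>"
      using 1 by (cases "snd l") (simp_all add: balanced_def lit_true_def)
    then have "\<beta> * false_prob D L \<le> false_prob D (insert (neg l) L)"
      unfolding cond using pos by (simp add: field_simps)
    with false_prob_split[of D l L] show ?thesis by (simp add: algebra_simps)
  next
    case 2
    then have k: "false_prob D (insert (neg k) L) \<ge> (1 - \<eta>) * false_prob D L" if "k = (fst l, b)" for k
      using pos that unfolding implied_def cond by (simp add: field_simps)
    have "false_prob D L \<le> 1" by (simp add: false_prob_def)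
    then have "\<eta> * false_prob D L \<le> \<eta>" using assms(2) mult_left_le by blast
    then have "false_prob D (insert (fst l, b) L) \<le> \<eta>"
      using k[OF refl] false_prob_split[of D "(fst l, b)" L] by (simp add: algebra_simps)
    moreover have "(fst l, b) = l \<or> (fst l, b) = neg l" by (rule eq_or_eq_neg) simp
    ultimately show ?thesis unfolding settled_def by auto
  qed
qed

text \<open>The last alternative of \<open>tame\<close>, with \<open>S\<close> as the set of visible
  literals of \<open>C\<close>. It depends on the mask alone and not on the values, so it can be
  decided before the example is drawn.\<close>

definition resolved :: "assignment pmf \<Rightarrow> real \<Rightarrow> nat \<Rightarrow> clause \<Rightarrow> clause \<Rightarrow> bool" where
  "resolved D \<eta> w C S \<longleftrightarrow> (\<exists>Q\<subseteq>C. card Q < w \<and> (\<forall>l\<in>C - Q. settled D \<eta> (Q \<inter> S) l))"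

text \<open>
  Here \<open>Q\<close> is the set of literals examined so far and \<open>L\<close> is the set of visible ones among them.
\<close>

lemma expectation_unresolved_le:
  fixes D \<eta> w C
  defines "h \<equiv> \<lambda>S. if resolved D \<eta> w C S then 0 else false_prob D S"
  assumes gap: "correlation_gap n w \<beta> (1 - \<eta>) D" and eta: "\<eta> \<ge> 0" and mu: "0 \<le> \<mu>" "\<mu> \<le> 1"
    and beta: "0 \<le> \<beta>" "\<beta> \<le> 1"
    and C: "C \<subseteq> lits n" "\<not> taut C"
    and "Q \<subseteq> C" "L \<subseteq> Q" "card Q + k = w"
  shows "measure_pmf.expectation (keep_pmf ({..<n} - fst ` Q) \<mu>) (\<lambda>keep. h (L \<union> {l \<in> C. keep (fst l)}))
    \<le> (1 - \<mu> * \<beta>) ^ k * false_prob D L"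
  using assms(10-)
proof (induction k arbitrary: Q L)
  case 0
  have "measure_pmf.expectation (keep_pmf ({..<n} - fst ` Q) \<mu>) (\<lambda>keep. h (L \<union> {l \<in> C. keep (fst l)}))
      \<le> measure_pmf.expectation (keep_pmf ({..<n} - fst ` Q) \<mu>) (\<lambda>_. false_prob D L)"
    by (intro integral_mono integrable_measure_pmf_finite finite_set_keep_pmf)
      (auto simp: h_def false_prob_nonneg intro: false_prob_antimono)
  then show ?case by simp
next
  case (Suc k)
  have finQ: "finite Q" using Suc(2) C(1) finite_clause by blast
  have LC: "L \<subseteq> lits n" using Suc(2,3) C(1) by blast
  have Lw: "card L \<le> w" using card_mono[OF finQ Suc(3)] Suc(4) by simp
  show ?case
  proof (cases "\<forall>l\<in>C - Q. settled D \<eta> L l")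
    case True
    \<comment> \<open>The process stops: variables of \<open>Q\<close> are outside the domain and
      take the default \<open>False\<close>, so exactly \<open>L\<close> is visible within
      \<open>Q\<close>, and \<open>Q\<close> itself shows that the clause is resolved.\<close>
    have "h (L \<union> {l \<in> C. keep (fst l)}) = 0" if "keep \<in> set_pmf (keep_pmf ({..<n} - fst ` Q) \<mu>)" for keep
    proof -
      have "\<not> keep (fst l)" if "l \<in> Q" for l
        using set_Pi_pmf_subset[of "{..<n} - fst ` Q" False] \<open>keep \<in> _\<close> that
        unfolding keep_pmf_def by fastforce
      then have "Q \<inter> (L \<union> {l \<in> C. keep (fst l)}) = L" using Suc(3) by auto
      then have "resolved D \<eta> w C (L \<union> {l \<in> C. keep (fst l)})"
        unfolding resolved_def using True Suc(2,4) by (intro exI[of _ Q]) auto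
      then show ?thesis by (simp add: h_def)
    qed
    then have "measure_pmf.expectation (keep_pmf ({..<n} - fst ` Q) \<mu>) (\<lambda>keep. h (L \<union> {l \<in> C. keep (fst l)})) =
        measure_pmf.expectation (keep_pmf ({..<n} - fst ` Q) \<mu>) (\<lambda>_. 0)"
      by (intro integral_cong_AE) (auto simp: AE_measure_pmf_iff)
    moreover have "0 \<le> 1 - \<mu> * \<beta>" using mu beta mult_le_one[of \<mu> \<beta>] by simp
    ultimately show ?thesis by (simp add: false_prob_nonneg)
  next
    case False
    then obtain l where l: "l \<in> C" "l \<notin> Q" "\<not> settled D \<eta> L l" by blast
    have dec: "false_prob D (insert l L) \<le> (1 - \<beta>) * false_prob D L"
      using settled_or_decreasing[OF gap eta LC Lw, of l] l C(1) by blast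
    let ?A = "{..<n} - fst ` insert l Q"
    have nQ: "fst l \<notin> fst ` Q"
      using inj_on_fst_nontaut[OF C(2)] l(1,2) Suc(2) by (auto simp: inj_on_def)
    then have ins: "{..<n} - fst ` Q = insert (fst l) ?A" using l(1) C(1) by (auto simp: lits_def)
    have set_eq: "{k \<in> C. (keep(fst l := b)) (fst k)} = (if b then {l} else {}) \<union> {k \<in> C. keep (fst k)}"
      if "keep \<in> set_pmf (keep_pmf ?A \<mu>)" for keep b
    proof -
      have "\<not> keep (fst l)"
        using set_Pi_pmf_subset[of ?A False] that unfolding keep_pmf_def by fastforce
      moreover have "k = l" if "k \<in> C" "fst k = fst l" for k
        using inj_on_fst_nontaut[OF C(2)] that l(1) by (auto simp: inj_on_def)
      ultimately show ?thesis using l(1) by auto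
    qed
    \<comment> \<open>The coin of the examined variable is split off; since \<open>C\<close> is no
      tautology, \<open>l\<close> is the only literal of \<open>C\<close> that it uncovers.\<close>
    have "keep_pmf ({..<n} - fst ` Q) \<mu> =
        bernoulli_pmf \<mu> \<bind> (\<lambda>b. map_pmf (\<lambda>keep. keep(fst l := b)) (keep_pmf ?A \<mu>))"
      unfolding ins keep_pmf_def by (subst Pi_pmf_insert') (auto simp: map_pmf_def)
    then have "measure_pmf.expectation (keep_pmf ({..<n} - fst ` Q) \<mu>) (\<lambda>keep. h (L \<union> {l \<in> C. keep (fst l)})) =
       (\<Sum>b\<in>UNIV. pmf (bernoulli_pmf \<mu>) b *\<^sub>R measure_pmf.expectation
          (map_pmf (\<lambda>keep. keep(fst l := b)) (keep_pmf ?A \<mu>)) (\<lambda>keep. h (L \<union> {l \<in> C. keep (fst l)})))"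
      by (simp only:) (rule pmf_expectation_bind, auto intro: finite_set_keep_pmf)
    also have "\<dots> = (\<Sum>b\<in>UNIV. pmf (bernoulli_pmf \<mu>) b * measure_pmf.expectation
          (keep_pmf ?A \<mu>) (\<lambda>keep. h (L \<union> {k \<in> C. (keep(fst l := b)) (fst k)})))"
      by simp
    also have "\<dots> = (\<Sum>b\<in>UNIV. pmf (bernoulli_pmf \<mu>) b * measure_pmf.expectation
          (keep_pmf ?A \<mu>) (\<lambda>keep. h ((if b then insert l L else L) \<union> {k \<in> C. keep (fst k)})))"
    proof (intro sum.cong refl arg_cong2[where f = "(*)"] integral_cong_AE)
      fix b
      show "AE keep in keep_pmf ?A \<mu>. h (L \<union> {k \<in> C. (keep(fst l := b)) (fst k)}) =
          h ((if b then insert l L else L) \<union> {k \<in> C. keep (fst k)})"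
        by (intro AE_pmfI) (simp only: set_eq, simp)
    qed auto
    also have "\<dots> = \<mu> * measure_pmf.expectation (keep_pmf ?A \<mu>) (\<lambda>keep. h (insert l L \<union> {k \<in> C. keep (fst k)})) +
        (1 - \<mu>) * measure_pmf.expectation (keep_pmf ?A \<mu>) (\<lambda>keep. h (L \<union> {k \<in> C. keep (fst k)}))"
      using mu by (simp add: UNIV_bool)
    also have "\<dots> \<le> \<mu> * ((1 - \<mu> * \<beta>) ^ k * false_prob D (insert l L)) +
        (1 - \<mu>) * ((1 - \<mu> * \<beta>) ^ k * false_prob D L)"
      using mu Suc(2-4) l(1,2) finQ
      by (intro add_mono mult_left_mono Suc.IH) auto
    also have "\<dots> = (1 - \<mu> * \<beta>) ^ k * (\<mu> * false_prob D (insert l L) + (1 - \<mu>) * false_prob D L)"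
      by (simp add: algebra_simps)
    \<comment> \<open>A visible literal retains a fraction \<open>1 - \<beta>\<close> of the mass, a
      masked one all of it; on average this is
      \<open>\<mu> * (1 - \<beta>) + (1 - \<mu>) = 1 - \<mu> * \<beta>\<close>.\<close>
    also have "\<dots> \<le> (1 - \<mu> * \<beta>) ^ k * (\<mu> * ((1 - \<beta>) * false_prob D L) + (1 - \<mu>) * false_prob D L)"
      using mu beta dec mult_le_one[of \<mu> \<beta>]
      by (intro mult_left_mono add_mono) auto
    also have "\<dots> = (1 - \<mu> * \<beta>) ^ Suc k * false_prob D L"
      by (simp add: algebra_simps)
    finally show ?thesis .
  qed
qed

text \<open>For a fixed mask, tameness can fail only if the clause is unresolved and all its visible
  literals are false. The expected probability of this is bounded by running the process from the
  empty set with \<open>w\<close> examinations.\<close>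

lemma prob_not_tame:
  assumes gap: "correlation_gap n w \<beta> (1 - \<eta>) D" and eta: "\<eta> \<ge> 0" and mu: "0 \<le> \<mu>" "\<mu> \<le> 1"
    and beta: "0 \<le> \<beta>" "\<beta> \<le> 1" and C: "C \<subseteq> lits n"
  shows "measure_pmf.prob (masked n \<mu> D) {\<rho>. \<not> tame D \<eta> w \<rho> C} \<le> (1 - \<mu> * \<beta>) ^ w"
proof (cases "taut C")
  case True
  then show ?thesis using mu beta mult_le_one[of \<mu> \<beta>] by (simp add: tame_def)
next
  case False
  let ?h = "\<lambda>S. if resolved D \<eta> w C S then 0 else false_prob D S"
  have "measure_pmf.prob D {x. \<not> tame D \<eta> w (hide keep x) C} \<le> ?h {l \<in> C. keep (fst l)}" for keep
  proof -
    let ?S = "{l \<in> C. keep (fst l)}"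
    have vis: "visible (hide keep x) Q = Q \<inter> ?S" if "Q \<subseteq> C" for Q x
      using that by (auto simp: visible_def hide_def)
    show ?thesis
    proof (cases "resolved D \<eta> w C ?S")
      case True
      then have "tame D \<eta> w (hide keep x) C" for x
        unfolding resolved_def tame_def using vis by metis
      then show ?thesis using True by simp
    next
      case False
      have "\<not> clause_true x ?S" if "\<not> tame D \<eta> w (hide keep x) C" for x
      proof -
        have "\<not> witnessed_true (hide keep x) C" using that by (simp add: tame_def)
        then show ?thesis by (auto simp: witnessed_true_def hide_def clause_true_def lit_true_def)
      qed
      then show ?thesis
        using False unfolding false_prob_def by (auto intro!: measure_pmf.finite_measure_mono)
    qed
  qed
  then have "measure_pmf.prob (masked n \<mu> D) {\<rho>. \<not> tame D \<eta> w \<rho> C} \<le>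
      measure_pmf.expectation (keep_pmf {..<n} \<mu>) (\<lambda>keep. ?h {l \<in> C. keep (fst l)})"
    unfolding prob_masked by (intro integral_mono integrable_measure_pmf_finite finite_set_keep_pmf) auto
  also have "\<dots> \<le> (1 - \<mu> * \<beta>) ^ w"
    using expectation_unresolved_le[OF gap eta mu beta C False, of "{}" "{}" w]
    by (simp add: false_prob_empty cong: if_cong)
  finally show ?thesis .
qed

section \<open>Running time\<close>

lemma time_map_tm: "time (map_tm f xs) = Suc (\<Sum>x\<leftarrow>xs. Suc (time (f x)))"
  by (induction xs) simp_all

lemma time_filter_tm: "time (filter_tm P xs) = Suc (\<Sum>x\<leftarrow>xs. Suc (time (P x)))"
  by (induction xs) simp_all

lemma time_ex_tm: "time (ex_tm P xs) \<le> Suc (\<Sum>x\<leftarrow>xs. Suc (time (P x)))"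
  by (induction xs) (simp_all add: le_SucI trans_le_add1)

lemma time_all_tm: "time (all_tm P xs) \<le> Suc (\<Sum>x\<leftarrow>xs. Suc (time (P x)))"
  by (induction xs) (simp_all add: le_SucI trans_le_add1)

lemma sum_list_le_length_mult:
  fixes f :: "'a \<Rightarrow> nat"
  shows "(\<And>x. x \<in> set xs \<Longrightarrow> f x \<le> b) \<Longrightarrow> (\<Sum>x\<leftarrow>xs. f x) \<le> length xs * b"
  by (induction xs) (fastforce intro: add_mono)+

lemma time_ex_tm_le:
  assumes "\<And>x. x \<in> set xs \<Longrightarrow> time (P x) \<le> b" "length xs \<le> m"
  shows "time (ex_tm P xs) \<le> Suc (m * Suc b)"
proof -
  have "(\<Sum>x\<leftarrow>xs. Suc (time (P x))) \<le> length xs * Suc b"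
    using assms(1) by (intro sum_list_le_length_mult) auto
  also have "\<dots> \<le> m * Suc b" using assms(2) by (rule mult_le_mono1)
  finally show ?thesis using time_ex_tm[of P xs] by simp
qed

lemma time_filter_tm_le:
  assumes "\<And>x. x \<in> set xs \<Longrightarrow> time (P x) \<le> b" "length xs \<le> m"
  shows "time (filter_tm P xs) \<le> Suc (m * Suc b)"
proof -
  have "(\<Sum>x\<leftarrow>xs. Suc (time (P x))) \<le> length xs * Suc b"
    using assms(1) by (intro sum_list_le_length_mult) auto
  also have "\<dots> \<le> m * Suc b" using assms(2) by (rule mult_le_mono1)
  finally show ?thesis by (simp add: time_filter_tm)
qed

lemma time_fold_tm_le:
  assumes "\<And>x s. x \<in> set xs \<Longrightarrow> I s \<Longrightarrow> time (f x s) \<le> b \<and> I (val (f x s))" "I s"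
  shows "time (fold_tm f xs s) \<le> Suc (length xs * Suc b)"
  using assms
proof (induction xs arbitrary: s)
  case (Cons x xs)
  have "time (f x s) \<le> b" "I (val (f x s))" using Cons.prems by auto
  moreover have "time (fold_tm f xs (val (f x s))) \<le> Suc (length xs * Suc b)"
    using Cons.prems by (intro Cons.IH) auto
  ultimately show ?case by simp
qed simp

lemma time_length_tm: "time (length_tm xs) = Suc (length xs)"
  by (induction xs) simp_all

lemma time_append_tm: "time (append_tm xs ys) = Suc (length xs)"
  by (induction xs) simp_all

lemma time_split_tm: "time (split_tm k xs) \<le> Suc (length xs)"
  by (induction k xs rule: split_tm.induct) simp_all

lemma time_mem_tm: "time (mem_tm l C) \<le> length C + 2"
  using time_ex_tm_le[of C "\<lambda>k. ret (k = l)" 0] by (simp add: mem_tm_def)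

lemma time_subset_tm: "time (subset_tm C D) \<le> length C * (length D + 3) + 2"
proof -
  have "(\<Sum>x\<leftarrow>C. Suc (time (mem_tm x D))) \<le> length C * (length D + 3)"
    using time_mem_tm[of _ D] by (intro sum_list_le_length_mult) (simp add: le_SucI)
  then show ?thesis
    using time_all_tm[of "\<lambda>l. mem_tm l D" C] by (simp add: subset_tm_def)
qed

lemma time_delete_tm: "time (delete_tm l C) = length C + 2"
  by (simp add: delete_tm_def time_filter_tm sum_list_triv)

lemma time_witnessed_true_tm: "time (witnessed_true_tm \<rho> C) \<le> length C + 2"
  using time_ex_tm_le[of C "\<lambda>l. ret (\<rho> (fst l) = Some (snd l))" 0] by (simp add: witnessed_true_tm_def)

lemma time_witnessed_false_tm: "time (witnessed_false_tm \<rho> C) \<le> length C + 2"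
  using time_all_tm[of "\<lambda>l. ret (\<rho> (fst l) = Some (\<not> snd l))" C]
  by (simp add: witnessed_false_tm_def sum_list_triv)

lemma length_lits_tm: "length (val (lits_tm n)) = 2 * n"
  by (induction n) simp_all

lemma time_lits_tm: "time (lits_tm n) = Suc n"
  by (induction n) simp_all

lemma length_sublists_tm: "length (val (sublists_tm k ls)) \<le> Suc (length ls) ^ k"
proof (induction k ls rule: sublists_tm.induct)
  case (3 k l ls)
  let ?m = "length ls"
  have "length (val (sublists_tm (Suc k) (l # ls))) \<le> Suc ?m ^ k + Suc ?m ^ Suc k"
    using 3 by simp
  also have "\<dots> = Suc ?m ^ k * Suc (Suc ?m)" by simp
  also have "\<dots> \<le> Suc (Suc ?m) ^ k * Suc (Suc ?m)" by (intro mult_le_mono1 power_mono) auto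
  finally show ?case by (simp add: mult.commute)
qed simp_all

lemma length_elem_sublists_tm: "C \<in> set (val (sublists_tm k ls)) \<Longrightarrow> length C \<le> k"
  by (induction k ls arbitrary: C rule: sublists_tm.induct) (auto simp: le_SucI)

text \<open>With \<open>m = Suc (length ls)\<close> the recurrence closes because
  \<open>m * (m + 2) \<le> Suc m * Suc m\<close>; the spare multiple of \<open>m ^ Suc k\<close>
  absorbs the cost of prefixing and appending.\<close>

lemma time_sublists_tm: "time (sublists_tm k ls) \<le> 5 * Suc (length ls) ^ Suc k"
proof (induction k ls rule: sublists_tm.induct)
  case (3 k l ls)
  let ?m = "Suc (length ls)"
  have "time (sublists_tm (Suc k) (l # ls)) =
      Suc (time (sublists_tm k ls) + time (sublists_tm (Suc k) ls)
        + 2 * Suc (length (val (sublists_tm k ls))))"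
    by (simp add: time_map_tm time_append_tm sum_list_triv)
  also have "\<dots> \<le> Suc (5 * ?m ^ Suc k + 5 * ?m ^ Suc (Suc k) + 2 * Suc (?m ^ k))"
    using 3 length_sublists_tm[of k ls] by (intro Suc_le_mono[THEN iffD2] add_mono mult_le_mono2) auto
  also have "\<dots> \<le> 5 * (?m ^ Suc (Suc k) + 2 * ?m ^ Suc k)"
  proof -
    have "?m ^ k \<le> ?m ^ Suc k" "1 \<le> ?m ^ Suc k" by (simp, intro one_le_power) simp
    moreover have "a \<le> b \<Longrightarrow> 1 \<le> b \<Longrightarrow> Suc (5 * b + 5 * c + 2 * Suc a) \<le> 5 * (c + 2 * b)" for a b c :: nat
      by arith
    ultimately show ?thesis by blast
  qed
  also have "?m ^ Suc (Suc k) + 2 * ?m ^ Suc k = ?m ^ k * (?m * (?m + 2))" by (simp add: algebra_simps)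
  also have "5 * \<dots> \<le> 5 * (Suc ?m ^ k * (Suc ?m * Suc ?m))"
  proof -
    have "?m * (?m + 2) \<le> Suc ?m * Suc ?m" by simp
    moreover have "?m ^ k \<le> Suc ?m ^ k" by (intro power_mono) auto
    ultimately show ?thesis by (rule mult_le_mono2[OF mult_le_mono[rotated]])
  qed
  also have "\<dots> = 5 * Suc (length (l # ls)) ^ Suc (Suc k)" by (simp add: algebra_simps)
  finally show ?case .
qed simp_all

lemma time_clauses_tm: "time (clauses_tm n k) \<le> 7 * (2 * n + 1) ^ Suc k"
proof -
  have "time (clauses_tm n k) \<le> n + 2 + 5 * (2 * n + 1) ^ Suc k"
    using time_sublists_tm[of k "val (lits_tm n)"]
    by (simp add: clauses_tm_def time_lits_tm length_lits_tm)
  moreover have "(2 * n + 1) ^ 1 \<le> (2 * n + 1) ^ Suc k" by (intro power_increasing) auto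
  ultimately show ?thesis by simp
qed

lemma length_clauses_tm: "length (val (clauses_tm n k)) \<le> (2 * n + 1) ^ k"
  using length_sublists_tm[of k "val (lits_tm n)"] by (simp add: clauses_tm_def length_lits_tm)

lemma length_elem_clauses_tm: "C \<in> set (val (clauses_tm n k)) \<Longrightarrow> length C \<le> k"
  by (rule length_elem_sublists_tm[of C k "val (lits_tm n)"]) (simp add: clauses_tm_def)

lemma cnf_size_append: "cnf_size (\<phi> @ \<psi>) = cnf_size \<phi> + cnf_size \<psi>"
  by (simp add: cnf_size_def)

lemma length_le_cnf_size: "length \<phi> \<le> cnf_size \<phi>"
  by (induction \<phi>) (simp_all add: cnf_size_def)

lemma cnf_size_le: "(\<And>C. C \<in> set \<phi> \<Longrightarrow> length C \<le> b) \<Longrightarrow> cnf_size \<phi> \<le> length \<phi> * Suc b"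
  unfolding cnf_size_def by (intro sum_list_le_length_mult) simp

lemma cnf_size_filter_le: "cnf_size (filter P \<phi>) \<le> cnf_size \<phi>"
  by (induction \<phi>) (simp_all add: cnf_size_def)

lemma cnf_size_map_le: "(\<And>C. length (f C) \<le> length C) \<Longrightarrow> cnf_size (map f \<phi>) \<le> cnf_size \<phi>"
  unfolding cnf_size_def by (induction \<phi>) (simp_all add: add_mono)

lemma sum_list_clause_le: "(\<Sum>C\<leftarrow>\<phi>. a * Suc (length C)) = a * cnf_size \<phi>"
  unfolding cnf_size_def by (induction \<phi>) (simp_all add: algebra_simps)

text \<open>Since \<open>M\<close> is at least \<open>100\<close>, one further factor \<open>M\<close> absorbs the constants.\<close>

lemma Suc_mult_Suc_le_power:
  fixes a M :: nat
  assumes "100 \<le> M" "a \<le> M ^ i"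
  shows "Suc (M * Suc a) \<le> M ^ (i + 2)"
proof -
  have "Suc (M * Suc a) \<le> Suc (M + M * M ^ i)" using assms(2) by simp
  also have "\<dots> \<le> 3 * (M * M ^ i)"
  proof -
    have "1 \<le> M ^ i" using assms(1) by (intro one_le_power) simp
    then have "M * 1 \<le> M * M ^ i" by (rule mult_le_mono2)
    then show ?thesis using assms(1) by linarith
  qed
  also have "\<dots> \<le> M * (M * M ^ i)" using assms(1) by (intro mult_le_mono1) simp
  finally show ?thesis by simp
qed

lemma time_ex_tm_le_power:
  assumes "100 \<le> M" "\<And>x. x \<in> set xs \<Longrightarrow> time (P x) \<le> M ^ i" "length xs \<le> M" "j = i + 2"
  shows "time (ex_tm P xs) \<le> M ^ j"
  unfolding assms(4)
  by (rule order_trans[OF time_ex_tm_le[OF assms(2,3)] Suc_mult_Suc_le_power[OF assms(1) order_refl]])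

text \<open>A single \<open>M\<close> bounds the number of candidate clauses, their length and the
  number of samples, so that the time bounds become powers of \<open>M\<close>.\<close>

lemma time_learn_tm:
  assumes "100 \<le> M" "(2 * n + 1) ^ Suc w \<le> M" "w \<le> M" "length \<rho>s \<le> M"
  shows "time (learn_tm n w t \<rho>s) \<le> M ^ 4"
proof -
  let ?Cs = "val (clauses_tm n w)"
  have len: "length ?Cs \<le> M"
    using length_clauses_tm[of n w] assms(2) power_increasing[of w "Suc w" "2 * n + 1"] by simp
  let ?P = "\<lambda>C. bind_tm (filter_tm (\<lambda>\<rho>. witnessed_false_tm \<rho> C) \<rho>s)
      (\<lambda>\<sigma>s. bind_tm (length_tm \<sigma>s) (\<lambda>k. ret (real k \<le> t)))"
  have P: "time (?P C) \<le> M * (M + 5)" if "C \<in> set ?Cs" for C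
  proof -
    have "length C \<le> M" using length_elem_clauses_tm[OF that] assms(3) by simp
    then have "time (witnessed_false_tm \<rho> C) \<le> M + 2" for \<rho>
      using time_witnessed_false_tm[of \<rho> C] by simp
    then have "time (filter_tm (\<lambda>\<rho>. witnessed_false_tm \<rho> C) \<rho>s) \<le> Suc (M * Suc (M + 2))"
      by (intro time_filter_tm_le assms(4))
    moreover have "length (filter (\<lambda>\<rho>. witnessed_false \<rho> (set C)) \<rho>s) \<le> M"
      by (rule order_trans[OF length_filter_le assms(4)])
    ultimately have "time (?P C) \<le> Suc (M * Suc (M + 2)) + Suc M" by (simp add: time_length_tm)
    also have "\<dots> \<le> M * (M + 5)" using assms(1) by (simp add: algebra_simps)
    finally show ?thesis .
  qed
  have "time (filter_tm ?P ?Cs) \<le> Suc (M * Suc (M * (M + 5)))"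
    by (intro time_filter_tm_le P len)
  moreover have "time (clauses_tm n w) \<le> 7 * M"
    using time_clauses_tm[of n w] assms(2) by simp
  ultimately have "time (learn_tm n w t \<rho>s) \<le> 1 + 7 * M + Suc (M * Suc (M * (M + 5)))"
    by (simp add: learn_tm_def)
  also have "\<dots> \<le> 100 * M ^ 3"
  proof -
    have "1 \<le> M ^ 3" "M \<le> M ^ 3" "M * M \<le> M ^ 3"
      using assms(1) by (simp_all add: power3_eq_cube)
    moreover have "1 + 7 * M + Suc (M * Suc (M * (M + 5))) = 2 + 8 * M + 5 * (M * M) + M ^ 3"
      by (simp add: algebra_simps power3_eq_cube)
    ultimately show ?thesis by linarith
  qed
  also have "\<dots> \<le> M * M ^ 3" using assms(1) by (rule mult_le_mono1)
  finally show ?thesis by (simp add: power_Suc[symmetric] del: power_Suc)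
qed

lemma time_cut_lit_tm:
  assumes "length C' \<le> M"
  shows "time (cut_lit_tm C' l C) \<le> 12 * Suc M * Suc (length C)"
proof -
  have "length (filter (\<lambda>k. k \<noteq> l) C') \<le> M" by (rule order_trans[OF length_filter_le assms])
  then have "time (mem_tm (neg l) (filter (\<lambda>k. k \<noteq> l) C')) \<le> M + 2"
    "time (subset_tm (filter (\<lambda>k. k \<noteq> l) C') C) \<le> M * (length C + 3) + 2"
    using time_mem_tm[of "neg l" "filter (\<lambda>k. k \<noteq> l) C'"]
      order_trans[OF time_subset_tm[of "filter (\<lambda>k. k \<noteq> l) C'" C], of "M * (length C + 3) + 2"]
    by (auto intro: mult_le_mono1)
  moreover have "time (cut_lit_tm C' l C) \<le> Suc (time (delete_tm l C') +
      time (mem_tm (neg l) (filter (\<lambda>k. k \<noteq> l) C')) + time (mem_tm (neg l) C) +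
      time (subset_tm (filter (\<lambda>k. k \<noteq> l) C') C) + time (delete_tm (neg l) C))"
    by (simp add: cut_lit_tm_def)
  moreover have "time (delete_tm l C') \<le> M + 2" using assms by (simp add: time_delete_tm)
  ultimately have "time (cut_lit_tm C' l C) \<le> Suc ((M + 2) + (M + 2) + (length C + 2)
      + (M * (length C + 3) + 2) + (length C + 2))"
    using time_mem_tm[of "neg l" C] time_delete_tm[of "neg l" C] by linarith
  also have "\<dots> \<le> 12 * Suc M * Suc (length C)" by (simp add: algebra_simps)
  finally show ?thesis .
qed

lemma length_val_cut_lit_tm: "length (val (cut_lit_tm C' l C)) \<le> length C"
  by (simp add: cut_lit_tm_def)

lemma length_fold_cut_lit_le: "length (fold (\<lambda>l C. val (cut_lit_tm C' l C)) ls C) \<le> length C"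
proof (induction ls arbitrary: C)
  case (Cons l ls)
  show ?case using order_trans[OF Cons length_val_cut_lit_tm] by simp
qed simp

lemma length_val_cut_clause_tm: "length (val (cut_clause_tm C' C)) \<le> length C"
  by (simp add: cut_clause_tm_def length_fold_cut_lit_le)

lemma length_fold_cut_clause_le: "length (fold (\<lambda>C' C. val (cut_clause_tm C' C)) \<psi> C) \<le> length C"
proof (induction \<psi> arbitrary: C)
  case (Cons C' \<psi>)
  show ?case using order_trans[OF Cons length_val_cut_clause_tm] by simp
qed simp

lemma time_cut_clause_tm:
  assumes "length C' \<le> M" "length C \<le> c"
  shows "time (cut_clause_tm C' C) \<le> 2 + M * Suc (12 * Suc M * Suc c)"
proof -
  have "time (fold_tm (cut_lit_tm C') C' C) \<le> Suc (length C' * Suc (12 * Suc M * Suc c))"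
  proof (rule time_fold_tm_le[where I = "\<lambda>C. length C \<le> c"])
    fix l and B :: "lit list" assume B: "length B \<le> c"
    have "time (cut_lit_tm C' l B) \<le> 12 * Suc M * Suc (length B)"
      by (rule time_cut_lit_tm[OF assms(1)])
    also have "\<dots> \<le> 12 * Suc M * Suc c" using B by (intro mult_le_mono2) simp
    finally show "time (cut_lit_tm C' l B) \<le> 12 * Suc M * Suc c \<and> length (val (cut_lit_tm C' l B)) \<le> c"
      using order_trans[OF length_val_cut_lit_tm B] by blast
  qed (rule assms(2))
  also have "\<dots> \<le> Suc (M * Suc (12 * Suc M * Suc c))"
    using mult_le_mono1[OF assms(1)] by (rule Suc_le_mono[THEN iffD2])
  finally show ?thesis by (simp add: cut_clause_tm_def)
qed

lemma time_simplify_tm: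
  assumes "100 \<le> M" "length \<psi> \<le> M" "\<And>C'. C' \<in> set \<psi> \<Longrightarrow> length C' \<le> M"
  shows "time (simplify_tm \<psi> \<phi>) \<le> M ^ 5 * (cnf_size \<phi> + 1)"
proof -
  have M: "1 \<le> M" using assms(1) by simp
  have fold: "Suc (time (fold_tm cut_clause_tm \<psi> C)) \<le> 42 * M ^ 3 * Suc (length C)" for C
  proof -
    let ?c = "length C"
    have "time (fold_tm cut_clause_tm \<psi> C) \<le> Suc (length \<psi> * Suc (2 + M * Suc (12 * Suc M * Suc ?c)))"
      using assms(3) length_val_cut_clause_tm
      by (intro time_fold_tm_le[where I = "\<lambda>B. length B \<le> ?c"] conjI time_cut_clause_tm)
        (auto intro: order_trans)
    also have "\<dots> \<le> Suc (M * Suc (2 + M * Suc (12 * Suc M * Suc ?c)))"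
      using assms(2) by (intro Suc_le_mono[THEN iffD2] mult_le_mono1)
    finally have 1: "Suc (time (fold_tm cut_clause_tm \<psi> C)) \<le>
        Suc (Suc (M * Suc (2 + M * Suc (12 * Suc M * Suc ?c))))"
      by (simp only: Suc_le_mono)
    have 2: "Suc (12 * Suc M * Suc ?c) \<le> 25 * M * Suc ?c"
    proof -
      have "12 * Suc M * Suc ?c \<le> 24 * M * Suc ?c" using M by (intro mult_le_mono1) simp
      moreover have "1 \<le> M * Suc ?c" using M by simp
      ultimately show ?thesis by linarith
    qed
    note 1
    also have "Suc (Suc (M * Suc (2 + M * Suc (12 * Suc M * Suc ?c)))) \<le>
        Suc (Suc (M * Suc (2 + M * (25 * M * Suc ?c))))"
      using 2 by (intro Suc_le_mono[THEN iffD2] mult_le_mono2 add_left_mono)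
    also have "\<dots> \<le> 42 * M ^ 3 * Suc ?c"
    proof -
      have "1 * 1 \<le> M ^ 3 * Suc ?c" "M * 1 \<le> M ^ 3 * Suc ?c"
        using M by (intro mult_le_mono one_le_power self_le_power; simp)+
      moreover have "Suc (Suc (M * Suc (2 + M * (25 * M * Suc ?c)))) = 2 + 3 * M + 25 * (M ^ 3 * Suc ?c)"
        by (simp add: algebra_simps power3_eq_cube)
      moreover have "1 \<le> t \<Longrightarrow> M \<le> t \<Longrightarrow> 2 + 3 * M + 25 * t \<le> 42 * t" for t :: nat by arith
      ultimately show ?thesis by (simp only: mult.assoc mult_1_right)
    qed
    finally show ?thesis by simp
  qed
  have "time (simplify_tm \<psi> \<phi>) = 2 + (\<Sum>C\<leftarrow>\<phi>. Suc (time (fold_tm cut_clause_tm \<psi> C)))"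
    by (simp add: simplify_tm_def time_map_tm)
  also have "\<dots> \<le> 2 + (\<Sum>C\<leftarrow>\<phi>. 42 * M ^ 3 * Suc (length C))"
    using fold by (intro add_left_mono sum_list_mono)
  also have "\<dots> = 2 + 42 * M ^ 3 * cnf_size \<phi>" by (simp only: sum_list_clause_le)
  also have "\<dots> \<le> 100 * M ^ 3 * (cnf_size \<phi> + 1)"
  proof -
    have "1 \<le> M ^ 3" using M by simp
    then show ?thesis by (simp add: algebra_simps)
  qed
  also have "\<dots> \<le> M ^ 5 * (cnf_size \<phi> + 1)"
  proof -
    have "100 * M ^ 3 \<le> (M * M) * M ^ 3" using assms(1) M by (intro mult_le_mono1) (simp add: le_trans)
    then show ?thesis by (intro mult_le_mono1) (simp add: power2_eq_square[symmetric] power_add[symmetric])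
  qed
  finally show ?thesis .
qed

lemma cnf_size_simplify_tm: "cnf_size (val (simplify_tm \<psi> \<phi>)) \<le> cnf_size \<phi>"
  using cnf_size_map_le[of "\<lambda>C. fold (\<lambda>C' C. val (cut_clause_tm C' C)) \<psi> C" \<phi>, OF length_fold_cut_clause_le]
  by (simp add: simplify_tm_def)

lemma time_restrict_tm: "time (restrict_tm \<rho> \<phi>) \<le> 9 * cnf_size \<phi> + 4"
proof -
  have a: "(\<Sum>C\<leftarrow>\<phi>. Suc (length C + 2)) \<le> 3 * cnf_size \<phi>"
    unfolding sum_list_clause_le[symmetric] by (intro sum_list_mono) simp
  have "time (ex_tm (witnessed_false_tm \<rho>) \<phi>) \<le> Suc (\<Sum>C\<leftarrow>\<phi>. Suc (time (witnessed_false_tm \<rho> C)))"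
    by (rule time_ex_tm)
  also have "\<dots> \<le> Suc (\<Sum>C\<leftarrow>\<phi>. Suc (length C + 2))"
    using time_witnessed_false_tm by (intro Suc_le_mono[THEN iffD2] sum_list_mono) simp
  finally have 1: "time (ex_tm (witnessed_false_tm \<rho>) \<phi>) \<le> Suc (3 * cnf_size \<phi>)" using a by simp
  have "(\<Sum>C\<leftarrow>\<phi>. Suc (time (witnessed_true_tm \<rho> C))) \<le> (\<Sum>C\<leftarrow>\<phi>. Suc (length C + 2))"
    using time_witnessed_true_tm by (intro sum_list_mono) simp
  then have 2: "(\<Sum>C\<leftarrow>\<phi>. Suc (time (witnessed_true_tm \<rho> C))) \<le> 3 * cnf_size \<phi>" using a by simp
  let ?\<phi> = "filter (\<lambda>C. \<not> witnessed_true \<rho> (set C)) \<phi>"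
  have "(\<Sum>C\<leftarrow>?\<phi>. Suc (Suc (length C))) \<le> (\<Sum>C\<leftarrow>?\<phi>. 3 * Suc (length C))"
    by (intro sum_list_mono) simp
  then have 3: "(\<Sum>C\<leftarrow>?\<phi>. Suc (Suc (length C))) \<le> 3 * cnf_size \<phi>"
    unfolding sum_list_clause_le using cnf_size_filter_le[of "\<lambda>C. \<not> witnessed_true \<rho> (set C)" \<phi>] by simp
  show ?thesis
    using 1 2 3 by (simp add: restrict_tm_def time_filter_tm time_map_tm sum_list_triv)
qed

lemma cnf_size_restrict_tm: "cnf_size (val (restrict_tm \<rho> \<phi>)) \<le> cnf_size \<phi> + 1"
proof -
  have "cnf_size (map (filter (\<lambda>l. \<rho> (fst l) = None)) (filter (\<lambda>C. \<not> witnessed_true \<rho> (set C)) \<phi>)) \<le> cnf_size \<phi>"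
    by (rule order_trans[OF cnf_size_map_le cnf_size_filter_le]) simp
  then show ?thesis by (simp add: restrict_tm_def) (simp add: cnf_size_def)
qed

text \<open>The axioms include the query, whose size is not bounded by \<open>M\<close>, so they
  enter through the linear factor \<open>cnf_size A + 1\<close>. The three nested searches of the
  cut rule raise the exponent by 2 each, from 3 to 9.\<close>

lemma time_derivable_tm:
  assumes M: "100 \<le> M" and "length C \<le> M" "length S \<le> M" "\<And>P. P \<in> set S \<Longrightarrow> length P \<le> M"
  shows "time (derivable_tm A S C) \<le> M ^ 10 * (cnf_size A + 1)"
proof -
  have sub: "time (subset_tm D C) \<le> M * (M + 3) + 2" if "length D \<le> M" for D
    using order_trans[OF time_subset_tm[of D C], of "M * (M + 3) + 2"] that assms(2)
    by (simp add: mult_le_mono)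
  have sub': "Suc (time (subset_tm D C)) \<le> (M + 3) * Suc (length D)" for D
  proof -
    have "length D * (length C + 3) \<le> length D * (M + 3)" using assms(2) by simp
    then have "Suc (time (subset_tm D C)) \<le> length D * (M + 3) + 3"
      using time_subset_tm[of D C] by linarith
    then show ?thesis by (simp add: algebra_simps)
  qed
  have a: "time (ex_tm (\<lambda>D. subset_tm D C) A) \<le> Suc ((M + 3) * cnf_size A)"
  proof -
    have "(\<Sum>D\<leftarrow>A. Suc (time (subset_tm D C))) \<le> (\<Sum>D\<leftarrow>A. (M + 3) * Suc (length D))"
      using sub' by (rule sum_list_mono)
    then show ?thesis using time_ex_tm[of "\<lambda>D. subset_tm D C" A] by (simp only: sum_list_clause_le)
  qed
  have b: "time (ex_tm (\<lambda>D. subset_tm D C) S) \<le> Suc (M * Suc (M * (M + 3) + 2))"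
    using sub assms(3,4) by (intro time_ex_tm_le) auto
  let ?inner = "\<lambda>P Q l. bind_tm (mem_tm (neg l) Q) (\<lambda>m. bind_tm (delete_tm l P) (\<lambda>P'.
      bind_tm (delete_tm (neg l) Q) (\<lambda>Q'. bind_tm (subset_tm P' C) (\<lambda>s. bind_tm (subset_tm Q' C)
        (\<lambda>t. ret (m \<and> s \<and> t))))))"
  have inner: "time (?inner P Q l) \<le> 3 * (M + 2) + 2 * (M * (M + 3) + 2)"
    if "P \<in> set S" "Q \<in> set S" for P Q l
  proof -
    have "length P \<le> M" "length Q \<le> M" using that assms(4) by auto
    moreover have "length (filter R P) \<le> length P" "length (filter R Q) \<le> length Q" for R by simp_all
    ultimately have "length (filter R P) \<le> M" "length (filter R Q) \<le> M" for R by (meson le_trans)+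
    then show ?thesis
      using sub[of "filter (\<lambda>k. k \<noteq> l) P"] sub[of "filter (\<lambda>k. k \<noteq> neg l) Q"]
        time_mem_tm[of "neg l" Q] time_delete_tm[of l P] time_delete_tm[of "neg l" Q]
        \<open>length P \<le> M\<close> \<open>length Q \<le> M\<close>
      by simp
  qed
  have M2: "100 * M \<le> M * M" "100 * (M * M) \<le> M ^ 3"
    using M by (simp_all add: power3_eq_cube)
  have "3 * (M + 2) + 2 * (M * (M + 3) + 2) = 10 + 2 * (M * M) + 9 * M" by (simp add: algebra_simps)
  also have "\<dots> \<le> M ^ 3" using M M2 by linarith
  finally have "3 * (M + 2) + 2 * (M * (M + 3) + 2) \<le> M ^ 3" .
  with inner have inner': "time (?inner P Q l) \<le> M ^ 3" if "P \<in> set S" "Q \<in> set S" for P Q l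
    using that le_trans by blast
  have ex1: "time (ex_tm (?inner P Q) P) \<le> M ^ 5" if "P \<in> set S" "Q \<in> set S" for P Q
    by (rule time_ex_tm_le_power[OF M inner'[OF that] assms(4)[OF that(1)]]) simp
  have ex2: "time (ex_tm (\<lambda>Q. ex_tm (?inner P Q) P) S) \<le> M ^ 7" if "P \<in> set S" for P
    by (rule time_ex_tm_le_power[OF M ex1[OF that] assms(3)]) simp_all
  have c: "time (ex_tm (\<lambda>P. ex_tm (\<lambda>Q. ex_tm (?inner P Q) P) S) S) \<le> M ^ 9"
    by (rule time_ex_tm_le_power[OF M ex2 assms(3)]) simp_all
  have "M * (M + 3) + 2 = M * M + 3 * M + 2" by (simp add: algebra_simps)
  also have "\<dots> \<le> M ^ 3" using M M2 by linarith
  finally have "M * (M + 3) + 2 \<le> M ^ 3" .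
  from order_trans[OF b Suc_mult_Suc_le_power[OF M this]]
  have b': "time (ex_tm (\<lambda>D. subset_tm D C) S) \<le> M ^ 5" by simp
  let ?s = "cnf_size A + 1"
  have pow: "M ^ i * ?s \<le> M ^ 9 * ?s" if "i \<le> 9" for i
    using M that by (intro mult_le_mono1 power_increasing) auto
  have "time (derivable_tm A S C) \<le> Suc (Suc ((M + 3) * cnf_size A) + M ^ 5 + M ^ 9)"
    using a b' c by (simp add: derivable_tm_def)
  also have "Suc ((M + 3) * cnf_size A) \<le> M ^ 2 * ?s"
  proof -
    have "M + 3 \<le> M ^ 2" unfolding power2_eq_square using M M2(1) by linarith
    then have "(M + 3) * cnf_size A \<le> M ^ 2 * cnf_size A" by (rule mult_le_mono1)
    moreover have "1 \<le> M ^ 2" using M by (intro one_le_power) simp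
    ultimately show ?thesis unfolding add_mult_distrib2 mult_1_right by linarith
  qed
  also have "Suc (M ^ 2 * ?s + M ^ 5 + M ^ 9) \<le> 4 * (M ^ 9 * ?s)"
  proof -
    have 1: "1 \<le> M ^ 9 * ?s" using mult_le_mono[OF one_le_power[of M 9], of 1 ?s] M by simp
    have 2: "M ^ 2 * ?s \<le> M ^ 9 * ?s" by (rule pow) simp
    have 3: "M ^ 5 \<le> M ^ 9 * ?s" by (rule order_trans[OF _ pow[of 5]]) simp_all
    have 4: "M ^ 9 \<le> M ^ 9 * ?s" by simp
    have "1 \<le> t \<Longrightarrow> a \<le> t \<Longrightarrow> b \<le> t \<Longrightarrow> c \<le> t \<Longrightarrow> Suc (a + b + c) \<le> 4 * t"
      for a b c t :: nat by arith
    from this[OF 1 2 3 4] show ?thesis .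
  qed
  also have "\<dots> \<le> M * (M ^ 9 * ?s)" using M by (intro mult_le_mono1) simp
  also have "\<dots> = M ^ 10 * ?s" by (simp only: mult.assoc[symmetric] power_Suc[symmetric]) simp
  finally show ?thesis by simp
qed

text \<open>Every round filters \<open>K\<close> afresh, so neither the number nor the length of the
  clauses found grows from round to round.\<close>

lemma time_saturate_tm:
  assumes M: "100 \<le> M" and K: "length K \<le> M" "\<And>C. C \<in> set K \<Longrightarrow> length C \<le> M"
  shows "set S \<subseteq> set K \<Longrightarrow> length S \<le> M \<Longrightarrow>
    time (saturate_tm A K r S) \<le> Suc (r * (3 + M * Suc (M ^ 10 * (cnf_size A + 1))))"
proof (induction r arbitrary: S)
  case (Suc r)
  have "time (filter_tm (derivable_tm A S) K) \<le> Suc (M * Suc (M ^ 10 * (cnf_size A + 1)))"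
    using Suc.prems K by (intro time_filter_tm_le time_derivable_tm M) auto
  moreover have "time (saturate_tm A K r (filter (\<lambda>C. val (derivable_tm A S C)) K)) \<le>
      Suc (r * (3 + M * Suc (M ^ 10 * (cnf_size A + 1))))"
    by (rule Suc.IH) (auto intro: order_trans[OF length_filter_le K(1)])
  ultimately show ?case by (simp add: algebra_simps)
qed simp

lemma length_saturate_tm:
  "length S \<le> M \<Longrightarrow> length K \<le> M \<Longrightarrow> length (val (saturate_tm A K r S)) \<le> M"
proof (induction r arbitrary: S)
  case (Suc r)
  show ?case
    using Suc.IH[OF order_trans[OF length_filter_le Suc.prems(2)] Suc.prems(2)] by simp
qed simp

lemma time_refutable_tm:
  assumes M: "100 \<le> M" and "(2 * n + 1) ^ Suc k \<le> M" "k \<le> M"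
  shows "time (refutable_tm n k A) \<le> M ^ 13 * (cnf_size A + 1)"
proof -
  let ?K = "val (clauses_tm n k)" and ?s = "cnf_size A + 1"
  have len: "length ?K \<le> M"
    using length_clauses_tm[of n k] assms(2) power_increasing[of k "Suc k" "2 * n + 1"] by simp
  have elem: "\<And>C. C \<in> set ?K \<Longrightarrow> length C \<le> M" using length_elem_clauses_tm assms(3) le_trans by blast
  have "time (saturate_tm A ?K (length ?K) []) \<le> Suc (length ?K * (3 + M * Suc (M ^ 10 * ?s)))"
    using time_saturate_tm[OF M len elem, of "[]" A "length ?K"] by simp
  also have "\<dots> \<le> Suc (M * (3 + M * Suc (M ^ 10 * ?s)))"
    using len by (intro Suc_le_mono[THEN iffD2] mult_le_mono1)
  finally have sat: "time (saturate_tm A ?K (length ?K) []) \<le> Suc (M * (3 + M * Suc (M ^ 10 * ?s)))" .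
  have ex: "time (ex_tm (\<lambda>C. ret (C = [])) (val (saturate_tm A ?K (length ?K) []))) \<le> Suc (M * Suc 0)"
    using length_saturate_tm[of "[]" M ?K A "length ?K"] len by (intro time_ex_tm_le) auto
  have cl: "time (clauses_tm n k) \<le> 7 * M" using time_clauses_tm[of n k] assms(2) by simp
  have "time (refutable_tm n k A) \<le> 1 + 7 * M + Suc M + Suc (M * (3 + M * Suc (M ^ 10 * ?s))) + Suc (M * Suc 0)"
    using sat ex cl len by (simp add: refutable_tm_def time_length_tm)
  also have "\<dots> = 4 + 12 * M + M * M + (M * (M * M ^ 10)) * ?s" by (simp add: algebra_simps)
  also have "M * (M * M ^ 10) = M ^ 12" by (simp flip: power_Suc)
  also have "4 + 12 * M + M * M + M ^ 12 * ?s \<le> 100 * M ^ 12 * ?s"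
  proof -
    have pow: "i \<le> j \<Longrightarrow> M ^ i \<le> M ^ j" for i j
      using M by (intro power_increasing) auto
    have s: "M ^ 12 * 1 \<le> M ^ 12 * ?s" by (intro mult_le_mono2) simp
    have M12: "1 \<le> M ^ 12" "M \<le> M ^ 12" "M * M \<le> M ^ 12"
      using pow[of 0 12] pow[of 1 12] pow[of 2 12] by (simp_all add: power2_eq_square)
    have "p * 1 \<le> t \<Longrightarrow> 1 \<le> p \<Longrightarrow> M \<le> p \<Longrightarrow> q \<le> p \<Longrightarrow> 4 + 12 * M + q + t \<le> 100 * t" for p q t :: nat
      by arith
    from this[OF s M12] show ?thesis by (simp only: mult.assoc)
  qed
  also have "\<dots> \<le> M * M ^ 12 * ?s" using M by (intro mult_le_mono1)
  also have "M * M ^ 12 = M ^ 13" by (simp flip: power_Suc)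
  finally show ?thesis .
qed

lemma time_test_tm:
  assumes M: "100 \<le> M" and "(2 * n + 1) ^ Suc (2 * w) \<le> M" "2 * w \<le> M"
  shows "time (test_tm n w \<theta> bound c \<rho>s) \<le> Suc (length \<rho>s * (M ^ 14 * (cnf_size \<theta> + 2)))"
proof (induction \<rho>s arbitrary: c)
  case (Cons \<rho> \<rho>s)
  let ?A = "val (restrict_tm \<rho> \<theta>)"
  have "time (refutable_tm n (2 * w) ?A) \<le> M ^ 13 * (cnf_size ?A + 1)"
    by (rule time_refutable_tm[OF assms])
  also have "\<dots> \<le> M ^ 13 * (cnf_size \<theta> + 2)"
    using cnf_size_restrict_tm[of \<rho> \<theta>] by (intro mult_le_mono2) simp
  finally have "Suc (time (restrict_tm \<rho> \<theta>) + time (refutable_tm n (2 * w) ?A)) \<le>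
      9 * cnf_size \<theta> + 5 + M ^ 13 * (cnf_size \<theta> + 2)"
    using time_restrict_tm[of \<rho> \<theta>] by simp
  also have "\<dots> \<le> 100 * M ^ 13 * (cnf_size \<theta> + 2)"
  proof -
    have "1 \<le> M ^ 13" using M by simp
    then have 1: "1 * (cnf_size \<theta> + 2) \<le> M ^ 13 * (cnf_size \<theta> + 2)" by (rule mult_le_mono1)
    have "1 * (a + 2) \<le> t \<Longrightarrow> 9 * a + 5 + t \<le> 100 * t" for a t :: nat by simp
    from this[OF 1] show ?thesis unfolding mult.assoc[of 100] .
  qed
  also have "\<dots> \<le> M * M ^ 13 * (cnf_size \<theta> + 2)" using M by (intro mult_le_mono1)
  also have "M * M ^ 13 = M ^ 14" by (simp flip: power_Suc)
  finally have 1: "Suc (time (restrict_tm \<rho> \<theta>) + time (refutable_tm n (2 * w) ?A)) \<le> M ^ 14 * (cnf_size \<theta> + 2)" .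
  have "time (test_tm n w \<theta> bound c (\<rho> # \<rho>s)) \<le> Suc (time (restrict_tm \<rho> \<theta>) + time (refutable_tm n (2 * w) ?A))
      + Suc (length \<rho>s * (M ^ 14 * (cnf_size \<theta> + 2)))"
    using Cons by (simp add: Let_def)
  with 1 show ?case by simp
qed simp

text \<open>The test loop dominates: at most \<open>M\<close> samples, \<open>M ^ 14\<close> for
  each, and a factor \<open>M ^ 3\<close> for the learned clauses appended to the query. The last
  factor \<open>M\<close> absorbs constants.\<close>

lemma time_learn_res:
  fixes n s :: nat and \<mu> \<beta> \<gamma> \<delta> \<epsilon> :: real and \<phi> :: "lit list list"
  defines "w \<equiv> res_width n \<mu> \<beta> \<gamma> \<delta> s"
  defines "m\<^sub>0 \<equiv> learn_samples n w \<mu> \<gamma> \<delta>"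
  defines "m\<^sub>1 \<equiv> test_samples \<gamma> \<delta>"
  assumes M: "100 \<le> M" and Mw: "(2 * n + 1) ^ Suc (2 * w) \<le> M" "2 * w \<le> M"
    and Mm: "m\<^sub>0 + m\<^sub>1 \<le> M" and len: "length \<rho>s = m\<^sub>0 + m\<^sub>1"
  shows "time (learn_res n \<mu> \<phi> s \<epsilon> \<delta> \<gamma> \<beta> \<rho>s) \<le> M ^ 19 * (cnf_size \<phi> + 1)"
proof -
  define \<psi> where "\<psi> = val (learn_tm n w (\<gamma> * \<mu> ^ w / (2 * real (2 * n + 1) ^ w) * real m\<^sub>0) (take m\<^sub>0 \<rho>s))"
  define \<phi>' where "\<phi>' = val (simplify_tm \<psi> \<phi>)"
  let ?s = "cnf_size \<phi> + 1"
  have "(2 * n + 1) ^ Suc w \<le> (2 * n + 1) ^ Suc (2 * w)" by (intro power_increasing) auto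
  then have Mw': "(2 * n + 1) ^ Suc w \<le> M" "w \<le> M" using Mw by auto
  have learn: "time (learn_tm n w t (take m\<^sub>0 \<rho>s)) \<le> M ^ 4" for t
    using len Mm by (intro time_learn_tm M Mw') simp
  have "set \<psi> \<subseteq> set (val (clauses_tm n w))" "length \<psi> \<le> length (val (clauses_tm n w))"
    by (auto simp: \<psi>_def learn_tm_def)
  moreover have "length (val (clauses_tm n w)) \<le> M"
    using length_clauses_tm[of n w] Mw'(1) power_increasing[of w "Suc w" "2 * n + 1"] by simp
  ultimately have psi: "length \<psi> \<le> M" "\<And>C'. C' \<in> set \<psi> \<Longrightarrow> length C' \<le> M"
    using length_elem_clauses_tm[of _ n w] Mw'(2) by (force, meson le_trans subsetD)
  have simp: "time (simplify_tm \<psi> \<phi>) \<le> M ^ 5 * ?s" by (rule time_simplify_tm[OF M psi])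
  have phi': "cnf_size \<phi>' \<le> cnf_size \<phi>" unfolding \<phi>'_def by (rule cnf_size_simplify_tm)
  have "cnf_size \<psi> \<le> length \<psi> * Suc M" using psi(2) by (rule cnf_size_le)
  also have "\<dots> \<le> M * Suc M" using psi(1) by (rule mult_le_mono1)
  finally have "cnf_size (\<phi>' @ \<psi>) + 2 \<le> cnf_size \<phi> + M * Suc M + 2"
    using phi' by (simp add: cnf_size_append)
  also have "\<dots> \<le> M ^ 3 * ?s"
  proof -
    have "M * Suc M + 2 \<le> M * (M * M)"
    proof -
      have "M * Suc M + 2 \<le> M * (M + 2)" using M by simp
      also have "\<dots> \<le> M * (M * M)" using M mult_le_mono1[OF M, of M] by (intro mult_le_mono2) linarith
      finally show ?thesis .
    qed
    then have "M * Suc M + 2 \<le> M ^ 3" by (simp add: power3_eq_cube mult.assoc)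
    moreover have "1 * cnf_size \<phi> \<le> M ^ 3 * cnf_size \<phi>" using M by (intro mult_le_mono1) simp
    ultimately show ?thesis unfolding add_mult_distrib2 mult_1_right by linarith
  qed
  finally have theta: "cnf_size (\<phi>' @ \<psi>) + 2 \<le> M ^ 3 * ?s" .
  have test: "time (test_tm n w (\<phi>' @ \<psi>) b c (drop m\<^sub>0 \<rho>s)) \<le> Suc (M ^ 18 * ?s)" for b c
  proof -
    have "time (test_tm n w (\<phi>' @ \<psi>) b c (drop m\<^sub>0 \<rho>s)) \<le>
        Suc (length (drop m\<^sub>0 \<rho>s) * (M ^ 14 * (cnf_size (\<phi>' @ \<psi>) + 2)))"
      by (rule time_test_tm[OF M Mw])
    also have "\<dots> \<le> Suc (M * (M ^ 14 * (M ^ 3 * ?s)))"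
      using len Mm theta by (intro Suc_le_mono[THEN iffD2] mult_le_mono mult_le_mono2) auto
    also have "M * (M ^ 14 * (M ^ 3 * ?s)) = M ^ 18 * ?s"
      by (simp only: mult.assoc[symmetric] power_Suc[symmetric] power_add[symmetric]) simp
    finally show ?thesis .
  qed
  have split: "time (split_tm m\<^sub>0 \<rho>s) \<le> Suc M" using time_split_tm[of m\<^sub>0 \<rho>s] len Mm by simp
  have app: "time (append_tm \<phi>' \<psi>) \<le> Suc ?s"
    using length_le_cnf_size[of \<phi>'] phi' by (simp add: time_append_tm)
  have "time (learn_res n \<mu> \<phi> s \<epsilon> \<delta> \<gamma> \<beta> \<rho>s) = Suc (time (split_tm m\<^sub>0 \<rho>s) +
      (time (learn_tm n w (\<gamma> * \<mu> ^ w / (2 * real (2 * n + 1) ^ w) * real m\<^sub>0) (take m\<^sub>0 \<rho>s)) +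
      (time (simplify_tm \<psi> \<phi>) + (time (append_tm \<phi>' \<psi>) +
      time (test_tm n w (\<phi>' @ \<psi>) \<lfloor>\<epsilon> * real m\<^sub>1\<rfloor> 0 (drop m\<^sub>0 \<rho>s))))))"
    unfolding learn_res_def w_def[symmetric] Let_def m\<^sub>0_def[symmetric] m\<^sub>1_def[symmetric] \<phi>'_def \<psi>_def
    by (simp only: time_simps val_simps val_split_tm val_append_tm fst_conv snd_conv)
  also have "\<dots> \<le> Suc (Suc M + (M ^ 4 + (M ^ 5 * ?s + (Suc ?s + Suc (M ^ 18 * ?s)))))"
    by (intro Suc_le_mono[THEN iffD2] add_mono split learn simp app test)
  also have "\<dots> = 1 + Suc M + M ^ 4 + M ^ 5 * ?s + Suc ?s + Suc (M ^ 18 * ?s)" by simp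
  also have "\<dots> \<le> 100 * M ^ 18 * ?s"
  proof -
    have pow: "M ^ i * ?s \<le> M ^ 18 * ?s" if "i \<le> 18" for i
      using M that by (intro mult_le_mono1 power_increasing) auto
    have "M ^ 4 \<le> M ^ 4 * ?s" "M ^ 1 \<le> M ^ 1 * ?s" by simp_all
    with pow[of 4] pow[of 1] have "M ^ 4 \<le> M ^ 18 * ?s" "M \<le> M ^ 18 * ?s" by simp_all
    moreover have "?s \<le> M ^ 18 * ?s" using pow[of 0] by simp
    moreover have "M ^ 5 * ?s \<le> M ^ 18 * ?s" by (rule pow) simp
    moreover have "a \<le> t \<Longrightarrow> M \<le> t \<Longrightarrow> e + 1 \<le> t \<Longrightarrow> b \<le> t \<Longrightarrow>
        1 + Suc M + a + b + Suc (e + 1) + Suc t \<le> 100 * t" for a b e t :: nat by arith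
    ultimately show ?thesis unfolding mult.assoc[of 100] by blast
  qed
  also have "\<dots> \<le> M * M ^ 18 * ?s" using M by (intro mult_le_mono1)
  also have "M * M ^ 18 = M ^ 19" by (simp flip: power_Suc)
  finally show ?thesis .
qed

section \<open>Size of the parameters\<close>

lemma test_samples_ge: "1 / (2 * \<gamma>\<^sup>2) * ln (2 / \<delta>) \<le> real (test_samples \<gamma> \<delta>)"
  unfolding test_samples_def by linarith

lemma test_samples_pos:
  assumes "\<gamma> \<noteq> 0" "\<delta> \<in> {0<..<1}"
  shows "0 < test_samples \<gamma> \<delta>"
proof -
  have "0 < 1 / (2 * \<gamma>\<^sup>2) * ln (2 / \<delta>)" using assms by (intro mult_pos_pos ln_gt_zero) auto
  then show ?thesis using test_samples_ge[of \<gamma> \<delta>] by linarith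
qed

text \<open>Used with \<open>z = 1 / \<mu>\<close> to bound \<open>(1 / \<mu>) ^ n\<close> by a
  power of \<open>n\<close> when \<open>1 / \<mu>\<close> exceeds \<open>n\<close>. The reason is
  \<open>ln (z / n) \<le> z / n - 1\<close>.\<close>

lemma mult_ln_le_mult_ln:
  fixes n z :: real
  assumes "2 \<le> n" "n \<le> z"
  shows "n * ln z \<le> 3 * (z * ln n)"
proof -
  have pos: "0 < n" "0 < z" using assms by auto
  have "ln z = ln n + ln (z / n)" using pos by (simp add: ln_div)
  also have "\<dots> \<le> ln n + (z / n - 1)" using pos by (intro add_left_mono ln_le_minus_one) simp
  finally have "n * ln z \<le> n * (ln n + (z / n - 1))" using pos by (intro mult_left_mono) auto
  also have "\<dots> = n * ln n + z - n" using pos by (simp add: field_simps)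
  also have "\<dots> \<le> z * ln n + 2 * (z * ln n)"
  proof -
    have "ln 2 \<le> ln n" using assms by simp
    then have "1 / 2 \<le> ln n" using ln2_ge_two_thirds by linarith
    then have "z * (1 / 2) \<le> z * ln n" using pos by (intro mult_left_mono) auto
    moreover have "n * ln n \<le> z * ln n" using assms by (intro mult_right_mono) auto
    ultimately show ?thesis using pos by linarith
  qed
  finally show ?thesis by simp
qed

lemma res_width_pos:
  assumes "1 \<le> n" "1 \<le> s" "\<mu> \<in> {0<..<1}" "\<beta> \<in> {0<..<1}" "\<gamma> \<in> {0<..<1}" "\<delta> \<in> {0<..<1}"
  shows "1 \<le> res_width n \<mu> \<beta> \<gamma> \<delta> s"
proof -
  have m: "1 \<le> real (test_samples \<gamma> \<delta>)"
    using test_samples_pos[of \<gamma> \<delta>] assms by (simp add: Suc_le_eq)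
  have "1 < 2 * real (test_samples \<gamma> \<delta>) * real s / \<delta>"
  proof -
    have "1 * 1 \<le> real (test_samples \<gamma> \<delta>) * real s"
      using m assms(2) by (intro mult_mono) auto
    then show ?thesis using assms(6) by (simp add: field_simps)
  qed
  then have "0 < 1 / (\<mu> * \<beta>) * ln (2 * real (test_samples \<gamma> \<delta>) * real s / \<delta>)"
    using assms(3,4) by (intro mult_pos_pos ln_gt_zero) auto
  then have "1 \<le> nat \<lceil>1 / (\<mu> * \<beta>) * ln (2 * real (test_samples \<gamma> \<delta>) * real s / \<delta>)\<rceil>"
    by linarith
  then show ?thesis using assms(1) by (simp add: res_width_def)
qed

lemma parameters_le_powr:
  fixes n s :: nat and \<mu> \<beta> \<gamma> \<delta> :: real
  assumes n: "2 \<le> n" and s: "2 \<le> s"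
    and mu: "\<mu> \<in> {0<..<1}" and be: "\<beta> \<in> {0<..<1}" and ga: "\<gamma> \<in> {0<..<1}" and de: "\<delta> \<in> {0<..<1}"
  defines "w \<equiv> res_width n \<mu> \<beta> \<gamma> \<delta> s"
  defines "m\<^sub>0 \<equiv> learn_samples n w \<mu> \<gamma> \<delta>"
  defines "m\<^sub>1 \<equiv> test_samples \<gamma> \<delta>"
  defines "X \<equiv> 1 / (\<mu> * \<beta>) * ln (real s / (\<gamma> * \<delta>))"
  shows "real (100 * (2 * n + 1) ^ Suc (2 * w) + 2 * w + (m\<^sub>0 + m\<^sub>1)) \<le> real n powr (98 * X)"
proof -
  define B where "B k = real n powr (k * X)" for k
  define y where "y = real s / (\<gamma> * \<delta>)"
  have mub: "0 < \<mu> * \<beta>" "\<mu> * \<beta> \<le> 1" "\<mu> * \<beta> \<le> \<mu>"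
    using mu be mult_le_one[of \<mu> \<beta>] mult_left_le[of \<beta> \<mu>] by auto
  have gd: "0 < \<gamma> * \<delta>" "\<gamma> * \<delta> \<le> \<gamma>" "\<gamma> * \<delta> \<le> \<delta>" "\<gamma> * \<delta> \<le> 1"
    using ga de mult_left_le[of \<delta> \<gamma>] mult_left_le[of \<gamma> \<delta>] mult_le_one[of \<gamma> \<delta>] by (auto simp: mult.commute)
  have y_ge: "2 \<le> y" "real s \<le> y" "1 / \<gamma> \<le> y" "1 / \<delta> \<le> y"
  proof -
    have "real s * (\<gamma> * \<delta>) \<le> real s" using gd by (simp add: mult_left_le)
    then show "real s \<le> y" unfolding y_def using gd(1) by (simp add: le_divide_eq)
    then show "2 \<le> y" using s by linarith
    show "1 / \<gamma> \<le> y" "1 / \<delta> \<le> y" unfolding y_def using gd s ga de by (intro frac_le; simp)+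
  qed
  have lny: "2 / 3 \<le> ln y" using ln2_ge_two_thirds ln_mono[of 2 y] y_ge(1) by linarith
  have X_eq: "X = 1 / (\<mu> * \<beta>) * ln y" by (simp add: X_def y_def)
  have X_ge: "ln y \<le> X" "1 / \<mu> \<le> 2 * X"
  proof -
    have "1 * ln y \<le> 1 / (\<mu> * \<beta>) * ln y"
      using mub lny by (intro mult_right_mono) (auto simp: le_divide_eq)
    then show "ln y \<le> X" by (simp add: X_eq)
    have "1 / \<mu> * (1 / 2) \<le> 1 / (\<mu> * \<beta>) * ln y"
      using mub lny mu by (intro mult_mono frac_le) auto
    then show "1 / \<mu> \<le> 2 * X" by (simp add: X_eq)
  qed
  then have X0: "2 / 3 \<le> X" using lny by linarith
  have n1: "1 \<le> real n" "2 \<le> real n" using n by auto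
  have B_add: "B i * B j = B (i + j)" for i j
    by (simp add: B_def powr_add distrib_right)
  have B_mono: "i \<le> j \<Longrightarrow> B i \<le> B j" for i j
    unfolding B_def using n1 X0 by (intro powr_mono mult_right_mono) auto
  have B_powr: "r \<le> k * X \<Longrightarrow> real n powr r \<le> B k" for r k
    unfolding B_def using n1 by (intro powr_mono) auto
  have B_pow: "real j \<le> k * X \<Longrightarrow> real n ^ j \<le> B k" for j k
    using B_powr[of "real j" k] n1 by (simp add: powr_realpow)
  have B_pos: "0 < B k" for k using n1 by (simp add: B_def)
  have B_ge1: "0 \<le> k \<Longrightarrow> 1 \<le> B k" for k
    using B_mono[of 0 k] n1 by (simp add: B_def)
  have n_le: "real n \<le> B 2" using B_pow[of 1 2] X0 by simp
  have two: "2 \<le> B 2" using n_le n1 by linarith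
  have four: "4 \<le> B 2 * B 2" using mult_mono[OF two two] two by simp
  have y_le: "y \<le> B 2"
  proof -
    have "ln y * 1 \<le> (2 * X) * ln (real n)"
    proof -
      have "1 / 2 \<le> ln (real n)" using ln2_ge_two_thirds ln_mono[of 2 "real n"] n1 by linarith
      then have "ln y * (1 / 2) \<le> X * ln (real n)" using X_ge(1) lny by (intro mult_mono) auto
      then show ?thesis by simp
    qed
    then have "exp (ln y) \<le> exp (2 * X * ln (real n))" by simp
    then show ?thesis using y_ge(1) n1 by (simp add: B_def powr_def)
  qed
  have y_pow: "y ^ j \<le> B (2 * real j)" for j
  proof -
    have "y ^ j \<le> B 2 ^ j" using y_le y_ge(1) by (intro power_mono) auto
    also have "\<dots> = B (2 * real j)"
      using n1 by (simp add: B_def powr_realpow[symmetric] powr_powr mult_ac del: powr_realpow)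
    finally show ?thesis .
  qed
  have m1: "real m\<^sub>1 \<le> y ^ 4"
  proof -
    have "1 / (2 * \<gamma>\<^sup>2) * ln (2 / \<delta>) \<le> 1 / (2 * \<gamma>\<^sup>2) * (2 / \<delta>)"
      using de ln_le_minus_one[of "2 / \<delta>"] by (intro mult_left_mono) auto
    also have "\<dots> = (1 / \<gamma>) ^ 2 * (1 / \<delta>)" by (simp add: power_divide)
    also have "\<dots> \<le> y ^ 2 * y"
      using y_ge ga de by (intro mult_mono power_mono) auto
    finally have "1 / (2 * \<gamma>\<^sup>2) * ln (2 / \<delta>) \<le> y ^ 3" by (simp add: power3_eq_cube power2_eq_square)
    then have "real m\<^sub>1 \<le> y ^ 3 + 1"
      unfolding m\<^sub>1_def test_samples_def using y_ge(1) zero_le_power[of y 3] by linarith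
    also have "\<dots> \<le> 2 * y ^ 3" using y_ge(1) one_le_power[of y 3] by simp
    also have "\<dots> \<le> y * y ^ 3" using y_ge(1) by (intro mult_right_mono) auto
    finally show ?thesis by (simp flip: power_Suc)
  qed
  have m1_pos: "0 < m\<^sub>1" unfolding m\<^sub>1_def using ga de by (intro test_samples_pos) auto
  \<comment> \<open>Under the logarithm, \<open>2\<close>, \<open>m\<^sub>1\<close>,
    \<open>s\<close> and \<open>1 / \<delta>\<close> are at most \<open>y\<close>,
    \<open>y ^ 4\<close>, \<open>y\<close> and \<open>y\<close>, which gives \<open>7 * X\<close>;
    rounding up costs 1, at most \<open>2 * X\<close>.\<close>
  have w_le: "real w \<le> 9 * X" "real w \<le> real n"
  proof -
    have "2 * real m\<^sub>1 * real s / \<delta> = 2 * real m\<^sub>1 * real s * (1 / \<delta>)" by simp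
    also have "\<dots> \<le> y * y ^ 4 * y * y"
      using y_ge m1 de by (intro mult_mono) auto
    also have "\<dots> = y ^ 7" by (simp add: numeral_eq_Suc)
    finally have "2 * real m\<^sub>1 * real s / \<delta> \<le> y ^ 7" .
    moreover have "0 < 2 * real m\<^sub>1 * real s / \<delta>" using m1_pos s de by simp
    ultimately have "ln (2 * real m\<^sub>1 * real s / \<delta>) \<le> ln (y ^ 7)" by (simp add: ln_mono)
    also have "\<dots> = 7 * ln y" using y_ge(1) by (simp add: ln_realpow)
    finally have "1 / (\<mu> * \<beta>) * ln (2 * real m\<^sub>1 * real s / \<delta>) \<le> 1 / (\<mu> * \<beta>) * (7 * ln y)"
      using mub by (intro mult_left_mono) auto
    also have "\<dots> = 7 * X" by (simp add: X_eq)
    finally have "real (nat \<lceil>1 / (\<mu> * \<beta>) * ln (2 * real m\<^sub>1 * real s / \<delta>)\<rceil>) \<le> 7 * X + 1"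
      using X0 by linarith
    then show "real w \<le> 9 * X"
      unfolding w_def res_width_def m\<^sub>1_def[symmetric] using X0 by linarith
    show "real w \<le> real n" by (simp add: w_def res_width_def)
  qed
  have n3: "real (2 * n + 1) \<le> real n ^ 3"
  proof -
    have "2 * real n + 1 \<le> 4 * real n" using n1 by linarith
    also have "\<dots> \<le> real n ^ 2 * real n"
      using n1 power_mono[of 2 "real n" 2] by (intro mult_right_mono) auto
    finally show ?thesis by (simp add: power3_eq_cube power2_eq_square)
  qed
  have n3_pow: "real (2 * n + 1) ^ j \<le> B k" if "3 * real j \<le> k * X" for j k
  proof -
    have "real (2 * n + 1) ^ j \<le> (real n ^ 3) ^ j" using n3 by (intro power_mono) auto
    also have "\<dots> = real n ^ (3 * j)" by (simp add: power_mult)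
    also have "\<dots> \<le> B k" using that by (intro B_pow) simp
    finally show ?thesis .
  qed
  \<comment> \<open>For \<open>1 / \<mu> \<le> n\<close> the bound \<open>w \<le> 9 * X\<close>
    suffices. For larger \<open>1 / \<mu>\<close> the cap \<open>w \<le> n\<close> is used instead,
    together with \<open>1 / \<mu> \<le> 2 * X\<close>.\<close>
  have mu_pow: "(1 / \<mu>) ^ (2 * w) \<le> B 18"
  proof (cases "1 / \<mu> \<le> real n")
    case True
    then have "(1 / \<mu>) ^ (2 * w) \<le> real n ^ (2 * w)" using mu by (intro power_mono) auto
    also have "\<dots> \<le> B 18" using w_le(1) by (intro B_pow) simp
    finally show ?thesis .
  next
    case False
    have "real n * ln (1 / \<mu>) \<le> 3 * (1 / \<mu> * ln (real n))"
      using False n1 by (intro mult_ln_le_mult_ln) auto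
    also have "\<dots> \<le> 3 * (2 * X * ln (real n))"
      using X_ge(2) n1 by (intro mult_left_mono mult_right_mono) auto
    finally have 1: "real n * ln (1 / \<mu>) \<le> 6 * (X * ln (real n))" by simp
    have "real w * ln (1 / \<mu>) \<le> real n * ln (1 / \<mu>)"
      using w_le(2) mu by (intro mult_right_mono) auto
    with 1 have "2 * (real w * ln (1 / \<mu>)) \<le> 12 * (X * ln (real n))" by linarith
    moreover have "0 \<le> X * ln (real n)" using X0 n1 by (intro mult_nonneg_nonneg) auto
    ultimately have "exp (2 * (real w * ln (1 / \<mu>))) \<le> exp (18 * (X * ln (real n)))" by simp
    moreover have "(1 / \<mu>) ^ (2 * w) = exp (2 * (real w * ln (1 / \<mu>)))"
      using mu by (simp add: powr_realpow[symmetric] powr_def mult_ac)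
    ultimately show ?thesis using n1 by (simp add: B_def powr_def mult_ac)
  qed
  have ln_le: "ln (4 * real (2 * n + 1) / \<delta>) \<le> B 12"
  proof -
    have "ln (4 * real (2 * n + 1) / \<delta>) \<le> 4 * real (2 * n + 1) * (1 / \<delta>)"
      using de ln_le_minus_one[of "4 * real (2 * n + 1) / \<delta>"] by simp
    also have "\<dots> \<le> B 4 * B 6 * B 2"
    proof (intro mult_mono)
      show "4 \<le> B 4" using B_add[of 2 2] four by simp
      show "real (2 * n + 1) \<le> B 6" using n3_pow[of 1 6] X0 by simp
      show "1 / \<delta> \<le> B 2" using y_ge(4) y_le by linarith
    qed (use de B_pos in \<open>auto simp: less_imp_le\<close>)
    finally show ?thesis by (simp add: B_add)
  qed
  \<comment> \<open>The factors contribute 2 + 2 + 54 + 18 + 4 + 12 = 92, and rounding up costs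
    another 2.\<close>
  have m0: "real m\<^sub>0 \<le> B 94"
  proof -
    have "2 * real w * real (2 * n + 1) ^ (2 * w) / (\<mu> ^ (2 * w) * \<gamma>\<^sup>2) * ln (4 * real (2 * n + 1) / \<delta>)
      = 2 * real w * real (2 * n + 1) ^ (2 * w) * (1 / \<mu>) ^ (2 * w) * (1 / \<gamma>) ^ 2 * ln (4 * real (2 * n + 1) / \<delta>)"
      by (simp add: power_divide)
    also have "\<dots> \<le> B 2 * B 2 * B 54 * B 18 * B 4 * B 12"
    proof (intro mult_mono two mu_pow ln_le)
      show "real w \<le> B 2" using w_le(2) n_le by linarith
      show "real (2 * n + 1) ^ (2 * w) \<le> B 54" using w_le(1) by (intro n3_pow) simp
      have "(1 / \<gamma>) ^ 2 \<le> y ^ 2" using y_ge(3) ga by (intro power_mono) auto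
      then show "(1 / \<gamma>) ^ 2 \<le> B 4" using y_pow[of 2] by simp
      have "1 \<le> 4 * real (2 * n + 1) / \<delta>" using de by (simp add: field_simps)
      then show "0 \<le> ln (4 * real (2 * n + 1) / \<delta>)" by simp
    qed (use mu ga B_pos in \<open>auto simp: less_imp_le\<close>)
    also have "\<dots> = B 92" by (simp add: B_add)
    finally have "real m\<^sub>0 \<le> B 92 + 1"
      unfolding m\<^sub>0_def learn_samples_def using B_pos[of 92] by linarith
    also have "\<dots> \<le> 2 * B 92" using B_ge1[of 92] by simp
    also have "\<dots> \<le> B 2 * B 92" using two B_pos[of 92] by (intro mult_right_mono) auto
    finally show ?thesis by (simp add: B_add)
  qed
  have "100 * real (2 * n + 1) ^ Suc (2 * w) \<le> B 14 * B 60"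
  proof (rule mult_mono)
    have "100 \<le> real n ^ 7" using power_mono[of 2 "real n" 7] n1 by simp
    then show "100 \<le> B 14" using B_pow[of 7 14] X0 by simp
    show "real (2 * n + 1) ^ Suc (2 * w) \<le> B 60" using w_le(1) X0 by (intro n3_pow) simp
  qed (use B_pos in \<open>auto simp: less_imp_le\<close>)
  then have a: "100 * real (2 * n + 1) ^ Suc (2 * w) \<le> B 94"
    using B_add[of 14 60] B_mono[of 74 94] by simp
  have b: "2 * real w \<le> B 94"
  proof -
    have "2 * real w \<le> B 2 * B 2" using two w_le(2) n_le B_pos[of 2] by (intro mult_mono) auto
    then show ?thesis using B_add[of 2 2] B_mono[of 4 94] by simp
  qed
  have c: "real m\<^sub>1 \<le> B 94" using m1 y_pow[of 4] B_mono[of 8 94] by simp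
  have "real (100 * (2 * n + 1) ^ Suc (2 * w) + 2 * w + (m\<^sub>0 + m\<^sub>1)) =
      100 * real (2 * n + 1) ^ Suc (2 * w) + 2 * real w + (real m\<^sub>0 + real m\<^sub>1)"
    by (simp only: of_nat_add of_nat_mult of_nat_power of_nat_numeral)
  \<comment> \<open>Each of the four summands is at most \<open>B 94\<close>, and the factor 4 is
    absorbed by \<open>B 4\<close>; hence 98.\<close>
  also have "\<dots> \<le> 4 * B 94" using a b c m0 by linarith
  also have "\<dots> \<le> (B 2 * B 2) * B 94"
    using four B_pos by (intro mult_right_mono) (auto simp: less_imp_le)
  finally show ?thesis by (simp add: B_add) (simp add: B_def)
qed

section \<open>Correctness\<close>

definition learned_cnf :: "nat \<Rightarrow> nat \<Rightarrow> real \<Rightarrow> nat \<Rightarrow> passignment list \<Rightarrow> cnf" where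
  "learned_cnf n w \<tau> m xs =
     {C. C \<subseteq> lits n \<and> card C \<le> w \<and> real (length (filter (\<lambda>\<rho>. witnessed_false \<rho> C) xs)) \<le> \<tau> * real m}"

lemma card_narrow_clauses_le: "card {C. C \<subseteq> lits n \<and> card C \<le> w} \<le> (2 * n + 1) ^ w"
proof -
  have "card (cnf_of (val (clauses_tm n w))) \<le> length (val (clauses_tm n w))"
    unfolding cnf_of_def by (meson card_image_le card_length le_trans List.finite_set)
  then show ?thesis
    using length_clauses_tm[of n w] by (simp add: cnf_of_val_clauses_tm width_def)
qed

lemma finite_narrow_clauses: "finite {C. C \<subseteq> lits n \<and> card C \<le> w}"
  by (rule finite_subset[of _ "Pow (lits n)"]) (auto simp: finite_lits)

lemma prob_narrow_clauses_le:
  assumes "0 \<le> b" "\<And>C. C \<subseteq> lits n \<Longrightarrow> card C \<le> w \<Longrightarrow> measure_pmf.prob p {xs. R C xs} \<le> b"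
  shows "measure_pmf.prob p {xs. \<exists>C. C \<subseteq> lits n \<and> card C \<le> w \<and> R C xs} \<le> real (2 * n + 1) ^ w * b"
proof -
  let ?I = "{C. C \<subseteq> lits n \<and> card C \<le> w}"
  have "{xs. \<exists>C. C \<subseteq> lits n \<and> card C \<le> w \<and> R C xs} = (\<Union>C\<in>?I. {xs. R C xs})" by auto
  then have "measure_pmf.prob p {xs. \<exists>C. C \<subseteq> lits n \<and> card C \<le> w \<and> R C xs}
      \<le> (\<Sum>C\<in>?I. measure_pmf.prob p {xs. R C xs})"
    using measure_UNION_le[OF finite_narrow_clauses, of n w "\<lambda>C. {xs. R C xs}" "measure_pmf p"] by simp
  also have "\<dots> \<le> (\<Sum>C\<in>?I. b)" using assms(2) by (intro sum_mono) auto
  also have "\<dots> = real (card ?I) * b" by simp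
  also have "\<dots> \<le> real ((2 * n + 1) ^ w) * b"
    using card_narrow_clauses_le assms(1) by (intro mult_right_mono of_nat_mono) auto
  finally show ?thesis by simp
qed

lemma has_refutation_contradiction: "has_refutation_of_width n {{}} k"
  by (intro refutation_of_derivable_empty derivable_axiom) auto

section \<open>Setting shared by both cases\<close>

locale learn_res_setting =
  fixes n s :: nat and \<phi> :: "lit list list" and D :: "assignment pmf"
    and \<mu> \<epsilon> \<gamma> \<delta> \<beta> :: real and w m\<^sub>0 m\<^sub>1 :: nat
  assumes n: "1 \<le> n" and s: "1 \<le> s" and over: "cnf_over n (cnf_of \<phi>)"
    and mu: "\<mu> \<in> {0<..<1}" and ep: "\<epsilon> \<in> {0<..<1}" and ga: "\<gamma> \<in> {0<..<1}"
    and de: "\<delta> \<in> {0<..<1}" and be: "\<beta> \<in> {0<..<1}"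
    and m1_def: "m\<^sub>1 = test_samples \<gamma> \<delta>"
    and w_def: "w = res_width n \<mu> \<beta> \<gamma> \<delta> s"
    and m0_def: "m\<^sub>0 = learn_samples n w \<mu> \<gamma> \<delta>"
begin

text \<open>The threshold of step (i) as a frequency per sample. For a non-tautological clause of
  width \<open>w\<close> it corresponds to the falsity probability
  \<open>\<gamma> / (2 * (2 * n + 1) ^ w)\<close>.\<close>

definition \<tau> :: real where
  "\<tau> = \<gamma> * \<mu> ^ w / (2 * real (2 * n + 1) ^ w)"

definition \<Psi> :: "passignment list \<Rightarrow> lit list list" where
  "\<Psi> xs = val (learn_tm n w (\<tau> * real m\<^sub>0) xs)"

definition \<Phi> :: "passignment list \<Rightarrow> lit list list" where
  "\<Phi> xs = val (simplify_tm (\<Psi> xs) \<phi>)"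

definition refuted :: "passignment list \<Rightarrow> passignment \<Rightarrow> bool" where
  "refuted xs \<rho> \<longleftrightarrow> has_refutation_of_width n (restrict_cnf \<rho> (cnf_of (\<Phi> xs) \<union> cnf_of (\<Psi> xs))) (2 * w)"

abbreviation M :: "passignment pmf" where
  "M \<equiv> masked n \<mu> D"

lemma accept_iff:
  "val (learn_res n \<mu> \<phi> s \<epsilon> \<delta> \<gamma> \<beta> \<rho>s) = Accept \<longleftrightarrow>
     real (length (filter (\<lambda>\<rho>. \<not> refuted (take m\<^sub>0 \<rho>s) \<rho>) (drop m\<^sub>0 \<rho>s))) \<le> \<epsilon> * real m\<^sub>1"
  using val_learn_res[OF over, of \<epsilon> \<mu> s \<delta> \<gamma> \<beta> \<rho>s] ep
  unfolding w_def[symmetric] m0_def[symmetric] m1_def[symmetric]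
  by (simp add: refuted_def \<Phi>_def \<Psi>_def \<tau>_def le_floor_iff)

lemma cnf_of_\<Psi>: "cnf_of (\<Psi> xs) = learned_cnf n w \<tau> m\<^sub>0 xs"
  by (simp add: \<Psi>_def cnf_of_val_learn_tm learned_cnf_def width_def)

lemma w_pos: "1 \<le> w" and w_le_n: "w \<le> n"
  using res_width_pos[OF n s mu be ga de] by (simp_all add: w_def res_width_def)

lemma m1_pos: "0 < m\<^sub>1"
  using test_samples_pos ga de by (simp add: m1_def)

lemma exp_m1: "exp (- 2 * real m\<^sub>1 * \<gamma>\<^sup>2) \<le> \<delta> / 2"
proof -
  have "1 / (2 * \<gamma>\<^sup>2) * ln (2 / \<delta>) \<le> real m\<^sub>1" unfolding m1_def by (rule test_samples_ge)
  then have "ln (2 / \<delta>) \<le> 2 * real m\<^sub>1 * \<gamma>\<^sup>2" using ga by (simp add: field_simps)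
  then have "exp (- 2 * real m\<^sub>1 * \<gamma>\<^sup>2) \<le> exp (- ln (2 / \<delta>))" by simp
  also have "\<dots> = \<delta> / 2" using de by (simp add: exp_minus)
  finally show ?thesis .
qed

text \<open>The exponent that the tail bounds of the learning step must reach to survive a union
  bound over all clauses of width at most \<open>w\<close>; \<open>m\<^sub>0\<close> is
  \<open>\<Lambda> / (2 * \<tau>\<^sup>2)\<close> rounded up.\<close>

definition \<Lambda> :: real where
  "\<Lambda> = real w * ln (4 * real (2 * n + 1) / \<delta>)"

lemma \<Lambda>_pos: "0 < \<Lambda>"
proof -
  have "1 < 4 * real (2 * n + 1) / \<delta>" using de by (simp add: field_simps)
  then show ?thesis unfolding \<Lambda>_def using w_pos by simp
qed

lemma union_bound: "real (2 * n + 1) ^ w * exp (- \<Lambda>) \<le> \<delta> / 4"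
proof -
  let ?a = "4 * real (2 * n + 1) / \<delta>"
  have a: "0 < ?a" using de by simp
  have "exp (- \<Lambda>) = 1 / ?a ^ w"
    using a by (simp add: \<Lambda>_def exp_minus exp_of_nat_mult inverse_eq_divide)
  then have "real (2 * n + 1) ^ w * exp (- \<Lambda>) = (real (2 * n + 1) / ?a) ^ w"
    by (simp only: power_divide times_divide_eq_right mult_1_right)
  also have "real (2 * n + 1) / ?a = \<delta> / 4" using de by (simp add: field_simps)
  also have "(\<delta> / 4) ^ w \<le> (\<delta> / 4) ^ 1" using de w_pos by (intro power_decreasing) auto
  finally show ?thesis by simp
qed

lemma \<tau>_pos: "0 < \<tau>"
  using mu ga by (simp add: \<tau>_def)

lemma m0_ge: "\<Lambda> * (2 * (real (2 * n + 1) ^ w)\<^sup>2 / ((\<mu> ^ w)\<^sup>2 * \<gamma>\<^sup>2)) \<le> real m\<^sub>0"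
proof -
  have "\<Lambda> * (2 * (real (2 * n + 1) ^ w)\<^sup>2 / ((\<mu> ^ w)\<^sup>2 * \<gamma>\<^sup>2)) =
      2 * real w * real (2 * n + 1) ^ (2 * w) / (\<mu> ^ (2 * w) * \<gamma>\<^sup>2) * ln (4 * real (2 * n + 1) / \<delta>)"
    by (simp add: \<Lambda>_def power_even_eq)
  then show ?thesis unfolding m0_def learn_samples_def by linarith
qed

lemma m0_pos: "0 < m\<^sub>0"
proof -
  have "0 < \<Lambda> * (2 * (real (2 * n + 1) ^ w)\<^sup>2 / ((\<mu> ^ w)\<^sup>2 * \<gamma>\<^sup>2))"
    using \<Lambda>_pos mu ga by (intro mult_pos_pos divide_pos_pos) auto
  then show ?thesis using m0_ge by linarith
qed

lemma m0_\<tau>_square: "\<Lambda> \<le> 2 * real m\<^sub>0 * \<tau>\<^sup>2"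
proof -
  have "\<Lambda> = 2 * (\<Lambda> * (2 * (real (2 * n + 1) ^ w)\<^sup>2 / ((\<mu> ^ w)\<^sup>2 * \<gamma>\<^sup>2))) * \<tau>\<^sup>2"
    using mu ga by (simp add: \<tau>_def power_divide power_mult_distrib)
  also have "\<dots> \<le> 2 * real m\<^sub>0 * \<tau>\<^sup>2" using m0_ge by (intro mult_right_mono) auto
  finally show ?thesis .
qed

text \<open>The multiplicative bound has exponent \<open>\<tau> * m\<^sub>0 / 6\<close>. Since
  \<open>\<tau> * m\<^sub>0\<close> is at least \<Lambda> times
  \<open>(2 * n + 1) ^ w / (\<mu> ^ w * \<gamma>)\<close>, the factor 6 comes from
  \<open>2 * n + 1 \<ge> 3\<close> and \<open>\<gamma> \<le> 1 / 2\<close>.\<close>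

lemma m0_\<tau>:
  assumes "\<gamma> \<le> 1 / 2"
  shows "6 * \<Lambda> \<le> \<tau> * real m\<^sub>0"
proof -
  let ?N = "real (2 * n + 1) ^ w"
  have "3 ^ 1 \<le> ?N"
  proof -
    have "(3::real) ^ 1 \<le> 3 ^ w" using w_pos by (intro power_increasing) auto
    also have "\<dots> \<le> ?N" using n by (intro power_mono) auto
    finally show ?thesis .
  qed
  moreover have "\<mu> ^ w * \<gamma> \<le> 1 * (1 / 2)" using mu ga assms by (intro mult_mono power_le_one) auto
  moreover have "0 < \<mu> ^ w * \<gamma>" using mu ga by simp
  ultimately have "6 \<le> ?N / (\<mu> ^ w * \<gamma>)" by (simp add: le_divide_eq)
  then have "\<Lambda> * 6 \<le> \<Lambda> * (?N / (\<mu> ^ w * \<gamma>))" using \<Lambda>_pos by (intro mult_left_mono) auto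
  also have "\<dots> = \<tau> * (\<Lambda> * (2 * ?N\<^sup>2 / ((\<mu> ^ w)\<^sup>2 * \<gamma>\<^sup>2)))"
    using mu ga by (simp add: \<tau>_def power2_eq_square field_simps)
  also have "\<dots> \<le> \<tau> * real m\<^sub>0" using m0_ge \<tau>_pos by (intro mult_left_mono) auto
  finally show ?thesis by simp
qed

section \<open>Case (1): rejection\<close>

lemma prob_learned_invalid:
  "measure_pmf.prob (replicate_pmf m\<^sub>0 M) {xs. \<not> (\<forall>C\<in>learned_cnf n w \<tau> m\<^sub>0 xs.
      measure_pmf.prob M {\<rho>. witnessed_false \<rho> C} \<le> 2 * \<tau>)} \<le> \<delta> / 4"
proof -
  let ?q = "\<lambda>C. measure_pmf.prob M {\<rho>. witnessed_false \<rho> C}"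
  let ?R = "\<lambda>C xs. real (length (filter (\<lambda>\<rho>. witnessed_false \<rho> C) xs)) \<le> \<tau> * real m\<^sub>0 \<and> 2 * \<tau> < ?q C"
  have "{xs. \<not> (\<forall>C\<in>learned_cnf n w \<tau> m\<^sub>0 xs. ?q C \<le> 2 * \<tau>)} =
      {xs. \<exists>C. C \<subseteq> lits n \<and> card C \<le> w \<and> ?R C xs}"
    by (auto simp: learned_cnf_def not_le)
  also have "measure_pmf.prob (replicate_pmf m\<^sub>0 M) \<dots> \<le> real (2 * n + 1) ^ w * exp (- \<Lambda>)"
  proof (rule prob_narrow_clauses_le)
    fix C
    show "measure_pmf.prob (replicate_pmf m\<^sub>0 M) {xs. ?R C xs} \<le> exp (- \<Lambda>)"
    proof (cases "2 * \<tau> < ?q C")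
      case True
      \<comment> \<open>A clause whose frequency exceeds twice the threshold is learned only after a
        deviation of at least \<tau>, so the additive bound is enough here.\<close>
      then have "measure_pmf.prob (replicate_pmf m\<^sub>0 M) {xs. ?R C xs} \<le> exp (- 2 * real m\<^sub>0 * \<tau>\<^sup>2)"
        using prob_count_le[OF m0_pos, of \<tau> \<tau> M "\<lambda>\<rho>. witnessed_false \<rho> C"] \<tau>_pos by simp
      also have "\<dots> \<le> exp (- \<Lambda>)" using m0_\<tau>_square by simp
      finally show ?thesis .
    qed simp
  qed simp
  also have "\<dots> \<le> \<delta> / 4" by (rule union_bound)
  finally show ?thesis .
qed

text \<open>Masking lowers the frequency by the factor \<open>\<mu> ^ card C\<close>, which is at
  least \<open>\<mu> ^ w\<close>. Tautologies may be learned as well, but they are never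
  false.\<close>

lemma false_prob_le_of_rarely_witnessed:
  assumes "C \<subseteq> lits n" "card C \<le> w" "measure_pmf.prob M {\<rho>. witnessed_false \<rho> C} \<le> 2 * \<tau>"
  shows "false_prob D C \<le> \<gamma> / real (2 * n + 1) ^ w"
proof (cases "taut C")
  case True
  then show ?thesis using ga by (simp add: false_prob_def clause_true_taut)
next
  case False
  have "\<mu> ^ w * false_prob D C \<le> \<mu> ^ card C * false_prob D C"
    using mu assms(2) by (intro mult_right_mono power_decreasing) (auto simp: false_prob_nonneg)
  also have "\<dots> \<le> 2 * \<tau>"
    using prob_witnessed_false[OF assms(1) False, of \<mu> D] assms(3) mu by simp
  also have "\<dots> = \<mu> ^ w * (\<gamma> / real (2 * n + 1) ^ w)" by (simp add: \<tau>_def)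
  finally have "\<mu> ^ w * false_prob D C \<le> \<mu> ^ w * (\<gamma> / real (2 * n + 1) ^ w)" .
  moreover have "0 < \<mu> ^ w" using mu by simp
  ultimately show ?thesis by (rule mult_left_le_imp_le)
qed

text \<open>All learned clauses hold together except with probability \<gamma>. Where the query
  holds as well, so does its simplification, and no restriction agreeing with the example can be
  refuted. Of the margin \<open>2 * \<gamma>\<close> one half remains for the test.\<close>

lemma prob_not_refuted_ge:
  assumes "\<epsilon> + 2 * \<gamma> \<le> measure_pmf.prob D {x. cnf_true x (cnf_of \<phi>)}"
    and "\<forall>C\<in>learned_cnf n w \<tau> m\<^sub>0 xs. measure_pmf.prob M {\<rho>. witnessed_false \<rho> C} \<le> 2 * \<tau>"
  shows "\<epsilon> + \<gamma> \<le> measure_pmf.prob M {\<rho>. \<not> refuted xs \<rho>}"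
proof -
  let ?\<psi> = "cnf_of (\<Psi> xs)"
  let ?A = "\<lambda>x. cnf_true x ?\<psi> \<and> cnf_true x (cnf_of \<phi>)"
  have sub: "?\<psi> \<subseteq> {C. C \<subseteq> lits n \<and> card C \<le> w}" by (auto simp: cnf_of_\<Psi> learned_cnf_def)
  have fin: "finite ?\<psi>" by (rule finite_subset[OF sub finite_narrow_clauses])
  have "card ?\<psi> \<le> (2 * n + 1) ^ w"
    by (rule order_trans[OF card_mono[OF finite_narrow_clauses sub] card_narrow_clauses_le])
  then have card: "real (card ?\<psi>) \<le> real (2 * n + 1) ^ w" by (metis of_nat_le_iff of_nat_power)
  let ?F = "\<Union>C\<in>?\<psi>. {x. \<not> clause_true x C}"
  have "measure_pmf.prob D ?F \<le> (\<Sum>C\<in>?\<psi>. false_prob D C)"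
    unfolding false_prob_def using fin by (intro measure_UNION_le) auto
  also have "\<dots> \<le> (\<Sum>C\<in>?\<psi>. \<gamma> / real (2 * n + 1) ^ w)"
    using sub assms(2) by (intro sum_mono false_prob_le_of_rarely_witnessed) (auto simp: cnf_of_\<Psi>)
  also have "\<dots> = real (card ?\<psi>) * (\<gamma> / real (2 * n + 1) ^ w)" by simp
  also have "\<dots> \<le> real (2 * n + 1) ^ w * (\<gamma> / real (2 * n + 1) ^ w)"
    using card ga by (intro mult_right_mono) auto
  finally have F: "measure_pmf.prob D ?F \<le> \<gamma>" by simp
  have "\<epsilon> + 2 * \<gamma> \<le> measure_pmf.prob D ({x. ?A x} \<union> ?F)"
    by (rule order_trans[OF assms(1)], intro measure_pmf.finite_measure_mono) (auto simp: cnf_true_def)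
  also have "\<dots> \<le> measure_pmf.prob D {x. ?A x} + measure_pmf.prob D ?F"
    by (intro measure_Un_le) auto
  finally have "\<epsilon> + \<gamma> \<le> measure_pmf.prob D {x. ?A x}" using F by linarith
  also have "\<dots> \<le> measure_pmf.prob M {\<rho>. \<not> refuted xs \<rho>}"
  proof (rule prob_le_prob_masked)
    fix x keep assume A: "?A x"
    then have "cnf_true x (cnf_of (\<Phi> xs))" unfolding \<Phi>_def by (intro cnf_true_simplify) auto
    with A have "cnf_true x (cnf_of (\<Phi> xs) \<union> ?\<psi>)" by (auto simp: cnf_true_def)
    then show "\<not> refuted xs (hide keep x)"
      unfolding refuted_def by (intro no_refutation_of_restriction[of x]) (auto simp: extends_def hide_def)
  qed
  finally show ?thesis .
qed

lemma reject:
  assumes "\<epsilon> + 2 * \<gamma> \<le> measure_pmf.prob D {x. cnf_true x (cnf_of \<phi>)}"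
  shows "1 - \<delta> \<le> measure_pmf.prob (replicate_pmf (m\<^sub>0 + m\<^sub>1) M)
    {\<rho>s. val (learn_res n \<mu> \<phi> s \<epsilon> \<delta> \<gamma> \<beta> \<rho>s) = Reject}"
proof -
  let ?P = "replicate_pmf (m\<^sub>0 + m\<^sub>1) M"
  let ?acc = "{\<rho>s. val (learn_res n \<mu> \<phi> s \<epsilon> \<delta> \<gamma> \<beta> \<rho>s) = Accept}"
  have "measure_pmf.prob ?P ?acc \<le> \<delta> / 4 + \<delta> / 2"
    unfolding accept_iff
  proof (rule prob_split_samples[OF prob_learned_invalid])
    fix xs assume "\<forall>C\<in>learned_cnf n w \<tau> m\<^sub>0 xs. measure_pmf.prob M {\<rho>. witnessed_false \<rho> C} \<le> 2 * \<tau>"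
    from prob_not_refuted_ge[OF assms this]
    have "measure_pmf.prob (replicate_pmf m\<^sub>1 M)
        {ys. real (length (filter (\<lambda>\<rho>. \<not> refuted xs \<rho>) ys)) \<le> \<epsilon> * real m\<^sub>1} \<le> exp (- 2 * real m\<^sub>1 * \<gamma>\<^sup>2)"
      using ga by (intro prob_count_le m1_pos) auto
    then show "measure_pmf.prob (replicate_pmf m\<^sub>1 M)
        {ys. real (length (filter (\<lambda>\<rho>. \<not> refuted xs \<rho>) ys)) \<le> \<epsilon> * real m\<^sub>1} \<le> \<delta> / 2"
      using exp_m1 by linarith
  qed (use de in auto)
  moreover have "{\<rho>s. val (learn_res n \<mu> \<phi> s \<epsilon> \<delta> \<gamma> \<beta> \<rho>s) = Reject} = UNIV - ?acc"
  proof -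
    have "v = Reject \<longleftrightarrow> v \<noteq> Accept" for v by (cases v) auto
    then show ?thesis by auto
  qed
  moreover have "measure_pmf.prob ?P (UNIV - ?acc) = 1 - measure_pmf.prob ?P ?acc"
    using measure_pmf.prob_compl[of ?acc ?P] by simp
  ultimately show ?thesis using de by simp
qed

section \<open>Case (2): acceptance\<close>

context
  fixes \<eta> :: real
  assumes eta_def: "\<eta> = \<gamma> / (4 * real n * real (2 * n + 1) ^ w)"
    and gap: "correlation_gap n w \<beta> (1 - \<eta>) D"
begin

lemma eta_pos: "0 < \<eta>"
  using n ga by (simp add: eta_def)

lemma eta_small: "(real n + 1) * \<eta> < 1"
proof -
  have "real n + 1 \<le> 2 * real n" using n by simp
  moreover have "1 \<le> real (2 * n + 1) ^ w" by (intro one_le_power) simp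
  ultimately have "(real n + 1) * 1 \<le> (2 * real n) * real (2 * n + 1) ^ w" by (intro mult_mono) auto
  then have "(real n + 1) / (4 * real n * real (2 * n + 1) ^ w) \<le> 1 / 2"
    using n by (simp add: field_simps)
  then have "\<gamma> * ((real n + 1) / (4 * real n * real (2 * n + 1) ^ w)) \<le> 1 * (1 / 2)"
    using ga by (intro mult_mono) auto
  then show ?thesis by (simp add: eta_def mult.commute)
qed

lemma \<tau>_eta: "\<mu> ^ w * (real n * \<eta>) = \<tau> / 2"
  using n by (simp add: eta_def \<tau>_def field_simps)

definition complete :: "cnf \<Rightarrow> bool" where
  "complete \<psi> \<longleftrightarrow> (\<forall>K. K \<subseteq> lits n \<longrightarrow> \<not> taut K \<longrightarrow> card K = w \<longrightarrow> false_prob D K \<le> real n * \<eta> \<longrightarrow> K \<in> \<psi>)"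

text \<open>Missing a clause means exceeding the threshold from an expected frequency of at most
  \<open>\<tau> / 2\<close>. The additive bound with deviation \<open>\<tau> / 2\<close> would
  guarantee only the exponent \<open>\<Lambda> / 4\<close>, too weak for the union bound.\<close>

lemma prob_learned_incomplete:
  assumes "\<gamma> \<le> 1 / 2"
  shows "measure_pmf.prob (replicate_pmf m\<^sub>0 M) {xs. \<not> complete (learned_cnf n w \<tau> m\<^sub>0 xs)} \<le> \<delta> / 4"
proof -
  let ?R = "\<lambda>C xs. \<tau> * real m\<^sub>0 < real (length (filter (\<lambda>\<rho>. witnessed_false \<rho> C) xs)) \<and>
      \<not> taut C \<and> card C = w \<and> false_prob D C \<le> real n * \<eta>"
  have "measure_pmf.prob (replicate_pmf m\<^sub>0 M) {xs. \<not> complete (learned_cnf n w \<tau> m\<^sub>0 xs)} \<le>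
      measure_pmf.prob (replicate_pmf m\<^sub>0 M) {xs. \<exists>C. C \<subseteq> lits n \<and> card C \<le> w \<and> ?R C xs}"
    by (intro measure_pmf.finite_measure_mono) (auto simp: complete_def learned_cnf_def not_le)
  also have "\<dots> \<le> real (2 * n + 1) ^ w * exp (- \<Lambda>)"
  proof (rule prob_narrow_clauses_le)
    fix C assume C: "C \<subseteq> lits n"
    show "measure_pmf.prob (replicate_pmf m\<^sub>0 M) {xs. ?R C xs} \<le> exp (- \<Lambda>)"
    proof (cases "\<not> taut C \<and> card C = w \<and> false_prob D C \<le> real n * \<eta>")
      case True
      then have "\<mu> ^ card C * false_prob D C \<le> \<mu> ^ w * (real n * \<eta>)"
        using mu by (intro mult_mono) (auto simp: false_prob_nonneg)
      then have "measure_pmf.prob M {\<rho>. witnessed_false \<rho> C} \<le> \<tau> / 2"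
        using prob_witnessed_false[OF C, of \<mu> D] True mu \<tau>_eta by simp
      then have "measure_pmf.prob (replicate_pmf m\<^sub>0 M) {xs. ?R C xs} \<le> exp (- (\<tau> * real m\<^sub>0 / 6))"
        using prob_count_gt_twice[of M "\<lambda>\<rho>. witnessed_false \<rho> C" \<tau> m\<^sub>0] True by simp
      also have "\<dots> \<le> exp (- \<Lambda>)" using m0_\<tau>[OF assms] by simp
      finally show ?thesis .
    next
      case False
      then have none: "{xs. ?R C xs} = {}" by auto
      show ?thesis by (simp only: none measure_empty exp_ge_zero)
    qed
  qed simp
  also have "\<dots> \<le> \<delta> / 4" by (rule union_bound)
  finally show ?thesis .
qed

text \<open>The width is chosen to make \<open>(1 - \<mu> * \<beta>) ^ w\<close> at most
  \<open>\<delta> / (2 * m\<^sub>1 * s)\<close>, and the union bound runs over \<open>s\<close>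
  clauses and \<open>m\<^sub>1\<close> samples. If the cap \<open>w = n\<close> is attained, every
  clause is tame, since a non-tautological one has at most \<open>n\<close> literals.\<close>

lemma prob_some_not_tame:
  assumes "length Cs \<le> s" "\<And>C. C \<in> set Cs \<Longrightarrow> g C \<subseteq> lits n"
  shows "real m\<^sub>1 * measure_pmf.prob M {\<rho>. \<exists>C\<in>set Cs. \<not> tame D \<eta> w \<rho> (g C)} \<le> \<delta> / 2"
proof (cases "w = n")
  case True
  then have "tame D \<eta> w \<rho> (g C)" if "C \<in> set Cs" for C \<rho>
    using card_nontaut_le assms(2)[OF that] by (auto simp: tame_def)
  then have "{\<rho>. \<exists>C\<in>set Cs. \<not> tame D \<eta> w \<rho> (g C)} = {}" by auto
  then show ?thesis using de by simp
next
  case False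
  let ?r = "2 * real m\<^sub>1 * real s / \<delta>"
  have r: "0 < ?r" using m1_pos s de by simp
  have mub: "0 < \<mu> * \<beta>" "\<mu> * \<beta> \<le> 1" using mu be mult_le_one[of \<mu> \<beta>] by auto
  have "w = nat \<lceil>1 / (\<mu> * \<beta>) * ln ?r\<rceil>"
    using False by (simp add: w_def res_width_def m1_def min_def split: if_splits)
  then have "1 / (\<mu> * \<beta>) * ln ?r \<le> real w" by linarith
  then have w: "ln ?r \<le> \<mu> * \<beta> * real w" using mub by (simp add: field_simps)
  have "(1 - \<mu> * \<beta>) ^ w \<le> exp (- (\<mu> * \<beta>)) ^ w"
    using mub exp_ge_add_one_self[of "- (\<mu> * \<beta>)"] by (intro power_mono) auto
  also have "\<dots> = exp (- (\<mu> * \<beta> * real w))" by (simp add: exp_of_nat_mult[symmetric] mult_ac)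
  also have "\<dots> \<le> exp (- ln ?r)" using w by simp
  also have "\<dots> = 1 / ?r" using r by (simp add: exp_minus inverse_eq_divide)
  finally have pow: "(1 - \<mu> * \<beta>) ^ w \<le> 1 / ?r" .
  have "{\<rho>. \<exists>C\<in>set Cs. \<not> tame D \<eta> w \<rho> (g C)} = (\<Union>C\<in>set Cs. {\<rho>. \<not> tame D \<eta> w \<rho> (g C)})" by auto
  then have "measure_pmf.prob M {\<rho>. \<exists>C\<in>set Cs. \<not> tame D \<eta> w \<rho> (g C)} \<le>
      (\<Sum>C\<in>set Cs. measure_pmf.prob M {\<rho>. \<not> tame D \<eta> w \<rho> (g C)})"
    using measure_UNION_le[of "set Cs" "\<lambda>C. {\<rho>. \<not> tame D \<eta> w \<rho> (g C)}" M] by simp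
  also have "\<dots> \<le> (\<Sum>C\<in>set Cs. 1 / ?r)"
  proof (rule sum_mono)
    fix C assume "C \<in> set Cs"
    then have "measure_pmf.prob M {\<rho>. \<not> tame D \<eta> w \<rho> (g C)} \<le> (1 - \<mu> * \<beta>) ^ w"
      using eta_pos mu be by (intro prob_not_tame[OF gap] assms(2)) auto
    with pow show "measure_pmf.prob M {\<rho>. \<not> tame D \<eta> w \<rho> (g C)} \<le> 1 / ?r" by linarith
  qed
  also have "\<dots> = real (card (set Cs)) * (1 / ?r)" by simp
  also have "\<dots> \<le> real s * (1 / ?r)"
    using de card_length[of Cs] assms(1) by (intro mult_right_mono) auto
  finally have "real m\<^sub>1 * measure_pmf.prob M {\<rho>. \<exists>C\<in>set Cs. \<not> tame D \<eta> w \<rho> (g C)} \<le>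
      real m\<^sub>1 * (real s * (1 / ?r))"
    by (intro mult_left_mono) auto
  also have "\<dots> = \<delta> / 2" using m1_pos s by simp
  finally show ?thesis .
qed

lemma refuted_of_tame:
  assumes "complete (learned_cnf n w \<tau> m\<^sub>0 xs)"
    and ref: "resolution_refutation n (\<psi>\<^sub>0 \<union> \<psi>\<^sub>1 \<union> cnf_of \<phi>) Cs"
    and valid: "\<forall>C\<in>\<psi>\<^sub>0. clause_valid D (1 - \<eta>) C"
    and f: "\<And>C. C \<in> cnf_of \<phi> \<Longrightarrow> f C \<in> cnf_of (\<Phi> xs) \<and> f C \<subseteq> C \<and> irreducible_by (cnf_of (\<Psi> xs)) (f C)"
    and wit: "cnf_witnessed_true \<rho> \<psi>\<^sub>1"
    and tame: "\<And>C. C \<in> set Cs \<Longrightarrow> tame D \<eta> w \<rho> (if C \<in> cnf_of \<phi> then f C else C)"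
  shows "refuted xs \<rho>"
proof (cases "\<exists>C\<in>cnf_of (\<Phi> xs) \<union> cnf_of (\<Psi> xs). witnessed_false \<rho> C")
  \<comment> \<open>A clause witnessed false turns the restriction into the contradiction, which is
    refuted by its empty axiom; the simulation covers the remaining case.\<close>
  case True
  then have "restrict_cnf \<rho> (cnf_of (\<Phi> xs) \<union> cnf_of (\<Psi> xs)) = {{}}" by (simp add: restrict_cnf_def)
  then show ?thesis by (simp add: refuted_def has_refutation_contradiction)
next
  case False
  interpret learned_restriction n w D \<eta> "cnf_of (\<Psi> xs)" "cnf_of (\<Phi> xs)" \<rho>
  proof unfold_locales
    show "K \<in> cnf_of (\<Psi> xs)"
      if "K \<subseteq> lits n" "\<not> taut K" "card K = w" "false_prob D K \<le> real n * \<eta>" for K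
      using assms(1) that unfolding complete_def cnf_of_\<Psi> by blast
    show "\<forall>C\<in>cnf_of (\<Phi> xs) \<union> cnf_of (\<Psi> xs). \<not> witnessed_false \<rho> C" using False by blast
  qed (use w_pos w_le_n eta_pos eta_small in simp_all)
  have "false_prob D C \<le> \<eta>" if "C \<in> \<psi>\<^sub>0" for C
  proof -
    have "measure_pmf.prob D {x. clause_true x C} \<ge> 1 - \<eta>"
      using valid that by (simp add: clause_valid_def)
    moreover have "{x. \<not> clause_true x C} = UNIV - {x. clause_true x C}" by auto
    ultimately show ?thesis
      unfolding false_prob_def using measure_pmf.prob_compl[of "{x. clause_true x C}" D] by simp
  qed
  from simulate_refutation[OF ref this wit f tame] show ?thesis by (simp add: refuted_def)
qed

lemma accept:
  assumes wit: "1 - \<epsilon> + 2 * \<gamma> \<le> measure_pmf.prob M {\<rho>. cnf_witnessed_true \<rho> \<psi>\<^sub>1}"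
    and ref: "resolution_refutation n (\<psi>\<^sub>0 \<union> \<psi>\<^sub>1 \<union> cnf_of \<phi>) Cs" "length Cs \<le> s"
    and valid: "\<forall>C\<in>\<psi>\<^sub>0. clause_valid D (1 - \<eta>) C"
  shows "1 - \<delta> \<le> measure_pmf.prob (replicate_pmf (m\<^sub>0 + m\<^sub>1) M)
    {\<rho>s. val (learn_res n \<mu> \<phi> s \<epsilon> \<delta> \<gamma> \<beta> \<rho>s) = Accept}"
proof -
  let ?P = "replicate_pmf (m\<^sub>0 + m\<^sub>1) M"
  let ?acc = "{\<rho>s. val (learn_res n \<mu> \<phi> s \<epsilon> \<delta> \<gamma> \<beta> \<rho>s) = Accept}"
  let ?R = "\<lambda>xs ys. \<not> real (length (filter (\<lambda>\<rho>. \<not> refuted xs \<rho>) ys)) \<le> \<epsilon> * real m\<^sub>1"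
  \<comment> \<open>A probability of at least \<open>1 - \<epsilon> + 2 * \<gamma>\<close> forces
    \<open>2 * \<gamma> \<le> \<epsilon>\<close>.\<close>
  have "1 - \<epsilon> + 2 * \<gamma> \<le> 1" using wit measure_pmf.prob_le_1[of M] by (meson order_trans)
  then have ga_half: "\<gamma> \<le> 1 / 2" using ep by simp
  \<comment> \<open>The error is shared out as \<open>\<delta> / 4\<close> for incomplete learning,
    \<open>\<delta> / 2\<close> for a test sample on which some clause is not tame, and
    \<open>\<delta> / 4\<close> for too many samples on which \<open>\<psi>\<^sub>1\<close> is not
    witnessed.\<close>
  have "measure_pmf.prob ?P {\<rho>s. ?R (take m\<^sub>0 \<rho>s) (drop m\<^sub>0 \<rho>s)} \<le> \<delta> / 4 + (\<delta> / 2 + \<delta> / 4)"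
  proof (rule prob_split_samples[OF prob_learned_incomplete[OF ga_half]])
    fix xs assume comp: "complete (learned_cnf n w \<tau> m\<^sub>0 xs)"
    \<comment> \<open>The simplified clauses are fixed together with \<open>xs\<close>, so
      \<open>g\<close> does not depend on the test samples.\<close>
    have "\<forall>C\<in>cnf_of \<phi>. \<exists>B. B \<in> cnf_of (\<Phi> xs) \<and> B \<subseteq> C \<and> irreducible_by (cnf_of (\<Psi> xs)) B"
      using simplify_irreducible[of _ \<phi> "\<Psi> xs"] unfolding \<Phi>_def by blast
    from bchoice[OF this] obtain f
      where f: "\<And>C. C \<in> cnf_of \<phi> \<Longrightarrow> f C \<in> cnf_of (\<Phi> xs) \<and> f C \<subseteq> C \<and> irreducible_by (cnf_of (\<Psi> xs)) (f C)"
      by blast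
    define g where "g C = (if C \<in> cnf_of \<phi> then f C else C)" for C
    let ?bad = "\<lambda>\<rho>. \<exists>C\<in>set Cs. \<not> tame D \<eta> w \<rho> (g C)"
    let ?unwit = "\<lambda>\<rho>. \<not> cnf_witnessed_true \<rho> \<psi>\<^sub>1"
    have g: "g C \<subseteq> lits n" if "C \<in> set Cs" for C
    proof -
      have "C \<subseteq> lits n" using ref(1) that unfolding resolution_refutation_def by (metis in_set_conv_nth)
      then show ?thesis using f by (auto simp: g_def)
    qed
    have ok: "refuted xs \<rho>" if "\<not> ?bad \<rho>" "\<not> ?unwit \<rho>" for \<rho>
      using that by (intro refuted_of_tame[OF comp ref(1) valid f]) (auto simp: g_def)
    have sub: "{ys. ?R xs ys} \<subseteq> {ys. \<exists>\<rho>\<in>set ys. ?bad \<rho>} \<union> {ys. \<epsilon> * real m\<^sub>1 \<le> real (length (filter ?unwit ys))}"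
    proof (intro subsetI UnCI)
      fix ys assume R: "ys \<in> {ys. ?R xs ys}" and nb: "ys \<notin> {ys. \<epsilon> * real m\<^sub>1 \<le> real (length (filter ?unwit ys))}"
      show "ys \<in> {ys. \<exists>\<rho>\<in>set ys. ?bad \<rho>}"
      proof (rule ccontr)
        assume "ys \<notin> {ys. \<exists>\<rho>\<in>set ys. ?bad \<rho>}"
        then have "\<And>\<rho>. \<rho> \<in> set ys \<Longrightarrow> \<not> refuted xs \<rho> \<Longrightarrow> ?unwit \<rho>" using ok by blast
        then have "length (filter (\<lambda>\<rho>. \<not> refuted xs \<rho>) ys) \<le> length (filter ?unwit ys)"
          by (induction ys) auto
        with R nb show False by auto
      qed
    qed
    have "measure_pmf.prob (replicate_pmf m\<^sub>1 M) {ys. \<exists>\<rho>\<in>set ys. ?bad \<rho>} \<le> \<delta> / 2"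
      by (rule order_trans[OF prob_exists_sample prob_some_not_tame[OF ref(2)]]) (rule g)
    moreover have "measure_pmf.prob (replicate_pmf m\<^sub>1 M)
        {ys. \<epsilon> * real m\<^sub>1 \<le> real (length (filter ?unwit ys))} \<le> \<delta> / 4"
    proof -
      have "measure_pmf.prob M {\<rho>. ?unwit \<rho>} = 1 - measure_pmf.prob M {\<rho>. cnf_witnessed_true \<rho> \<psi>\<^sub>1}"
      proof -
        have "{\<rho>. ?unwit \<rho>} = UNIV - {\<rho>. cnf_witnessed_true \<rho> \<psi>\<^sub>1}" by auto
        then show ?thesis using measure_pmf.prob_compl[of "{\<rho>. cnf_witnessed_true \<rho> \<psi>\<^sub>1}" M] by simp
      qed
      then have "measure_pmf.prob (replicate_pmf m\<^sub>1 M)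
          {ys. \<epsilon> * real m\<^sub>1 \<le> real (length (filter ?unwit ys))} \<le> exp (- 2 * real m\<^sub>1 * (2 * \<gamma>)\<^sup>2)"
        using wit ga by (intro prob_count_ge m1_pos) auto
      \<comment> \<open>The margin is \<open>2 * \<gamma>\<close> here, so the exponent is four
        times the one to which \<open>m\<^sub>1\<close> is tuned; this pays for the smaller share
        \<open>\<delta> / 4\<close>.\<close>
      also have "\<dots> = exp (- 2 * real m\<^sub>1 * \<gamma>\<^sup>2) ^ 4"
        by (simp add: exp_of_nat_mult[symmetric] power_mult_distrib)
      also have "\<dots> \<le> (\<delta> / 2) ^ 4" using exp_m1 by (intro power_mono) auto
      also have "\<dots> \<le> (\<delta> / 2) ^ 2" using de by (intro power_decreasing) auto
      also have "\<dots> \<le> \<delta> / 4" using de mult_left_le[of \<delta> \<delta>] by (simp add: power2_eq_square)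
      finally show ?thesis .
    qed
    moreover have "measure_pmf.prob (replicate_pmf m\<^sub>1 M) {ys. ?R xs ys} \<le>
        measure_pmf.prob (replicate_pmf m\<^sub>1 M) {ys. \<exists>\<rho>\<in>set ys. ?bad \<rho>} +
        measure_pmf.prob (replicate_pmf m\<^sub>1 M) {ys. \<epsilon> * real m\<^sub>1 \<le> real (length (filter ?unwit ys))}"
      by (rule order_trans[OF measure_pmf.finite_measure_mono[OF sub] measure_Un_le]) auto
    ultimately show "measure_pmf.prob (replicate_pmf m\<^sub>1 M) {ys. ?R xs ys} \<le> \<delta> / 2 + \<delta> / 4"
      by linarith
  qed (use de in auto)
  moreover have "{\<rho>s. ?R (take m\<^sub>0 \<rho>s) (drop m\<^sub>0 \<rho>s)} = UNIV - ?acc" by (auto simp: accept_iff)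
  moreover have "measure_pmf.prob ?P (UNIV - ?acc) = 1 - measure_pmf.prob ?P ?acc"
    using measure_pmf.prob_compl[of ?acc ?P] by simp
  ultimately show ?thesis by simp
qed

end

end

theorem theorem3:
  shows "\<exists>c>0. \<forall>(n::nat) (p :: nat \<Rightarrow> nat) (\<phi> :: lit list list) (D :: assignment pmf)
      \<mu> \<epsilon> \<gamma> \<delta> \<beta> w m\<^sub>0 m\<^sub>1 (\<eta>::real).
    n \<ge> 1 \<longrightarrow> p n \<ge> 1 \<longrightarrow> cnf_over n (cnf_of \<phi>) \<longrightarrow>
    \<mu> \<in> {0<..<1} \<longrightarrow> \<epsilon> \<in> {0<..<1} \<longrightarrow> \<gamma> \<in> {0<..<1} \<longrightarrow> \<delta> \<in> {0<..<1} \<longrightarrow> \<beta> \<in> {0<..<1} \<longrightarrow>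
    m\<^sub>1 = test_samples \<gamma> \<delta> \<longrightarrow>
    w = res_width n \<mu> \<beta> \<gamma> \<delta> (p n) \<longrightarrow>
    m\<^sub>0 = learn_samples n w \<mu> \<gamma> \<delta> \<longrightarrow>
    \<eta> = \<gamma> / (4 * real n * real (2 * n + 1) ^ w) \<longrightarrow>
    distribution_over n D \<longrightarrow> correlation_gap n w \<beta> (1 - \<eta>) D \<longrightarrow>
      (\<P>(x in D. cnf_true x (cnf_of \<phi>)) \<ge> \<epsilon> + 2 * \<gamma> \<longrightarrow>
         \<P>(\<rho>s in sample n \<mu> D (m\<^sub>0 + m\<^sub>1). val (learn_res n \<mu> \<phi> (p n) \<epsilon> \<delta> \<gamma> \<beta> \<rho>s) = Reject) \<ge> 1 - \<delta>) \<and>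
      ((\<exists>\<psi>\<^sub>0 \<psi>\<^sub>1. cnf_over n \<psi>\<^sub>0 \<and> cnf_over n \<psi>\<^sub>1 \<and>
           (\<forall>C\<in>\<psi>\<^sub>0. clause_valid D (1 - \<eta>) C) \<and>
           \<P>(\<rho> in masked n \<mu> D. cnf_witnessed_true \<rho> \<psi>\<^sub>1) \<ge> 1 - \<epsilon> + 2 * \<gamma> \<and>
           (\<exists>Cs. resolution_refutation n (\<psi>\<^sub>0 \<union> \<psi>\<^sub>1 \<union> cnf_of \<phi>) Cs \<and> length Cs \<le> p n)) \<longrightarrow>
         \<P>(\<rho>s in sample n \<mu> D (m\<^sub>0 + m\<^sub>1). val (learn_res n \<mu> \<phi> (p n) \<epsilon> \<delta> \<gamma> \<beta> \<rho>s) = Accept) \<ge> 1 - \<delta>) \<and>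
      (n \<ge> 2 \<longrightarrow> p n \<ge> 2 \<longrightarrow>
         (\<forall>\<rho>s. length \<rho>s = m\<^sub>0 + m\<^sub>1 \<longrightarrow>
            real (time (learn_res n \<mu> \<phi> (p n) \<epsilon> \<delta> \<gamma> \<beta> \<rho>s))
              \<le> real (cnf_size \<phi> + 1) *
                 real n powr (c * (1 / (\<mu> * \<beta>) * ln (real (p n) / (\<gamma> * \<delta>))))))"
proof (intro exI[of _ "1862::real"] conjI[of "0 < (1862::real)"] allI impI)
  fix n :: nat and p :: "nat \<Rightarrow> nat" and \<phi> :: "lit list list" and D :: "assignment pmf"
    and \<mu> \<epsilon> \<gamma> \<delta> \<beta> :: real and w m\<^sub>0 m\<^sub>1 :: nat and \<eta> :: real
  assume n: "n \<ge> 1" and p: "p n \<ge> 1" and over: "cnf_over n (cnf_of \<phi>)"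
    and mu: "\<mu> \<in> {0<..<1}" and ep: "\<epsilon> \<in> {0<..<1}" and ga: "\<gamma> \<in> {0<..<1}"
    and de: "\<delta> \<in> {0<..<1}" and be: "\<beta> \<in> {0<..<1}"
    and m1: "m\<^sub>1 = test_samples \<gamma> \<delta>" and w: "w = res_width n \<mu> \<beta> \<gamma> \<delta> (p n)"
    and m0: "m\<^sub>0 = learn_samples n w \<mu> \<gamma> \<delta>"
    and eta: "\<eta> = \<gamma> / (4 * real n * real (2 * n + 1) ^ w)"
    and gap: "correlation_gap n w \<beta> (1 - \<eta>) D"
  interpret learn_res_setting n "p n" \<phi> D \<mu> \<epsilon> \<gamma> \<delta> \<beta> w m\<^sub>0 m\<^sub>1
    using n p over mu ep ga de be m1 w m0 by unfold_locales
  have rej: "\<P>(\<rho>s in sample n \<mu> D (m\<^sub>0 + m\<^sub>1). val (learn_res n \<mu> \<phi> (p n) \<epsilon> \<delta> \<gamma> \<beta> \<rho>s) = Reject) \<ge> 1 - \<delta>"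
    if "\<P>(x in D. cnf_true x (cnf_of \<phi>)) \<ge> \<epsilon> + 2 * \<gamma>"
    using reject that by (simp add: sample_def)
  have acc: "\<P>(\<rho>s in sample n \<mu> D (m\<^sub>0 + m\<^sub>1). val (learn_res n \<mu> \<phi> (p n) \<epsilon> \<delta> \<gamma> \<beta> \<rho>s) = Accept) \<ge> 1 - \<delta>"
    if "\<exists>\<psi>\<^sub>0 \<psi>\<^sub>1. cnf_over n \<psi>\<^sub>0 \<and> cnf_over n \<psi>\<^sub>1 \<and>
           (\<forall>C\<in>\<psi>\<^sub>0. clause_valid D (1 - \<eta>) C) \<and>
           \<P>(\<rho> in masked n \<mu> D. cnf_witnessed_true \<rho> \<psi>\<^sub>1) \<ge> 1 - \<epsilon> + 2 * \<gamma> \<and>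
           (\<exists>Cs. resolution_refutation n (\<psi>\<^sub>0 \<union> \<psi>\<^sub>1 \<union> cnf_of \<phi>) Cs \<and> length Cs \<le> p n)"
  proof -
    from that obtain \<psi>\<^sub>0 \<psi>\<^sub>1 Cs where *: "\<forall>C\<in>\<psi>\<^sub>0. clause_valid D (1 - \<eta>) C"
      "\<P>(\<rho> in masked n \<mu> D. cnf_witnessed_true \<rho> \<psi>\<^sub>1) \<ge> 1 - \<epsilon> + 2 * \<gamma>"
      "resolution_refutation n (\<psi>\<^sub>0 \<union> \<psi>\<^sub>1 \<union> cnf_of \<phi>) Cs" "length Cs \<le> p n" by blast
    show ?thesis
      using accept[OF eta gap _ *(3,4,1)] *(2) by (simp add: sample_def)
  qed
  have tim: "real (time (learn_res n \<mu> \<phi> (p n) \<epsilon> \<delta> \<gamma> \<beta> \<rho>s)) \<le> real (cnf_size \<phi> + 1) *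
      real n powr (1862 * (1 / (\<mu> * \<beta>) * ln (real (p n) / (\<gamma> * \<delta>))))"
    if "n \<ge> 2" "p n \<ge> 2" "length \<rho>s = m\<^sub>0 + m\<^sub>1" for \<rho>s
  proof -
    let ?X = "1 / (\<mu> * \<beta>) * ln (real (p n) / (\<gamma> * \<delta>))"
    \<comment> \<open>A sum that dominates every quantity required of \<open>M\<close> in the time
      bound; the coefficient 100 provides its lower bound.\<close>
    define N where "N = 100 * (2 * n + 1) ^ Suc (2 * w) + 2 * w + (m\<^sub>0 + m\<^sub>1)"
    have "1 \<le> (2 * n + 1) ^ Suc (2 * w)" by (intro one_le_power) simp
    then have N: "100 \<le> N" "(2 * n + 1) ^ Suc (2 * w) \<le> N" "2 * w \<le> N" "m\<^sub>0 + m\<^sub>1 \<le> N"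
      unfolding N_def by linarith+
    have "time (learn_res n \<mu> \<phi> (p n) \<epsilon> \<delta> \<gamma> \<beta> \<rho>s) \<le> N ^ 19 * (cnf_size \<phi> + 1)"
      by (rule time_learn_res) (use N that(3) in \<open>simp_all add: w m0 m1\<close>)
    then have "real (time (learn_res n \<mu> \<phi> (p n) \<epsilon> \<delta> \<gamma> \<beta> \<rho>s)) \<le> real (N ^ 19 * (cnf_size \<phi> + 1))"
      by (rule of_nat_mono)
    also have "\<dots> = real (cnf_size \<phi> + 1) * real N ^ 19" by (simp only: of_nat_mult of_nat_power mult.commute)
    also have "\<dots> \<le> real (cnf_size \<phi> + 1) * (real n powr (98 * ?X)) ^ 19"
      using parameters_le_powr[OF that(1,2) mu be ga de]
      by (intro mult_left_mono power_mono) (simp_all add: N_def w m0 m1)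
    \<comment> \<open>The degree 19 of the time bound times the exponent 98 of the parameters gives
      1862.\<close>
    also have "(real n powr (98 * ?X)) ^ 19 = real n powr (1862 * ?X)"
    proof -
      have "(real n powr (98 * ?X)) ^ 19 = (real n powr (98 * ?X)) powr 19"
        using n by (subst powr_numeral) simp_all
      then show ?thesis by (simp add: powr_powr)
    qed
    finally show ?thesis .
  qed
  show "(\<P>(x in D. cnf_true x (cnf_of \<phi>)) \<ge> \<epsilon> + 2 * \<gamma> \<longrightarrow>
         \<P>(\<rho>s in sample n \<mu> D (m\<^sub>0 + m\<^sub>1). val (learn_res n \<mu> \<phi> (p n) \<epsilon> \<delta> \<gamma> \<beta> \<rho>s) = Reject) \<ge> 1 - \<delta>) \<and>
      ((\<exists>\<psi>\<^sub>0 \<psi>\<^sub>1. cnf_over n \<psi>\<^sub>0 \<and> cnf_over n \<psi>\<^sub>1 \<and>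
           (\<forall>C\<in>\<psi>\<^sub>0. clause_valid D (1 - \<eta>) C) \<and>
           \<P>(\<rho> in masked n \<mu> D. cnf_witnessed_true \<rho> \<psi>\<^sub>1) \<ge> 1 - \<epsilon> + 2 * \<gamma> \<and>
           (\<exists>Cs. resolution_refutation n (\<psi>\<^sub>0 \<union> \<psi>\<^sub>1 \<union> cnf_of \<phi>) Cs \<and> length Cs \<le> p n)) \<longrightarrow>
         \<P>(\<rho>s in sample n \<mu> D (m\<^sub>0 + m\<^sub>1). val (learn_res n \<mu> \<phi> (p n) \<epsilon> \<delta> \<gamma> \<beta> \<rho>s) = Accept) \<ge> 1 - \<delta>) \<and>
      (n \<ge> 2 \<longrightarrow> p n \<ge> 2 \<longrightarrow>
         (\<forall>\<rho>s. length \<rho>s = m\<^sub>0 + m\<^sub>1 \<longrightarrow>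
            real (time (learn_res n \<mu> \<phi> (p n) \<epsilon> \<delta> \<gamma> \<beta> \<rho>s))
              \<le> real (cnf_size \<phi> + 1) *
                 real n powr (1862 * (1 / (\<mu> * \<beta>) * ln (real (p n) / (\<gamma> * \<delta>))))))"
    using rej acc tim by (intro conjI allI impI)
qed simp

end
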